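(* Let $p\in(1,\infty)$, let $(K,d,m)$ be the Sierpiński carpet, and let $(\mathcal E_p,\mathcal F_p)$ be the self-similar $p$-energy on it (see context). There exists a family of finite Borel measures $\{\Gamma_p\langle f\rangle\}_{f\in\mathcal F_p}$ on $K$ satisfying the following. (i) For any $f\in\mathcal F_p$, $\Gamma_p\langle f\rangle(K)=\mathcal E_p(f)$ and $\Gamma_p\langle f\rangle(F_w(K))=\rho(p)^n\mathcal E_p(f\circ F_w)$ for all $w\in S^n$, $n\in\mathbb N$. (ii) (Triangle inequality) For any $f_1,f_2\in\mathcal F_p$ and Borel function $g:K\to[0,\infty]$, $$\Big(\int_Kg\,d\Gamma_p\langle f_1+f_2\rangle\Big)^{1/p}\le\Big(\int_Kg\,d\Gamma_p\langle f_1\rangle\Big)^{1/p}+\Big(\int_Kg\,d\Gamma_p\langle f_2\rangle\Big)^{1/p}.$$ (iii) (Lipschitz contractivity) For any $f\in\mathcal F_p$, Borel function $g:K\to[0,\infty]$ and $1$-Lipschitz function $\varphi:\mathbb R\to\mathbb R$, $\int_Kg\,d\Gamma_p\langle\varphi\circ f\rangle\le\int_Kg\,d\Gamma_p\langle f\rangle$. (iv) (Self-similarity) For any $n\in\mathbb N$ and $f\in\mathcal F_p$, $\Gamma_p\langle f\rangle=\rho(p)^n\sum_{w\in S^n}(F_w)_*\big(\Gamma_p\langle f\circ F_w\rangle\big)$. (v) (Symmetry) For any $f\in\mathcal F_p$ and $\Phi\in D_4$, $\Phi_*\big(\Gamma_p\langle f\rangle\big)=\Gamma_p\langle f\circ\Phi\rangle$.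 (vi) (Chain rule and strong locality) For any $\Psi\in C^1(\mathbb R)$ and $f\in\mathcal F_p\cap C(K)$, $\Gamma_p\langle\Psi\circ f\rangle(dx)=|\Psi'(f(x))|^p\,\Gamma_p\langle f\rangle(dx)$. If $f,g\in\mathcal F_p\cap C(K)$ and a Borel set $A\subseteq K$ satisfy $f-g=a$ on $A$ for some $a\in\mathbb R$, then $\Gamma_p\langle f\rangle(A)=\Gamma_p\langle g\rangle(A)$.
   Context: Sierpiński carpet: let $q_1=(-1,-1)$, $q_2=(0,-1)$, $q_3=(1,-1)$, $q_4=(1,0)$, $q_5=(1,1)$, $q_6=(0,1)$, $q_7=(-1,1)$, $q_8=(-1,0)$ in $\mathbb R^2$, $S=\{1,\dots,8\}$, $f_i(x)=\frac13(x-q_i)+q_i$. $K$ is the unique non-empty compact subset of $\mathbb R^2$ with $K=\bigcup_{i\in S}f_i(K)$; $F_i:=f_i|_K$; $F_w:=F_{w_1}\circ\cdots\circ F_{w_n}$ for $w=w_1\cdots w_n\in S^n$. $d$ is the Euclidean metric on $K$ and $m$ the self-similar Borel probability measure with $m(F_w(K))=8^{-n}$ for $w\in S^n$. $\mathbb N$ = positive integers. $\mathbb G_n=(V_n,E_n)$: $V_n=S^n$, $E_n=\{\{u,v\}:u\ne v\in V_n,\ F_u(K)\cap F_v(K)\ne\emptyset\}$, with graph distance $d_n$; $\mathcal E_p^{\mathbb G_n}(g)=\sum_{\{u,v\}\in E_n}|g(u)-g(v)|^p$; $(M_nf)(u)=\frac1{m(F_u(K))}\int_{F_u(K)}f\,dm$.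 $D_4$ is the order-$8$ dihedral group of linear symmetries of $[-1,1]^2$ (they preserve $K$). $\mu\mapsto T_*\mu=\mu\circ T^{-1}$ denotes push-forward. Scaling factor: for $m,n\in\mathbb N$ and $w\in V_m$ let $S^n(w)\subset V_{n+m}$ be the words whose first $m$ letters form $w$. Let $c_n(w)=\inf\{\mathcal E_p^{\mathbb G_{n+m}}(g): g=0\text{ on }S^n(w),\ g=1\text{ on }V_{n+m}\setminus\bigcup_{v\in V_m,\,d_m(v,w)\le1}S^n(v)\}$, $\mathcal C_p^{(n)}=\sup_{m\in\mathbb N,w\in V_m}c_n(w)$, and $\rho(p):=\lim_{n\to\infty}(\mathcal C_p^{(n)})^{-1/n}\in(0,\infty)$ (the limit exists). Sobolev space: $|f|_{\mathcal F_p}=(\sup_{n\in\mathbb N}\rho(p)^n\mathcal E_p^{\mathbb G_n}(M_nf))^{1/p}$, $\mathcal F_p=\{f\in L^p(K,m):|f|_{\mathcal F_p}<\infty\}$, $\|f\|_{\mathcal F_p}=\|f\|_{L^p}+|f|_{\mathcal F_p}$; this is a reflexive separable Banach space in which $\mathcal F_p\cap C(K)$ is dense, and $\mathcal F_p\cap C(K)$ is dense in $C(K)$. Self-similar $p$-energy: $\mathcal E_p:\mathcal F_p\to[0,\infty)$ is a fixed functional with the following properties, for some $C\ge1$ (such a functional exists): $\mathcal E_p^{1/p}$ is a uniformly convex semi-norm with $C^{-1}|f|_{\mathcal F_p}\le\mathcal E_p(f)^{1/p}\le C|f|_{\mathcal F_p}$; for $1$-Lipschitz $\varphi:\mathbb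 R\to\mathbb R$, $\varphi\circ f\in\mathcal F_p$ and $\mathcal E_p(\varphi\circ f)\le\mathcal E_p(f)$; $\|f-\int_Kf\,dm\|_{L^p}^p\le C\mathcal E_p(f)$, and $\mathcal E_p(f)=0$ iff $f$ is constant $m$-a.e.; $\mathcal E_p(f+g+h)+\mathcal E_p(h)=\mathcal E_p(f+h)+\mathcal E_p(g+h)$ whenever the supports of $f\,dm$ and $(g-a)\,dm$ are disjoint for some $a\in\mathbb R$; $f\circ F_i\in\mathcal F_p$ and $\mathcal E_p(f)=\rho(p)\sum_{i\in S}\mathcal E_p(f\circ F_i)$, and $\mathcal F_p\cap C(K)=\{f\in C(K):f\circ F_i\in\mathcal F_p\ \forall i\in S\}$; $f\circ\Phi\in\mathcal F_p$ and $\mathcal E_p(f\circ\Phi)=\mathcal E_p(f)$ for $\Phi\in D_4$.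
   Formalization: In (v) the identity is stated as Φ_*(Γ_p⟨f⟩) = Γ_p⟨f∘Φ⁻¹⟩ instead of Γ_p⟨f∘Φ⟩; with T_*μ = μ∘T⁻¹ the printed form contradicts (i) for rotations by ±90°, and both forms agree for all other Φ in D_4. *)

theory Defs
  imports "HOL-Probability.Probability"
begin

type_synonym plane = "real \<times> real"

definition carpet_pt :: "nat \<Rightarrow> plane" where
  "carpet_pt i =
     [(-1,-1), (0,-1), (1,-1), (1,0), (1,1), (0,1), (-1,1), (-1,0)] ! (i - 1)"

definition carpet_map :: "nat \<Rightarrow> plane \<Rightarrow> plane" where
  "carpet_map i x = (1/3) *\<^sub>R (x - carpet_pt i) + carpet_pt i"

definition is_carpet :: "plane set \<Rightarrow> bool" where
  "is_carpet K \<longleftrightarrow> compact K \<and> K \<noteq> {} \<and> K = (\<Union>i\<in>{1..8}. carpet_map i ` K)"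

definition words :: "nat \<Rightarrow> nat list set" where
  "words n = {w. length w = n \<and> set w \<subseteq> {1..8}}"

text \<open>The maps are kept as affine maps of the whole plane. Every condition below on a function
  of type \<^typ>\<open>plane \<Rightarrow> real\<close> only concerns its values on the carpet \<open>K\<close>, which these maps send
  into itself.\<close>

definition word_map :: "nat list \<Rightarrow> plane \<Rightarrow> plane" where
  "word_map w = foldr (\<lambda>i h. carpet_map i \<circ> h) w id"

abbreviation borel_on :: "plane set \<Rightarrow> plane measure" where
  "borel_on K \<equiv> restrict_space borel K"

definition is_carpet_measure :: "plane set \<Rightarrow> plane measure \<Rightarrow> bool" where
  "is_carpet_measure K m \<longleftrightarrow>
     sets m = sets (borel_on K) \<and> prob_space m \<and>
     (\<forall>A\<in>sets m. measure m A = (\<Sum>i\<in>{1..8}. measure (distr m m (carpet_map i)) A) / 8) \<and>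
     (\<forall>n. \<forall>w\<in>words n. measure m (word_map w ` K) = (1/8) ^ n)"

definition carpet_symmetries :: "(plane \<Rightarrow> plane) set" where
  "carpet_symmetries =
     {T. linear T \<and> T ` cbox (-1,-1) (1,1) = cbox (-1,-1) (1,1)}"

definition carpet_adj :: "plane set \<Rightarrow> nat \<Rightarrow> (nat list \<times> nat list) set" where
  "carpet_adj K n =
     {(u, v). u \<in> words n \<and> v \<in> words n \<and> u \<noteq> v \<and> word_map u ` K \<inter> word_map v ` K \<noteq> {}}"

definition graph_dist :: "plane set \<Rightarrow> nat \<Rightarrow> nat list \<Rightarrow> nat list \<Rightarrow> enat" where
  "graph_dist K n u v = (INF l\<in>{l. (u, v) \<in> carpet_adj K n ^^ l}. enat l)"

text \<open>Each undirected edge occurs in \<^const>\<open>carpet_adj\<close> in both orientations, hence the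
  division by 2.\<close>

definition graph_energy :: "plane set \<Rightarrow> real \<Rightarrow> nat \<Rightarrow> (nat list \<Rightarrow> real) \<Rightarrow> real" where
  "graph_energy K p n g = (\<Sum>(u, v)\<in>carpet_adj K n. \<bar>g u - g v\<bar> powr p) / 2"

definition subwords :: "nat \<Rightarrow> nat list \<Rightarrow> nat list set" where
  "subwords n w = {u \<in> words (n + length w). take (length w) u = w}"

definition cell_conductance :: "plane set \<Rightarrow> real \<Rightarrow> nat \<Rightarrow> nat list \<Rightarrow> real" where
  "cell_conductance K p n w =
     Inf {graph_energy K p (n + length w) g | g.
       (\<forall>u\<in>subwords n w. g u = 0) \<and>
       (\<forall>u\<in>words (n + length w) -
             (\<Union>v\<in>{v \<in> words (length w). graph_dist K (length w) v w \<le> 1}. subwords n v).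
          g u = 1)}"

definition conductance_const :: "plane set \<Rightarrow> real \<Rightarrow> nat \<Rightarrow> real" where
  "conductance_const K p n = (SUP w\<in>(\<Union>k\<in>{1..}. words k). cell_conductance K p n w)"

definition is_scaling_factor :: "plane set \<Rightarrow> real \<Rightarrow> real \<Rightarrow> bool" where
  "is_scaling_factor K p \<rho> \<longleftrightarrow>
     0 < \<rho> \<and> (\<lambda>n. conductance_const K p n powr (- 1 / real n)) \<longlonglongrightarrow> \<rho>"

text \<open>Elements of function spaces are represented by functions rather than by classes modulo
  almost everywhere equality. Norms are accordingly pseudo-norms.\<close>

definition Lp_space :: "plane measure \<Rightarrow> real \<Rightarrow> (plane \<Rightarrow> real) set" where
  "Lp_space m p = {f \<in> borel_measurable m. integrable m (\<lambda>x. \<bar>f x\<bar> powr p)}"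

definition Lp_norm :: "plane measure \<Rightarrow> real \<Rightarrow> (plane \<Rightarrow> real) \<Rightarrow> real" where
  "Lp_norm m p f = (\<integral>x. \<bar>f x\<bar> powr p \<partial>m) powr (1/p)"

definition cell_mean ::
  "plane set \<Rightarrow> plane measure \<Rightarrow> (plane \<Rightarrow> real) \<Rightarrow> nat list \<Rightarrow> real" where
  "cell_mean K m f u = (LINT x:word_map u ` K|m. f x) / measure m (word_map u ` K)"

definition scaled_energy ::
  "plane set \<Rightarrow> plane measure \<Rightarrow> real \<Rightarrow> real \<Rightarrow> (plane \<Rightarrow> real) \<Rightarrow> nat \<Rightarrow> real" where
  "scaled_energy K m p \<rho> f n = \<rho> ^ n * graph_energy K p n (cell_mean K m f)"

definition sobolev :: "plane set \<Rightarrow> plane measure \<Rightarrow> real \<Rightarrow> real \<Rightarrow> (plane \<Rightarrow> real) set" where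
  "sobolev K m p \<rho> = {f \<in> Lp_space m p. bdd_above (scaled_energy K m p \<rho> f ` {1..})}"

definition sobolev_seminorm ::
  "plane set \<Rightarrow> plane measure \<Rightarrow> real \<Rightarrow> real \<Rightarrow> (plane \<Rightarrow> real) \<Rightarrow> real" where
  "sobolev_seminorm K m p \<rho> f = (SUP n\<in>{1..}. scaled_energy K m p \<rho> f n) powr (1/p)"

definition sobolev_norm ::
  "plane set \<Rightarrow> plane measure \<Rightarrow> real \<Rightarrow> real \<Rightarrow> (plane \<Rightarrow> real) \<Rightarrow> real" where
  "sobolev_norm K m p \<rho> f = Lp_norm m p f + sobolev_seminorm K m p \<rho> f"

definition sobolev_cont ::
  "plane set \<Rightarrow> plane measure \<Rightarrow> real \<Rightarrow> real \<Rightarrow> (plane \<Rightarrow> real) set" where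
  "sobolev_cont K m p \<rho> = {f \<in> sobolev K m p \<rho>. continuous_on K f}"

text \<open>The vector space operations are pointwise. The ground type is arbitrary, so that these
  notions also apply to a space of functionals, as is needed for the bidual.\<close>

definition fun_subspace :: "('a \<Rightarrow> real) set \<Rightarrow> bool" where
  "fun_subspace V \<longleftrightarrow>
     (\<lambda>x. 0) \<in> V \<and> (\<forall>f\<in>V. \<forall>g\<in>V. (\<lambda>x. f x + g x) \<in> V) \<and> (\<forall>f\<in>V. \<forall>c. (\<lambda>x. c * f x) \<in> V)"

definition seminorm_on :: "('a \<Rightarrow> real) set \<Rightarrow> (('a \<Rightarrow> real) \<Rightarrow> real) \<Rightarrow> bool" where
  "seminorm_on V N \<longleftrightarrow>
     fun_subspace V \<and> (\<forall>f\<in>V. 0 \<le> N f) \<and>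
     (\<forall>f\<in>V. \<forall>c. N (\<lambda>x. c * f x) = \<bar>c\<bar> * N f) \<and>
     (\<forall>f\<in>V. \<forall>g\<in>V. N (\<lambda>x. f x + g x) \<le> N f + N g)"

definition uniformly_convex_on :: "('a \<Rightarrow> real) set \<Rightarrow> (('a \<Rightarrow> real) \<Rightarrow> real) \<Rightarrow> bool" where
  "uniformly_convex_on V N \<longleftrightarrow>
     (\<forall>\<epsilon>>0. \<exists>\<delta>>0. \<forall>f\<in>V. \<forall>g\<in>V. N f = 1 \<longrightarrow> N g = 1 \<longrightarrow> N (\<lambda>x. f x - g x) > \<epsilon> \<longrightarrow>
        N (\<lambda>x. f x + g x) \<le> 2 * (1 - \<delta>))"

definition complete_on :: "('a \<Rightarrow> real) set \<Rightarrow> (('a \<Rightarrow> real) \<Rightarrow> real) \<Rightarrow> bool" where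
  "complete_on V N \<longleftrightarrow>
     (\<forall>s. (\<forall>n::nat. s n \<in> V) \<longrightarrow>
        (\<forall>\<epsilon>>0. \<exists>M. \<forall>i\<ge>M. \<forall>j\<ge>M. N (\<lambda>x. s i x - s j x) < \<epsilon>) \<longrightarrow>
        (\<exists>f\<in>V. (\<lambda>n. N (\<lambda>x. s n x - f x)) \<longlonglongrightarrow> 0))"

definition dense_subset_on ::
  "('a \<Rightarrow> real) set \<Rightarrow> (('a \<Rightarrow> real) \<Rightarrow> real) \<Rightarrow> ('a \<Rightarrow> real) set \<Rightarrow> bool" where
  "dense_subset_on V N D \<longleftrightarrow>
     D \<subseteq> V \<and> (\<forall>f\<in>V. \<forall>\<epsilon>>0. \<exists>g\<in>D. N (\<lambda>x. f x - g x) < \<epsilon>)"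

definition separable_on :: "('a \<Rightarrow> real) set \<Rightarrow> (('a \<Rightarrow> real) \<Rightarrow> real) \<Rightarrow> bool" where
  "separable_on V N \<longleftrightarrow> (\<exists>D. countable D \<and> dense_subset_on V N D)"

text \<open>Functionals are extended by 0 outside \<open>V\<close>, so that each one has a unique representative.\<close>

definition dual_space ::
  "('a \<Rightarrow> real) set \<Rightarrow> (('a \<Rightarrow> real) \<Rightarrow> real) \<Rightarrow> (('a \<Rightarrow> real) \<Rightarrow> real) set" where
  "dual_space V N =
     {L. (\<forall>f\<in>V. \<forall>g\<in>V. L (\<lambda>x. f x + g x) = L f + L g) \<and>
         (\<forall>f\<in>V. \<forall>c. L (\<lambda>x. c * f x) = c * L f) \<and>
         (\<exists>C. \<forall>f\<in>V. \<bar>L f\<bar> \<le> C * N f) \<and>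
         (\<forall>f. f \<notin> V \<longrightarrow> L f = 0)}"

definition dual_norm ::
  "('a \<Rightarrow> real) set \<Rightarrow> (('a \<Rightarrow> real) \<Rightarrow> real) \<Rightarrow> (('a \<Rightarrow> real) \<Rightarrow> real) \<Rightarrow> real" where
  "dual_norm V N L = (SUP f\<in>{f \<in> V. N f \<le> 1}. \<bar>L f\<bar>)"

definition reflexive_on :: "('a \<Rightarrow> real) set \<Rightarrow> (('a \<Rightarrow> real) \<Rightarrow> real) \<Rightarrow> bool" where
  "reflexive_on V N \<longleftrightarrow>
     (\<forall>\<Lambda>\<in>dual_space (dual_space V N) (dual_norm V N).
        \<exists>f\<in>V. \<forall>L\<in>dual_space V N. \<Lambda> L = L f)"

text \<open>The topological support in \<open>K\<close> of the signed measure \<open>f dm\<close>.\<close>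

definition supp_on :: "plane set \<Rightarrow> plane measure \<Rightarrow> (plane \<Rightarrow> real) \<Rightarrow> plane set" where
  "supp_on K m f = {x\<in>K. \<forall>U. open U \<longrightarrow> x \<in> U \<longrightarrow> \<not> (AE y in m. y \<in> U \<longrightarrow> f y = 0)}"

definition self_similar_energy ::
  "plane set \<Rightarrow> plane measure \<Rightarrow> real \<Rightarrow> real \<Rightarrow> ((plane \<Rightarrow> real) \<Rightarrow> real) \<Rightarrow> bool" where
  "self_similar_energy K m p \<rho> E \<longleftrightarrow>
     (let F = sobolev K m p \<rho> in \<exists>C\<ge>1.
        (\<forall>f\<in>F. 0 \<le> E f) \<and>
        seminorm_on F (\<lambda>f. E f powr (1/p)) \<and>
        uniformly_convex_on F (\<lambda>f. E f powr (1/p)) \<and>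
        (\<forall>f\<in>F. sobolev_seminorm K m p \<rho> f / C \<le> E f powr (1/p) \<and>
                E f powr (1/p) \<le> C * sobolev_seminorm K m p \<rho> f) \<and>
        (\<forall>f\<in>F. \<forall>\<phi>::real \<Rightarrow> real. 1-lipschitz_on UNIV \<phi> \<longrightarrow>
                \<phi> \<circ> f \<in> F \<and> E (\<phi> \<circ> f) \<le> E f) \<and>
        (\<forall>f\<in>F. (\<integral>x. \<bar>f x - (\<integral>y. f y \<partial>m)\<bar> powr p \<partial>m) \<le> C * E f) \<and>
        (\<forall>f\<in>F. E f = 0 \<longleftrightarrow> (\<exists>c. AE x in m. f x = c)) \<and>
        (\<forall>f\<in>F. \<forall>g\<in>F. \<forall>h\<in>F. \<forall>a.
           supp_on K m f \<inter> supp_on K m (\<lambda>x. g x - a) = {} \<longrightarrow>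
           E (\<lambda>x. f x + g x + h x) + E h = E (\<lambda>x. f x + h x) + E (\<lambda>x. g x + h x)) \<and>
        (\<forall>f\<in>F. (\<forall>i\<in>{1..8}. f \<circ> carpet_map i \<in> F) \<and>
                E f = \<rho> * (\<Sum>i\<in>{1..8}. E (f \<circ> carpet_map i))) \<and>
        sobolev_cont K m p \<rho> =
          {f. continuous_on K f \<and> (\<forall>i\<in>{1..8}. f \<circ> carpet_map i \<in> F)} \<and>
        (\<forall>f\<in>F. \<forall>\<Phi>\<in>carpet_symmetries. f \<circ> \<Phi> \<in> F \<and> E (f \<circ> \<Phi>) = E f))"

text \<open>Only used with a positive exponent, where the power of \<open>\<infinity>\<close> is \<open>\<infinity>\<close>.\<close>

definition ennreal_powr :: "ennreal \<Rightarrow> real \<Rightarrow> ennreal" where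
  "ennreal_powr x a = (if x = \<infinity> then \<infinity> else ennreal (enn2real x powr a))"

end

theory Submission
  imports Defs
begin

text \<open>
  The masses \<open>\<rho> ^ n * E (f \<circ> F\<^sub>w)\<close> are additive under subdivision of words, so they define a measure on
  the infinite words, whose image on \<open>K\<close> is \<open>\<Gamma> f\<close>. A compact set \<open>A\<close> has as its mass the limit of the
  total mass of the cells of level \<open>n\<close> that meet \<open>A\<close>; most assertions are therefore inherited from \<open>E\<close>
  cell by cell.

  That a cell has its own mass amounts to the absence of energy on the sides of the square. To see this
  for the upper side and continuous \<open>f\<close>, let \<open>c n\<close> be the energy in the highest row of cells of level \<open>n\<close>,
  which decreases to some \<open>c\<close>. Replacing \<open>f\<close> in each of these cells by two reflections of its values on the
  lowest third of the cell gives functions that converge uniformly to \<open>f\<close> and have energy at most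
  \<open>E f - c n + 3 * (c n - c (n + 1))\<close>, hence \<open>E f \<le> E f - c\<close> by lower semicontinuity, which follows from
  uniform convexity.
\<close>

text \<open>Cells of one level overlap along their sides, so the limit over cells meeting a compact
  cell could pick up mass from its neighbours; this is why the sides have to be studied at all. The
  factor 3 comes from counting: folding uses each of the three lowest subcells of a cell at most
  three times, and \<open>c n - c (n + 1)\<close> is the energy of all subcells outside the highest
  row. Gluing the folded pieces needs continuity, because a function composed of pieces in the
  Sobolev space is known to belong to it only if it is continuous; general \<open>f\<close> follow
  by density.

  Two assertions are not inherited from \<open>E\<close> cell by cell. For the chain rule,
  \<open>\<Psi> \<circ> f\<close> is compared on every small cell with a linear function of
  \<open>f\<close>. Strong locality reduces to the claim that a continuous function has no energy on
  its level sets, a second use of lower semicontinuity. Inequalities between \<open>p\<close>-th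
  roots are replaced by families of linear inequalities with a parameter \<open>l\<close>, since
  linear ones pass directly from cells to limits, Borel sets and integrals.\<close>

text \<open>The alphabet is a parameter because the cells along a side of the square are those whose
  letters all come from a set of three.\<close>

definition words_over :: "nat set \<Rightarrow> nat \<Rightarrow> nat list set" where
  "words_over T n = {w. length w = n \<and> set w \<subseteq> T}"

lemma words_eq_words_over: "words n = words_over {1..8} n"
  by (simp add: words_def words_over_def)

lemma words_over_0 [simp]: "words_over T 0 = {[]}"
  by (auto simp: words_over_def)

lemma words_over_Suc: "words_over T (Suc n) = (\<lambda>(i, w). i # w) ` (T \<times> words_over T n)"
  by (force simp: words_over_def length_Suc_conv)

lemma words_over_add:
  "words_over T (n + k) = (\<lambda>(u, v). u @ v) ` (words_over T n \<times> words_over T k)" (is "_ = ?R")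
proof
  show "words_over T (n + k) \<subseteq> ?R"
  proof
    fix w assume "w \<in> words_over T (n + k)"
    then have "take n w \<in> words_over T n" "drop n w \<in> words_over T k"
      by (auto simp: words_over_def dest: in_set_takeD in_set_dropD)
    then show "w \<in> ?R" by (intro image_eqI[of _ _ "(take n w, drop n w)"]) auto
  qed
qed (auto simp: words_over_def)

lemma finite_words_over: "finite T \<Longrightarrow> finite (words_over T n)"
  by (induction n) (simp_all add: words_over_Suc)

lemma finite_words: "finite (words n)"
  by (simp add: words_eq_words_over finite_words_over)

lemma sum_words_over_Suc:
  "(\<Sum>w\<in>words_over T (Suc n). g w) = (\<Sum>i\<in>T. \<Sum>w\<in>words_over T n. g (i # w))"
proof -
  have "inj_on (\<lambda>(i, w). i # w) (T \<times> words_over T n)" by (auto simp: inj_on_def)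
  then show ?thesis
    unfolding words_over_Suc sum.cartesian_product by (simp add: sum.reindex split_def)
qed

lemma sum_words_over_add:
  "(\<Sum>w\<in>words_over T (n + k). g w) = (\<Sum>u\<in>words_over T n. \<Sum>v\<in>words_over T k. g (u @ v))"
proof -
  have "inj_on (\<lambda>(u, v). u @ v) (words_over T n \<times> words_over T k)"
    by (auto simp: inj_on_def words_over_def)
  then show ?thesis
    unfolding words_over_add sum.cartesian_product by (simp add: sum.reindex split_def)
qed

lemma words_append: "u \<in> words n \<Longrightarrow> v \<in> words k \<Longrightarrow> u @ v \<in> words (n + k)"
  by (auto simp: words_def)

lemma words_snoc: "w \<in> words n \<Longrightarrow> i \<in> {1..8} \<Longrightarrow> w @ [i] \<in> words (Suc n)"
  by (auto simp: words_def)

lemma words_Suc_snocE: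
  assumes "v \<in> words (Suc n)"
  obtains w i where "v = w @ [i]" "w \<in> words n" "i \<in> {1..8}"
proof (cases v rule: rev_cases)
  case (snoc w i)
  then show ?thesis using assms that[of w i] by (auto simp: words_def)
qed (use assms in \<open>simp add: words_def\<close>)

section \<open>The contractions of the plane and their fixed points\<close>

lemma word_map_Nil [simp]: "word_map [] = id"
  by (simp add: word_map_def)

lemma word_map_Cons [simp]: "word_map (i # w) = carpet_map i \<circ> word_map w"
  by (simp add: word_map_def)

lemma word_map_append: "word_map (u @ v) = word_map u \<circ> word_map v"
  by (induction u) (simp_all add: comp_assoc)

lemma carpet_map_diff: "carpet_map i x - carpet_map i y = (1/3) *\<^sub>R (x - y)"
  by (simp add: carpet_map_def algebra_simps)

lemma word_map_diff: "word_map w x - word_map w y = (1/3) ^ length w *\<^sub>R (x - y)"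
proof (induction w)
  case (Cons i w)
  then show ?case by (simp add: carpet_map_diff del: scaleR_right_diff_distrib)
qed simp

lemma dist_word_map: "dist (word_map w x) (word_map w y) = (1/3) ^ length w * dist x y"
  by (simp add: dist_norm word_map_diff)

lemma inj_word_map: "inj (word_map w)"
proof (rule injI)
  fix x y assume "word_map w x = word_map w y"
  then have "dist (word_map w x) (word_map w y) = 0" by simp
  then show "x = y" unfolding dist_word_map by simp
qed

lemma continuous_on_carpet_map [continuous_intros]:
  "continuous_on A f \<Longrightarrow> continuous_on A (\<lambda>x. carpet_map i (f x))"
  by (simp add: carpet_map_def continuous_intros)

lemma continuous_on_word_map: "continuous_on A (word_map w)"
proof (induction w)
  case (Cons i w)
  then show ?case by (simp add: comp_def continuous_on_carpet_map)
qed (simp add: continuous_on_id)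

lemma carpet_map_prod:
  "carpet_map i (x, y) = ((x + 2 * fst (carpet_pt i)) / 3, (y + 2 * snd (carpet_pt i)) / 3)"
  by (cases "carpet_pt i") (simp add: carpet_map_def field_simps)

lemma fst_carpet_map: "fst (carpet_map i z) = (fst z + 2 * fst (carpet_pt i)) / 3"
  and snd_carpet_map: "snd (carpet_map i z) = (snd z + 2 * snd (carpet_pt i)) / 3"
  by (cases z; simp add: carpet_map_prod)+

lemma letters_eq: "{1..8::nat} = {1, 2, 3, 4, 5, 6, 7, 8}"
  by auto

lemma carpet_pts [simp]:
  "carpet_pt 1 = (-1, -1)" "carpet_pt (Suc 0) = (-1, -1)" "carpet_pt 2 = (0, -1)"
  "carpet_pt 3 = (1, -1)" "carpet_pt 4 = (1, 0)" "carpet_pt 5 = (1, 1)"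
  "carpet_pt 6 = (0, 1)" "carpet_pt 7 = (-1, 1)" "carpet_pt 8 = (-1, 0)"
  by (simp_all add: carpet_pt_def)

lemma inj_on_carpet_pt: "inj_on carpet_pt {1..8}"
  unfolding letters_eq by (simp add: inj_on_def)

text \<open>The grid without its centre: a description that signed permutations of the coordinates
  visibly preserve.\<close>

lemma carpet_pt_image:
  "carpet_pt ` {1..8} = ({-1, 0, 1} \<times> {-1, 0, 1}) - {(0, 0)}"
  unfolding letters_eq by auto

lemma carpet_pt_cases:
  assumes "i \<in> {1..8}"
  shows "fst (carpet_pt i) \<in> {-1, 0, 1}" "snd (carpet_pt i) \<in> {-1, 0, 1}"
proof -
  have "carpet_pt i \<in> ({-1, 0, 1} \<times> {-1, 0, 1}) - {(0, 0)}"
    using assms carpet_pt_image by blast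
  then show "fst (carpet_pt i) \<in> {-1, 0, 1}" "snd (carpet_pt i) \<in> {-1, 0, 1}" by auto
qed

subsection \<open>The carpet\<close>

locale carpet =
  fixes K :: "plane set"
  assumes carpet: "is_carpet K"
begin

lemma compact_K: "compact K" and K_nonempty: "K \<noteq> {}"
  and K_fixed: "K = (\<Union>i\<in>{1..8}. carpet_map i ` K)"
  using carpet by (auto simp: is_carpet_def)

lemma closed_K: "closed K" by (rule compact_imp_closed[OF compact_K])

lemma carpet_map_in_K: "i \<in> {1..8} \<Longrightarrow> x \<in> K \<Longrightarrow> carpet_map i x \<in> K"
  using K_fixed by blast

lemma word_map_in_K: "w \<in> words n \<Longrightarrow> x \<in> K \<Longrightarrow> word_map w x \<in> K"
proof (induction w arbitrary: n)
  case (Cons i w)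
  then have "w \<in> words (n - 1)" "i \<in> {1..8}" by (auto simp: words_def)
  with Cons carpet_map_in_K[of i "word_map w x"] show ?case by simp
qed (auto simp: words_def)

lemma compact_cell: "compact (word_map w ` K)"
  by (intro compact_continuous_image continuous_on_word_map compact_K)

text \<open>At a point of \<open>K\<close> where the absolute value of a coordinate is maximal, say
  with value \<open>M\<close>, writing the point as an image under some \<open>carpet_map i\<close>
  gives \<open>M \<le> (M + 2) / 3\<close>, hence \<open>M \<le> 1\<close>.\<close>

lemma K_in_square: assumes "z \<in> K" shows "\<bar>fst z\<bar> \<le> 1" "\<bar>snd z\<bar> \<le> 1"
proof -
  have *: "\<bar>g z\<bar> \<le> 1" if g: "continuous_on K g"
    and gi: "\<And>i z. i \<in> {1..8} \<Longrightarrow> \<exists>q\<in>{-1,0,1}. g (carpet_map i z) = (g z + 2 * q) / 3"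
    for g :: "plane \<Rightarrow> real"
  proof -
    have "continuous_on K (\<lambda>z. \<bar>g z\<bar>)" using g by (intro continuous_intros)
    from continuous_attains_sup[OF compact_K K_nonempty this]
    obtain s where s: "s \<in> K" "\<And>y. y \<in> K \<Longrightarrow> \<bar>g y\<bar> \<le> \<bar>g s\<bar>" by blast
    obtain i s' where i: "i \<in> {1..8}" "s' \<in> K" "s = carpet_map i s'" using s(1) K_fixed by blast
    with gi[OF i(1), of s'] s(2)[of s'] have "\<bar>g s\<bar> \<le> 1" by auto
    with s(2)[OF assms] show ?thesis by linarith
  qed
  show "\<bar>fst z\<bar> \<le> 1"
    by (rule *, intro continuous_intros, rule bexI[OF _ carpet_pt_cases(1)]) (simp_all only: fst_carpet_map)
  show "\<bar>snd z\<bar> \<le> 1"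
    by (rule *, intro continuous_intros, rule bexI[OF _ carpet_pt_cases(2)]) (simp_all only: snd_carpet_map)
qed

text \<open>The maximal distance from a point of one carpet to the other is at most a third of
  itself, since the contractions divide distances by 3. Uniqueness serves to show that symmetries of
  the square preserve \<open>K\<close>.\<close>

lemma carpet_unique:
  assumes "is_carpet L" shows "L = K"
proof -
  have half: "A \<subseteq> B" if A: "is_carpet A" and B: "is_carpet B" for A B
  proof -
    have cA: "compact A" "A \<noteq> {}" "A = (\<Union>i\<in>{1..8}. carpet_map i ` A)"
      and cB: "compact B" "B \<noteq> {}" "B = (\<Union>i\<in>{1..8}. carpet_map i ` B)"
      using A B by (auto simp: is_carpet_def)
    have "continuous_on A (\<lambda>x. infdist x B)" by (intro continuous_intros)
    from continuous_attains_sup[OF cA(1,2) this]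
    obtain s where s: "s \<in> A" "\<And>y. y \<in> A \<Longrightarrow> infdist y B \<le> infdist s B" by blast
    obtain i s' where i: "i \<in> {1..8}" "s' \<in> A" "s = carpet_map i s'" using s(1) cA(3) by blast
    obtain b where b: "b \<in> B" "infdist s' B = dist s' b"
      using infdist_attains_inf[OF compact_imp_closed[OF cB(1)] cB(2)] by blast
    have "carpet_map i b \<in> B" using i(1) b(1) cB(3) by blast
    then have "infdist s B \<le> dist s (carpet_map i b)" by (rule infdist_le)
    also have "\<dots> = dist s' b / 3"
      using dist_word_map[of "[i]" s' b] i by simp
    finally have "infdist s B \<le> infdist s B / 3" using s(2)[OF i(2)] b(2) by simp
    then have "infdist y B = 0" if "y \<in> A" for y
      using s(2)[OF that] infdist_nonneg[of y B] by linarith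
    then show ?thesis
      using in_closed_iff_infdist_zero[OF compact_imp_closed[OF cB(1)] cB(2)] by blast
  qed
  show ?thesis using half[OF assms carpet] half[OF carpet assms] by blast
qed

end

subsection \<open>Measures with prescribed masses of words\<close>

definition cell_weight :: "(nat list \<Rightarrow> real) \<Rightarrow> bool" where
  "cell_weight \<mu> \<longleftrightarrow> (\<forall>n. \<forall>w\<in>words n. 0 \<le> \<mu> w \<and> \<mu> w = (\<Sum>i\<in>{1..8}. \<mu> (w @ [i])))"

text \<open>The words of a given length cut \<open>[0, \<mu> [])\<close> lexicographically into intervals of length
  \<open>\<mu> w\<close>; the measure is the image of Lebesgue measure under the coding map \<open>t \<mapsto> x\<close>, where \<open>x\<close> is the
  point of the cells whose intervals contain \<open>t\<close>. This replaces an extension theorem.\<close>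

definition cell_start :: "(nat list \<Rightarrow> real) \<Rightarrow> nat list \<Rightarrow> real" where
  "cell_start \<mu> w = (\<Sum>k<length w. \<Sum>j\<in>{1..<w ! k}. \<mu> (take k w @ [j]))"

definition cell_interval :: "(nat list \<Rightarrow> real) \<Rightarrow> nat list \<Rightarrow> real set" where
  "cell_interval \<mu> w = {cell_start \<mu> w..<cell_start \<mu> w + \<mu> w}"

lemma cell_start_snoc:
  "cell_start \<mu> (w @ [i]) = cell_start \<mu> w + (\<Sum>j\<in>{1..<i}. \<mu> (w @ [j]))"
proof -
  have "(\<Sum>k<length w. \<Sum>j\<in>{1..<(w @ [i]) ! k}. \<mu> (take k (w @ [i]) @ [j])) = cell_start \<mu> w"
    unfolding cell_start_def by (intro sum.cong) (auto simp: nth_append)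
  then show ?thesis by (simp add: cell_start_def)
qed

lemma cell_interval_Nil: "cell_interval \<mu> [] = {0..<\<mu> []}"
  by (simp add: cell_interval_def cell_start_def)

context
  fixes \<mu> :: "nat list \<Rightarrow> real"
  assumes weight: "cell_weight \<mu>"
begin

lemma weight_nonneg: "w \<in> words n \<Longrightarrow> 0 \<le> \<mu> w"
  using weight unfolding cell_weight_def by blast

lemma weight_sum: "w \<in> words n \<Longrightarrow> (\<Sum>i\<in>{1..8}. \<mu> (w @ [i])) = \<mu> w"
  using weight unfolding cell_weight_def by metis

lemma weight_partial_mono:
  assumes "w \<in> words n" "k \<le> l" "l \<le> 9"
  shows "(\<Sum>j\<in>{1..<k}. \<mu> (w @ [j])) \<le> (\<Sum>j\<in>{1..<l}. \<mu> (w @ [j]))"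
  using assms by (intro sum_mono2) (auto intro!: weight_nonneg[OF words_snoc[OF assms(1)]])

lemma weight_partial_Suc:
  "1 \<le> i \<Longrightarrow> (\<Sum>j\<in>{1..<Suc i}. \<mu> (w @ [j])) = (\<Sum>j\<in>{1..<i}. \<mu> (w @ [j])) + \<mu> (w @ [i])"
  by simp

lemma weight_partial_9: "w \<in> words n \<Longrightarrow> (\<Sum>j\<in>{1..<9}. \<mu> (w @ [j])) = \<mu> w"
  using weight_sum[of w n] by (simp add: atLeastLessThanSuc_atLeastAtMost[symmetric] del: sum.op_ivl_Suc)

lemma cell_interval_snoc_subset:
  assumes "w \<in> words n" "i \<in> {1..8}"
  shows "cell_interval \<mu> (w @ [i]) \<subseteq> cell_interval \<mu> w"
proof -
  have "(\<Sum>j\<in>{1..<i}. \<mu> (w @ [j])) + \<mu> (w @ [i]) \<le> \<mu> w"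
    using weight_partial_mono[OF assms(1), of "Suc i" 9] weight_partial_Suc[of i w]
      weight_partial_9[OF assms(1)] assms(2) by auto
  moreover have "0 \<le> (\<Sum>j\<in>{1..<i}. \<mu> (w @ [j]))"
    using weight_partial_mono[OF assms(1), of 1 i] assms(2) by auto
  ultimately show ?thesis by (auto simp: cell_interval_def cell_start_snoc)
qed

lemma cell_interval_split:
  assumes "w \<in> words n" "t \<in> cell_interval \<mu> w"
  shows "\<exists>i\<in>{1..8}. t \<in> cell_interval \<mu> (w @ [i])"
proof -
  define S where "S k = cell_start \<mu> w + (\<Sum>j\<in>{1..<k}. \<mu> (w @ [j]))" for k
  \<comment> \<open>The right end of the wanted subinterval is the first partial sum beyond
    \<open>t\<close>. Both \<open>S 0\<close> and \<open>S 1\<close> are the left end of the whole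
    interval, so \<open>k \<ge> 2\<close> and the letter is \<open>k - 1\<close>.\<close>
  define k where "k = (LEAST k. t < S k)"
  have S9: "t < S 9" using assms weight_partial_9[OF assms(1)] by (auto simp: S_def cell_interval_def)
  then have tk: "t < S k" "k \<le> 9" unfolding k_def by (rule LeastI, rule Least_le)
  have low: "S l \<le> t" if "l < k" for l
    using not_less_Least[of l "\<lambda>k. t < S k"] that k_def by (auto simp: not_less)
  have "S k \<le> t" if "k \<le> 1" using that assms by (cases k) (auto simp: S_def cell_interval_def)
  then have "k \<ge> 2" using tk(1) by (cases "k \<le> 1") auto
  then obtain i where i: "k = Suc i" "1 \<le> i" by (cases k) auto
  then show ?thesis
    using low[of i] tk weight_partial_Suc[of i w]
    by (intro bexI[of _ i]) (auto simp: S_def cell_interval_def cell_start_snoc)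
qed

lemma cell_interval_append:
  assumes "u \<in> words n" "v \<in> words k"
  shows "cell_interval \<mu> (u @ v) \<subseteq> cell_interval \<mu> u"
  using assms(2)
proof (induction k arbitrary: v)
  case (Suc k)
  then obtain v' i where v: "v = v' @ [i]" "v' \<in> words k" "i \<in> {1..8}"
    by (elim words_Suc_snocE)
  then have "cell_interval \<mu> (u @ v) \<subseteq> cell_interval \<mu> (u @ v')"
    using cell_interval_snoc_subset[OF words_append[OF assms(1) v(2)] v(3)] by simp
  with Suc.IH[OF v(2)] show ?case by blast
qed (simp add: words_def)

lemma cell_interval_unique:
  assumes "u \<in> words n" "v \<in> words n" "t \<in> cell_interval \<mu> u" "t \<in> cell_interval \<mu> v"
  shows "u = v"
  using assms
proof (induction n arbitrary: u v)
  case (Suc n)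
  obtain u' i where u: "u = u' @ [i]" "u' \<in> words n" "i \<in> {1..8}"
    using Suc.prems(1) by (elim words_Suc_snocE)
  obtain v' j where v: "v = v' @ [j]" "v' \<in> words n" "j \<in> {1..8}"
    using Suc.prems(2) by (elim words_Suc_snocE)
  have "t \<in> cell_interval \<mu> u'" "t \<in> cell_interval \<mu> v'"
    using cell_interval_snoc_subset[OF u(2,3)] cell_interval_snoc_subset[OF v(2,3)] Suc.prems u v
    by blast+
  then have w: "u' = v'" using Suc.IH u v by blast
  have nless: "\<not> a < b" if "a \<in> {1..8}" "b \<in> {1..8}" "t \<in> cell_interval \<mu> (u' @ [a])"
    "t \<in> cell_interval \<mu> (u' @ [b])" for a b
  proof
    assume "a < b"
    then show False
      using weight_partial_mono[OF u(2), of "Suc a" b] weight_partial_Suc[of a u'] that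
      by (auto simp: cell_interval_def cell_start_snoc)
  qed
  have "t \<in> cell_interval \<mu> (u' @ [i])" "t \<in> cell_interval \<mu> (u' @ [j])"
    using Suc.prems(3,4) u(1) v(1) w by simp_all
  then have "\<not> i < j" "\<not> j < i" using nless u(3) v(3) by blast+
  then show ?case using u(1) v(1) w by simp
qed (simp add: words_def)

text \<open>Step functions of level \<open>n\<close> are written as sums over words, which makes
  them measurable; this evaluates them at \<open>t\<close> through the single word whose interval
  contains \<open>t\<close>.\<close>

lemma sum_indicator_cell_interval:
  fixes g :: "nat list \<Rightarrow> 'z::real_vector"
  assumes "v \<in> words n" "t \<in> cell_interval \<mu> v"
  shows "(\<Sum>w\<in>words n. indicator (cell_interval \<mu> w) t *\<^sub>R g w) = g v"
proof -
  have "indicator (cell_interval \<mu> w) t *\<^sub>R g w = (if w = v then g w else 0)"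
    if "w \<in> words n" for w
    using cell_interval_unique[OF that assms(1) _ assms(2)] assms(2)
    by (cases "w = v") (auto simp: indicator_def)
  then have "(\<Sum>w\<in>words n. indicator (cell_interval \<mu> w) t *\<^sub>R g w)
      = (\<Sum>w\<in>words n. if w = v then g w else 0)"
    by (intro sum.cong) auto
  then show ?thesis using assms(1) by (simp add: finite_words)
qed

lemma cell_interval_cover:
  assumes "t \<in> {0..<\<mu> []}"
  shows "\<exists>w\<in>words n. t \<in> cell_interval \<mu> w"
proof (induction n)
  case 0
  then show ?case using assms by (auto simp: words_eq_words_over cell_interval_Nil)
next
  case (Suc n)
  then obtain w where w: "w \<in> words n" "t \<in> cell_interval \<mu> w" by blast
  from cell_interval_split[OF this] words_snoc[OF w(1)] show ?case by blast
qed

end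

section \<open>The measure on the carpet with given masses of words\<close>

context carpet
begin

definition base :: plane where "base = (SOME x. x \<in> K)"

lemma base_in_K: "base \<in> K"
  unfolding base_def using K_nonempty by (simp add: some_in_eq)

lemma sets_borel_on: "A \<in> sets (borel_on K) \<longleftrightarrow> A \<in> sets borel \<and> A \<subseteq> K"
  using closed_K by (subst sets_restrict_space_iff) auto

lemma compact_sets: "compact A \<Longrightarrow> A \<subseteq> K \<Longrightarrow> A \<in> sets (borel_on K)"
  by (simp add: sets_borel_on borel_compact)

lemma space_borel_on: "space (borel_on K) = K"
  by (simp add: space_restrict_space)

text \<open>The words \<open>W n t\<close> belonging to \<open>t\<close> have nested shrinking cells
  with common point \<open>Y t\<close>. The sum of level \<open>n\<close> is the Lebesgue integral
  of the step function \<open>h n\<close>, and dominated convergence applies: if \<open>Y t\<close>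
  is in \<open>A\<close>, all these cells meet \<open>A\<close>; if not, they eventually lie in a
  ball around \<open>Y t\<close> that misses \<open>A\<close>. The continuous factor
  \<open>\<phi>\<close> is carried along for the chain rule.\<close>

theorem cell_measure_exists:
  assumes weight: "cell_weight \<mu>"
  shows "\<exists>\<nu>. finite_measure \<nu> \<and> sets \<nu> = sets (borel_on K) \<and>
    (\<forall>A \<phi>. compact A \<longrightarrow> A \<subseteq> K \<longrightarrow> continuous_on K \<phi> \<longrightarrow>
       (\<lambda>n. \<Sum>w\<in>{w\<in>words n. word_map w ` K \<inter> A \<noteq> {}}. \<phi> (word_map w base) * \<mu> w)
         \<longlonglongrightarrow> (\<integral>x. indicator A x * \<phi> x \<partial>\<nu>))"
proof -
  define J where "J = {0..<\<mu> []}"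
  define N where "N = restrict_space lborel J"
  define X where "X n t = (\<Sum>w\<in>words n. indicator (cell_interval \<mu> w) t *\<^sub>R word_map w base)" for n t
  define W where "W n t = (SOME w. w \<in> words n \<and> t \<in> cell_interval \<mu> w)" for n t
  define Y where "Y t = lim (\<lambda>n. X n t)" for t
  define D where "D = diameter K"
  have spN: "space N = J" by (simp add: N_def space_restrict_space)
  have W: "W n t \<in> words n" "t \<in> cell_interval \<mu> (W n t)" if "t \<in> J" for n t
  proof -
    have "\<exists>w. w \<in> words n \<and> t \<in> cell_interval \<mu> w"
      using cell_interval_cover[OF weight, of t n] that J_def by blast
    from someI_ex[OF this] have "W n t \<in> words n \<and> t \<in> cell_interval \<mu> (W n t)"
      unfolding W_def .
    then show "W n t \<in> words n" "t \<in> cell_interval \<mu> (W n t)" by (rule conjunct1, rule conjunct2)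
  qed
  have XW: "X n t = word_map (W n t) base" if "t \<in> J" for n t
    unfolding X_def
    by (rule sum_indicator_cell_interval[OF weight W[OF that]])
  have X_cell: "X (n + k) t \<in> word_map (W n t) ` K" if "t \<in> J" for n k t
  proof -
    have "W (n + k) t \<in> words (n + k)" by (rule W(1)[OF that])
    then obtain u v where uv: "W (n + k) t = u @ v" "u \<in> words n" "v \<in> words k"
      by (auto simp: words_eq_words_over words_over_add)
    \<comment> \<open>The first \<open>n\<close> letters of \<open>W (n + k) t\<close> also have an
      interval containing \<open>t\<close>, so they form \<open>W n t\<close>; this is the nesting
      of the cells.\<close>
    have "t \<in> cell_interval \<mu> u"
      using cell_interval_append[OF weight uv(2,3)] W(2)[OF that, of "n + k"] uv(1) by auto
    then have "u = W n t" using cell_interval_unique[OF weight uv(2) W(1)[OF that] _ W(2)[OF that]] by blast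
    then show ?thesis
      using uv word_map_in_K[OF uv(3) base_in_K] by (simp add: XW[OF that] word_map_append)
  qed
  have diam: "dist x y \<le> (1/3) ^ n * D"
    if cell: "x \<in> word_map w ` K" "y \<in> word_map w ` K" "w \<in> words n" for x y w n
  proof -
    obtain x' y' where xy: "x' \<in> K" "y' \<in> K" "x = word_map w x'" "y = word_map w y'"
      using cell by blast
    have "dist x' y' \<le> D" unfolding D_def
      using xy compact_imp_bounded[OF compact_K] by (intro diameter_bounded_bound)
    then show ?thesis using xy cell(3) by (simp add: dist_word_map words_def)
  qed
  have small: "(\<lambda>n. (1/3) ^ n * D) \<longlonglongrightarrow> 0" by real_asymp
  have XY: "(\<lambda>n. X n t) \<longlonglongrightarrow> Y t" if t: "t \<in> J" for t
  proof -
    have "Cauchy (\<lambda>n. X n t)"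
    proof (rule metric_CauchyI)
      fix e :: real assume "0 < e"
      from order_tendstoD(2)[OF small this] obtain n where n: "(1/3) ^ n * D < e"
        by (auto simp: eventually_sequentially)
      have *: "X k t \<in> word_map (W n t) ` K" if "n \<le> k" for k
        using X_cell[OF t, of n "k - n"] that by simp
      show "\<exists>M. \<forall>i\<ge>M. \<forall>j\<ge>M. dist (X i t) (X j t) < e"
        using le_less_trans[OF diam[OF * * W(1)[OF t]] n] by blast
    qed
    then show ?thesis unfolding Y_def by (simp add: Cauchy_convergent_iff convergent_LIMSEQ_iff)
  qed
  have Y_cell: "Y t \<in> word_map (W n t) ` K" if t: "t \<in> J" for n t
    by (rule closed_sequentially[OF compact_imp_closed[OF compact_cell] _ LIMSEQ_ignore_initial_segment[OF XY[OF t], of n]])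
      (use X_cell[OF t, of n] in \<open>simp add: add.commute\<close>)
  have YK: "Y t \<in> K" if "t \<in> J" for t
    using Y_cell[OF that, of 0] W(1)[OF that, of 0] by (simp add: words_def)
  have XK: "X n t \<in> K" if "t \<in> J" for n t
    using XW[OF that] word_map_in_K[OF W(1)[OF that] base_in_K] by simp
  have I_sets: "cell_interval \<mu> w \<in> sets borel" for w by (simp add: cell_interval_def)
  have measX [measurable]: "X n \<in> borel_measurable N" for n
    unfolding X_def N_def using I_sets
      by (intro measurable_restrict_space1 borel_measurable_sum borel_measurable_scaleR
          borel_measurable_indicator) auto
  have Ymeas: "Y \<in> borel_measurable N"
    by (rule borel_measurable_LIMSEQ_metric[where f=X, OF measX]) (simp add: XY spN)
  then have Ymeas' [measurable]: "Y \<in> measurable N (borel_on K)"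
    by (intro measurable_restrict_space2) (auto simp: spN YK)
  have M0: "0 \<le> \<mu> []" using weight_nonneg[OF weight, of "[]" 0] by (simp add: words_def)
  have finN: "finite_measure N"
    unfolding N_def by (intro finite_measureI) (simp add: space_restrict_space emeasure_restrict_space J_def M0)
  define \<nu> where "\<nu> = distr N (borel_on K) Y"
  have I_sub: "cell_interval \<mu> w \<subseteq> J" if "w \<in> words n" for w n
    using cell_interval_append[OF weight, of "[]" 0 w n] that by (simp add: words_def cell_interval_Nil J_def)
  have measI: "measure N (cell_interval \<mu> w) = \<mu> w" if "w \<in> words n" for w n
    using I_sub[OF that] weight_nonneg[OF weight that]
    by (simp add: N_def measure_restrict_space J_def) (simp add: cell_interval_def)
  have I_N: "cell_interval \<mu> w \<in> sets N" if "w \<in> words n" for w n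
    using I_sub[OF that] by (simp add: N_def sets_restrict_space_iff J_def I_sets)
  have main: "(\<lambda>n. \<Sum>w\<in>{w\<in>words n. word_map w ` K \<inter> A \<noteq> {}}. \<phi> (word_map w base) * \<mu> w)
         \<longlonglongrightarrow> (\<integral>x. indicator A x * \<phi> x \<partial>\<nu>)"
    if A: "compact A" "A \<subseteq> K" and \<phi>: "continuous_on K \<phi>" for A \<phi>
  proof -
    define h where "h n t = (\<Sum>w\<in>words n. indicator (cell_interval \<mu> w) t *\<^sub>R
        (if word_map w ` K \<inter> A \<noteq> {} then \<phi> (word_map w base) else 0))" for n t
    obtain B where B: "\<And>x. x \<in> K \<Longrightarrow> \<bar>\<phi> x\<bar> \<le> B"
      using compact_imp_bounded[OF compact_continuous_image[OF \<phi> compact_K]]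
      by (auto simp: bounded_iff)
    have "0 \<le> B" using B[OF base_in_K] by linarith
    have hW: "h n t = (if word_map (W n t) ` K \<inter> A \<noteq> {} then \<phi> (X n t) else 0)" if "t \<in> J" for n t
      unfolding h_def XW[OF that] by (rule sum_indicator_cell_interval[OF weight W[OF that]])
    have \<phi>meas [measurable]: "\<phi> \<in> borel_measurable (borel_on K)"
      by (rule borel_measurable_continuous_on_restrict[OF \<phi>])
    have Ameas [measurable]: "A \<in> sets (borel_on K)" by (rule compact_sets[OF A])
    have "(\<lambda>n. integral\<^sup>L N (h n)) \<longlonglongrightarrow> (\<integral>t. indicator A (Y t) * \<phi> (Y t) \<partial>N)"
    proof (rule integral_dominated_convergence)
      show "(\<lambda>t. indicator A (Y t) * \<phi> (Y t)) \<in> borel_measurable N" by measurable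
      show "h n \<in> borel_measurable N" for n
        unfolding h_def N_def using I_sets
      by (intro measurable_restrict_space1 borel_measurable_sum borel_measurable_scaleR
          borel_measurable_indicator) auto
      show "integrable N (\<lambda>_. B)" by (rule finite_measure.integrable_const[OF finN])
      show "AE t in N. norm (h n t) \<le> B" for n
        using B XK \<open>0 \<le> B\<close> by (intro AE_I2) (simp add: spN hW)
      show "AE t in N. (\<lambda>n. h n t) \<longlonglongrightarrow> indicator A (Y t) * \<phi> (Y t)"
      proof (intro AE_I2)
        fix t assume "t \<in> space N"
        then have t: "t \<in> J" by (simp add: spN)
        show "(\<lambda>n. h n t) \<longlonglongrightarrow> indicator A (Y t) * \<phi> (Y t)"
        proof (cases "Y t \<in> A")
          case True
          have "h n t = \<phi> (X n t)" for n using True Y_cell[OF t, of n] by (auto simp: hW[OF t])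
          moreover have "(\<lambda>n. \<phi> (X n t)) \<longlonglongrightarrow> \<phi> (Y t)"
            using continuous_on_tendsto_compose[OF \<phi> XY[OF t] YK[OF t]] XK[OF t] by simp
          ultimately show ?thesis using True by simp
        next
          case False
          have "open (- A)" using compact_imp_closed[OF A(1)] by (rule open_Compl)
          then obtain e where e: "0 < e" "ball (Y t) e \<subseteq> - A" using False unfolding open_contains_ball by blast
          have "eventually (\<lambda>n. h n t = 0) sequentially"
            using order_tendstoD(2)[OF small e(1)]
          proof eventually_elim
            case (elim n)
            have "dist (Y t) y < e" if "y \<in> word_map (W n t) ` K" for y
              using diam[OF Y_cell[OF t, of n] that W(1)[OF t]] elim by linarith
            with e(2) have "word_map (W n t) ` K \<inter> A = {}" by fastforce
            then show ?case by (simp add: hW[OF t])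
          qed
          then show ?thesis using False by (simp add: tendsto_eventually)
        qed
      qed
    qed
    moreover have "(\<integral>t. indicator A (Y t) * \<phi> (Y t) \<partial>N) = (\<integral>x. indicator A x * \<phi> x \<partial>\<nu>)"
      unfolding \<nu>_def by (subst integral_distr) auto
    moreover have "integral\<^sup>L N (h n)
        = (\<Sum>w\<in>{w\<in>words n. word_map w ` K \<inter> A \<noteq> {}}. \<phi> (word_map w base) * \<mu> w)" for n
    proof -
      have "integral\<^sup>L N (h n) = (\<Sum>w\<in>words n. measure N (cell_interval \<mu> w) *\<^sub>R
          (if word_map w ` K \<inter> A \<noteq> {} then \<phi> (word_map w base) else 0))"
        unfolding h_def using I_N finite_measure.emeasure_finite[OF finN]
        by (subst Bochner_Integration.integral_sum)
          (auto intro!: sum.cong integrable_scaleR_left integrable_real_indicator simp: less_top[symmetric]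
            sets.Int_space_eq1)
      also have "\<dots> = (\<Sum>w\<in>words n.
          if word_map w ` K \<inter> A \<noteq> {} then \<phi> (word_map w base) * \<mu> w else 0)"
        by (intro sum.cong) (auto simp: measI)
      also have "\<dots> = (\<Sum>w\<in>{w\<in>words n. word_map w ` K \<inter> A \<noteq> {}}. \<phi> (word_map w base) * \<mu> w)"
        by (rule sum.inter_filter[symmetric]) (rule finite_words)
      finally show ?thesis .
    qed
    ultimately show ?thesis by simp
  qed
  show ?thesis
    by (rule exI[of _ \<nu>]) (use main finN in
      \<open>auto simp: \<nu>_def intro!: finite_measure.finite_measure_distr\<close>)
qed

text \<open>The choice is immaterial: for \<open>\<phi> = 1\<close> the limits give the masses of
  all compact sets, and a finite Borel measure on \<open>K\<close> is determined by these.\<close>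

definition cell_measure :: "(nat list \<Rightarrow> real) \<Rightarrow> plane measure" where
  "cell_measure \<mu> = (SOME \<nu>. finite_measure \<nu> \<and> sets \<nu> = sets (borel_on K) \<and>
    (\<forall>A \<phi>. compact A \<longrightarrow> A \<subseteq> K \<longrightarrow> continuous_on K \<phi> \<longrightarrow>
       (\<lambda>n. \<Sum>w\<in>{w\<in>words n. word_map w ` K \<inter> A \<noteq> {}}. \<phi> (word_map w base) * \<mu> w)
         \<longlonglongrightarrow> (\<integral>x. indicator A x * \<phi> x \<partial>\<nu>)))"

lemma
  assumes "cell_weight \<mu>"
  shows finite_cell_measure: "finite_measure (cell_measure \<mu>)"
    and sets_cell_measure: "sets (cell_measure \<mu>) = sets (borel_on K)"
    and cell_measure_integral: "compact A \<Longrightarrow> A \<subseteq> K \<Longrightarrow> continuous_on K \<phi> \<Longrightarrow>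
       (\<lambda>n. \<Sum>w\<in>{w\<in>words n. word_map w ` K \<inter> A \<noteq> {}}. \<phi> (word_map w base) * \<mu> w)
         \<longlonglongrightarrow> (\<integral>x. indicator A x * \<phi> x \<partial>cell_measure \<mu>)"
  using someI_ex[OF cell_measure_exists[OF assms]] unfolding cell_measure_def by blast+

lemma cell_measure_compact:
  assumes "cell_weight \<mu>" "compact A" "A \<subseteq> K"
  shows "(\<lambda>n. \<Sum>w\<in>{w\<in>words n. word_map w ` K \<inter> A \<noteq> {}}. \<mu> w) \<longlonglongrightarrow> measure (cell_measure \<mu>) A"
  using cell_measure_integral[OF assms continuous_on_const[of K 1]]
    compact_sets[OF assms(2,3)] sets_cell_measure[OF assms(1)] by (simp add: Int_absorb1 sets.Int_space_eq2)

section \<open>Inner regularity and comparison of measures on the carpet\<close>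

text \<open>The general fact \<open>inner_regular\<close> concerns measures on \<open>borel\<close>,
  so \<open>\<nu>\<close> is first carried from \<open>K\<close> to the plane by the inclusion
  map.\<close>

lemma emeasure_inner_compact:
  assumes fin: "finite_measure \<nu>" and sets: "sets \<nu> = sets (borel_on K)" and B: "B \<in> sets (borel_on K)"
  shows "emeasure \<nu> B = (SUP A\<in>{A. A \<subseteq> B \<and> compact A}. emeasure \<nu> A)"
proof -
  have id: "(\<lambda>x. x) \<in> measurable \<nu> borel"
    using measurable_restrict_space1[OF measurable_ident, of borel K] sets
    by (simp add: id_def cong: measurable_cong_sets)
  have sp: "space \<nu> = K" using sets_eq_imp_space_eq[OF sets] by (simp add: space_borel_on)
  have BK: "B \<subseteq> K" "B \<in> sets borel" using B by (auto simp: sets_borel_on)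
  have eq: "emeasure (distr \<nu> borel (\<lambda>x. x)) A = emeasure \<nu> A" if "A \<subseteq> B" "A \<in> sets borel" for A
    using that BK sp by (subst emeasure_distr[OF id]) (auto intro: arg_cong[where f="emeasure \<nu>"])
  have "emeasure \<nu> B = emeasure (distr \<nu> borel (\<lambda>x. x)) B" using eq[of B] BK by simp
  also have "\<dots> = (SUP A\<in>{A. A \<subseteq> B \<and> compact A}. emeasure (distr \<nu> borel (\<lambda>x. x)) A)"
    using finite_measure.emeasure_finite[OF finite_measure.finite_measure_distr[OF fin id]] BK
    by (intro inner_regular) auto
  also have "\<dots> = (SUP A\<in>{A. A \<subseteq> B \<and> compact A}. emeasure \<nu> A)"
    by (intro SUP_cong) (auto simp: eq borel_compact)
  finally show ?thesis .
qed

lemma measure_eqI_compact: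
  assumes "finite_measure \<nu>" "sets \<nu> = sets (borel_on K)"
    and "finite_measure \<nu>'" "sets \<nu>' = sets (borel_on K)"
    and eq: "\<And>A. compact A \<Longrightarrow> A \<subseteq> K \<Longrightarrow> measure \<nu> A = measure \<nu>' A"
  shows "\<nu> = \<nu>'"
proof (rule measure_eqI)
  fix B assume "B \<in> sets \<nu>"
  then have B: "B \<in> sets (borel_on K)" using assms by simp
  have "emeasure \<nu> A = emeasure \<nu>' A" if "A \<subseteq> B" "compact A" for A
    using eq[OF that(2)] order_trans[OF that(1), of K] B by (simp add: finite_measure.emeasure_eq_measure[OF assms(1)]
        finite_measure.emeasure_eq_measure[OF assms(3)] sets_borel_on)
  then show "emeasure \<nu> B = emeasure \<nu>' B"
    unfolding emeasure_inner_compact[OF assms(1,2) B] emeasure_inner_compact[OF assms(3,4) B]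
    by (intro SUP_cong) auto
qed (use assms in simp)

text \<open>A linear bound between weights survives summation over the cells meeting a compact set,
  then the limit, then the supremum over compact subsets of \<open>B\<close>. Two terms on the right
  serve the triangle inequality; Lipschitz contractivity is the case \<open>a = 1\<close>,
  \<open>b = 0\<close>.\<close>

lemma cell_measure_le:
  assumes \<mu>: "cell_weight \<mu>" and \<mu>1: "cell_weight \<mu>1" and \<mu>2: "cell_weight \<mu>2"
    and ab: "0 \<le> a" "0 \<le> b"
    and le: "\<And>n w. w \<in> words n \<Longrightarrow> \<mu> w \<le> a * \<mu>1 w + b * \<mu>2 w"
    and B: "B \<in> sets (borel_on K)"
  shows "emeasure (cell_measure \<mu>) B
    \<le> ennreal a * emeasure (cell_measure \<mu>1) B + ennreal b * emeasure (cell_measure \<mu>2) B"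
proof -
  note fin = finite_cell_measure sets_cell_measure
  have "emeasure (cell_measure \<mu>) A
      \<le> ennreal a * emeasure (cell_measure \<mu>1) B + ennreal b * emeasure (cell_measure \<mu>2) B"
    if A: "A \<subseteq> B" "compact A" for A
  proof -
    have AK: "A \<subseteq> K" using order_trans[OF A(1), of K] B by (simp add: sets_borel_on)
    have "measure (cell_measure \<mu>) A \<le> a * measure (cell_measure \<mu>1) A + b * measure (cell_measure \<mu>2) A"
    proof (rule LIMSEQ_le[OF cell_measure_compact[OF \<mu> A(2) AK]])
      show "(\<lambda>n. a * (\<Sum>w\<in>{w\<in>words n. word_map w ` K \<inter> A \<noteq> {}}. \<mu>1 w) +
          b * (\<Sum>w\<in>{w\<in>words n. word_map w ` K \<inter> A \<noteq> {}}. \<mu>2 w))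
          \<longlonglongrightarrow> a * measure (cell_measure \<mu>1) A + b * measure (cell_measure \<mu>2) A"
        by (intro tendsto_intros cell_measure_compact assms A AK)
      show "\<exists>N. \<forall>n\<ge>N. (\<Sum>w\<in>{w\<in>words n. word_map w ` K \<inter> A \<noteq> {}}. \<mu> w)
          \<le> a * (\<Sum>w\<in>{w\<in>words n. word_map w ` K \<inter> A \<noteq> {}}. \<mu>1 w) +
          b * (\<Sum>w\<in>{w\<in>words n. word_map w ` K \<inter> A \<noteq> {}}. \<mu>2 w)"
        using le by (auto simp: sum_distrib_left sum.distrib[symmetric] intro!: sum_mono)
    qed
    also have "\<dots> \<le> a * measure (cell_measure \<mu>1) B + b * measure (cell_measure \<mu>2) B"
      using A(1) B ab \<mu>1 \<mu>2
      by (intro add_mono mult_left_mono finite_measure.finite_measure_mono fin)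
        (auto simp: sets_cell_measure)
    finally show ?thesis
      using ab by (simp add: finite_measure.emeasure_eq_measure fin \<mu> \<mu>1 \<mu>2
          flip: ennreal_mult' ennreal_plus)
  qed
  then show ?thesis
    unfolding emeasure_inner_compact[OF finite_cell_measure[OF \<mu>] sets_cell_measure[OF \<mu>] B]
    by (intro SUP_least) auto
qed

end

subsection \<open>The self-similar energy\<close>

locale carpet_energy = carpet +
  fixes m :: "plane measure" and p \<rho> :: real and E :: "(plane \<Rightarrow> real) \<Rightarrow> real"
  assumes p: "1 < p"
    and m: "is_carpet_measure K m"
    and rho: "0 < \<rho>"
    and dense: "dense_subset_on (sobolev K m p \<rho>) (sobolev_norm K m p \<rho>) (sobolev_cont K m p \<rho>)"
    and energy: "self_similar_energy K m p \<rho> E"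
begin

abbreviation "\<F> \<equiv> sobolev K m p \<rho>"
abbreviation "\<F>C \<equiv> sobolev_cont K m p \<rho>"

definition N :: "(plane \<Rightarrow> real) \<Rightarrow> real" where
  "N f = E f powr (1/p)"

lemma N_eta: "N = (\<lambda>f. E f powr (1/p))"
  by (simp add: N_def fun_eq_iff)

lemma E_nonneg: "f \<in> \<F> \<Longrightarrow> 0 \<le> E f"
  and N_seminorm: "seminorm_on \<F> N"
  and N_uniformly_convex: "uniformly_convex_on \<F> N"
  and E_lipschitz: "f \<in> \<F> \<Longrightarrow> 1-lipschitz_on UNIV \<phi> \<Longrightarrow> E (\<phi> \<circ> f) \<le> E f"
  and F_lipschitz: "f \<in> \<F> \<Longrightarrow> 1-lipschitz_on UNIV \<phi> \<Longrightarrow> \<phi> \<circ> f \<in> \<F>"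
  and E_eq_0_iff: "f \<in> \<F> \<Longrightarrow> E f = 0 \<longleftrightarrow> (\<exists>c. AE x in m. f x = c)"
  and F_carpet_map: "f \<in> \<F> \<Longrightarrow> i \<in> {1..8} \<Longrightarrow> f \<circ> carpet_map i \<in> \<F>"
  and E_carpet_map: "f \<in> \<F> \<Longrightarrow> E f = \<rho> * (\<Sum>i\<in>{1..8}. E (f \<circ> carpet_map i))"
  and FC_eq: "\<F>C = {f. continuous_on K f \<and> (\<forall>i\<in>{1..8}. f \<circ> carpet_map i \<in> \<F>)}"
  and F_symmetry: "f \<in> \<F> \<Longrightarrow> \<Phi> \<in> carpet_symmetries \<Longrightarrow> f \<circ> \<Phi> \<in> \<F>"
  and E_symmetry: "f \<in> \<F> \<Longrightarrow> \<Phi> \<in> carpet_symmetries \<Longrightarrow> E (f \<circ> \<Phi>) = E f"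
  using energy unfolding self_similar_energy_def Let_def N_eta by blast+

lemma N_comparable:
  obtains C where "1 \<le> C"
    "\<And>f. f \<in> \<F> \<Longrightarrow> sobolev_seminorm K m p \<rho> f \<le> C * N f"
    "\<And>f. f \<in> \<F> \<Longrightarrow> N f \<le> C * sobolev_seminorm K m p \<rho> f"
proof -
  obtain C where C: "1 \<le> C"
    "\<forall>f\<in>\<F>. sobolev_seminorm K m p \<rho> f / C \<le> N f \<and> N f \<le> C * sobolev_seminorm K m p \<rho> f"
    using energy unfolding self_similar_energy_def Let_def N_eta by blast
  show ?thesis
  proof (rule that[OF C(1)])
    fix f assume f: "f \<in> \<F>"
    then have "sobolev_seminorm K m p \<rho> f / C \<le> N f" using C(2) by blast
    with C(1) show "sobolev_seminorm K m p \<rho> f \<le> C * N f" by (simp add: field_simps)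
    show "N f \<le> C * sobolev_seminorm K m p \<rho> f" using C(2) f by blast
  qed
qed

lemma N_nonneg: "0 \<le> N f"
  by (simp add: N_def)

lemma E_eq_N: "f \<in> \<F> \<Longrightarrow> E f = N f powr p"
  using p by (simp add: N_def powr_powr E_nonneg)

lemma F_add: "f \<in> \<F> \<Longrightarrow> g \<in> \<F> \<Longrightarrow> (\<lambda>x. f x + g x) \<in> \<F>"
  and F_mult: "f \<in> \<F> \<Longrightarrow> (\<lambda>x. c * f x) \<in> \<F>"
  and N_mult: "f \<in> \<F> \<Longrightarrow> N (\<lambda>x. c * f x) = \<bar>c\<bar> * N f"
  and N_add: "f \<in> \<F> \<Longrightarrow> g \<in> \<F> \<Longrightarrow> N (\<lambda>x. f x + g x) \<le> N f + N g"
  using N_seminorm unfolding seminorm_on_def fun_subspace_def by blast+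

lemma F_diff: "f \<in> \<F> \<Longrightarrow> g \<in> \<F> \<Longrightarrow> (\<lambda>x. f x - g x) \<in> \<F>"
  using F_add[of f "\<lambda>x. (-1) * g x"] F_mult[of g "-1"] by simp

lemma N_diff: "f \<in> \<F> \<Longrightarrow> g \<in> \<F> \<Longrightarrow> N (\<lambda>x. f x - g x) \<le> N f + N g"
  using N_add[of f "\<lambda>x. (-1) * g x"] F_mult[of g "-1"] N_mult[of g "-1"] by simp

lemma N_le_add_diff: "f \<in> \<F> \<Longrightarrow> g \<in> \<F> \<Longrightarrow> N f \<le> N g + N (\<lambda>x. f x - g x)"
  using N_add[of g "\<lambda>x. f x - g x"] F_diff[of f g] by simp

section \<open>Null sets and independence of the representative\<close>

lemma sets_m: "sets m = sets (borel_on K)"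
  using m by (simp add: is_carpet_measure_def)

lemma space_m: "space m = K"
  using sets_eq_imp_space_eq[OF sets_m] by (simp add: space_borel_on)

lemma prob_space_m: "prob_space m"
  using m by (simp add: is_carpet_measure_def)

lemma measurable_carpet_map: "i \<in> {1..8} \<Longrightarrow> carpet_map i \<in> measurable m m"
proof -
  assume i: "i \<in> {1..8}"
  have "carpet_map i \<in> measurable (borel_on K) (borel_on K)"
    using carpet_map_in_K[OF i]
    by (intro measurable_restrict_space2 borel_measurable_continuous_on_restrict continuous_on_carpet_map
        continuous_on_id) (auto simp: space_restrict_space)
  then show ?thesis by (simp add: measurable_cong_sets[OF sets_m sets_m])
qed

text \<open>By self-similarity, \<open>m\<close> is the average of its images under the eight maps,
  so a null set has null preimage under each of them. Hence composition with a cell map respects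
  equality almost everywhere.\<close>

lemma AE_carpet_map:
  assumes "i \<in> {1..8}" "AE x in m. P x"
  shows "AE x in m. P (carpet_map i x)"
proof -
  interpret prob_space m by (rule prob_space_m)
  obtain Z where Z: "Z \<in> null_sets m" "{x\<in>space m. \<not> P x} \<subseteq> Z"
    using assms(2) by (auto simp: eventually_ae_filter)
  have Zs: "Z \<in> sets m" using Z by auto
  have "measure m Z = 0" using Z by (simp add: measure_def null_setsD1)
  moreover have "measure m Z = (\<Sum>i\<in>{1..8}. measure (distr m m (carpet_map i)) Z) / 8"
    using m Zs by (simp add: is_carpet_measure_def)
  ultimately have "(\<Sum>i\<in>{1..8}. measure (distr m m (carpet_map i)) Z) = 0" by simp
  then have "measure (distr m m (carpet_map i)) Z = 0"
    using assms(1) by (subst (asm) sum_nonneg_eq_0_iff) auto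
  then have "measure m (carpet_map i -` Z \<inter> space m) = 0"
    by (simp add: measure_distr[OF measurable_carpet_map[OF assms(1)] Zs])
  then have "carpet_map i -` Z \<inter> space m \<in> null_sets m"
    using measurable_sets[OF measurable_carpet_map[OF assms(1)] Zs]
    by (intro null_setsI) (simp_all add: emeasure_eq_measure)
  from AE_not_in[OF this] AE_space show ?thesis
  proof eventually_elim
    case (elim x)
    then have "carpet_map i x \<in> space m" using carpet_map_in_K[OF assms(1)] by (simp add: space_m)
    with elim Z(2) show ?case by blast
  qed
qed

text \<open>Functions are defined on the whole plane, while folded or clamped functions can be
  identified on \<open>K\<close> only.\<close>

lemma F_cong:
  assumes "f \<in> \<F>" "\<And>x. x \<in> K \<Longrightarrow> f x = g x"
  shows "g \<in> \<F>"
proof -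
  have "cell_mean K m g = cell_mean K m f"
    unfolding cell_mean_def set_lebesgue_integral_def using assms(2)
    by (auto intro!: ext arg_cong2[where f="(/)"] Bochner_Integration.integral_cong simp: space_m)
  moreover have "g \<in> borel_measurable m \<longleftrightarrow> f \<in> borel_measurable m"
    by (rule measurable_cong) (simp add: assms(2) space_m)
  moreover have "integrable m (\<lambda>x. \<bar>g x\<bar> powr p) \<longleftrightarrow> integrable m (\<lambda>x. \<bar>f x\<bar> powr p)"
    by (rule Bochner_Integration.integrable_cong) (simp_all add: assms(2) space_m)
  ultimately show ?thesis
    using assms(1) by (auto simp: sobolev_def Lp_space_def scaled_energy_def)
qed

text \<open>The difference of the two functions has zero energy, and the triangle inequality for
  \<open>N\<close> does the rest.\<close>

lemma E_cong_AE:
  assumes "f \<in> \<F>" "g \<in> \<F>" "AE x in m. f x = g x"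
  shows "E f = E g"
proof -
  have "E (\<lambda>x. f x - g x) = 0" "E (\<lambda>x. g x - f x) = 0"
    using assms by (auto simp: E_eq_0_iff[OF F_diff] intro!: exI[of _ 0])
  then have "N f = N g"
    using N_le_add_diff[of f g] N_le_add_diff[of g f] assms by (simp add: N_def[of "\<lambda>x. _ x - _ x"])
  then show ?thesis using assms by (simp add: E_eq_N)
qed

lemma E_cong: "f \<in> \<F> \<Longrightarrow> (\<And>x. x \<in> K \<Longrightarrow> f x = g x) \<Longrightarrow> E f = E g"
  by (rule E_cong_AE) (auto intro: F_cong AE_I2 simp: space_m)

lemma N_cong: "f \<in> \<F> \<Longrightarrow> (\<And>x. x \<in> K \<Longrightarrow> f x = g x) \<Longrightarrow> N f = N g"
  using E_cong[of f g] by (simp add: N_def)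

lemma FC_F: "f \<in> \<F>C \<Longrightarrow> f \<in> \<F>" and FC_cont: "f \<in> \<F>C \<Longrightarrow> continuous_on K f"
  by (simp_all add: sobolev_cont_def)

lemma FC_I: "f \<in> \<F> \<Longrightarrow> continuous_on K f \<Longrightarrow> f \<in> \<F>C"
  by (simp add: sobolev_cont_def)

lemma FC_carpetI: "continuous_on K f \<Longrightarrow> (\<And>i. i \<in> {1..8} \<Longrightarrow> f \<circ> carpet_map i \<in> \<F>) \<Longrightarrow> f \<in> \<F>C"
  by (simp add: FC_eq)

lemma comp_word_map_Cons: "f \<circ> word_map (i # w) = f \<circ> carpet_map i \<circ> word_map w"
  by (simp add: fun_eq_iff)

lemma comp_word_map_append: "f \<circ> word_map (u @ v) = f \<circ> word_map u \<circ> word_map v"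
  by (simp add: fun_eq_iff word_map_append)

lemma FC_carpet_map:
  assumes "f \<in> \<F>C" "i \<in> {1..8}" shows "f \<circ> carpet_map i \<in> \<F>C"
proof (rule FC_I[OF F_carpet_map[OF FC_F[OF assms(1)] assms(2)]])
  show "continuous_on K (f \<circ> carpet_map i)"
    unfolding comp_def using carpet_map_in_K[OF assms(2)]
    by (intro continuous_on_compose2[OF FC_cont[OF assms(1)]] continuous_on_carpet_map
        continuous_on_id image_subsetI)
qed

lemma F_word_map: "f \<in> \<F> \<Longrightarrow> w \<in> words n \<Longrightarrow> f \<circ> word_map w \<in> \<F>"
proof (induction w arbitrary: n f)
  case (Cons i w)
  then have w: "w \<in> words (n - 1)" and i: "i \<in> {1..8}" by (auto simp: words_def)
  show ?case
    unfolding comp_word_map_Cons by (rule Cons.IH[OF F_carpet_map[OF Cons.prems(1) i] w])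
qed simp

lemma AE_word_map: "w \<in> words n \<Longrightarrow> AE x in m. P x \<Longrightarrow> AE x in m. P (word_map w x)"
proof (induction w arbitrary: n P)
  case (Cons i w)
  then have w: "w \<in> words (n - 1)" and i: "i \<in> {1..8}" by (auto simp: words_def)
  from Cons.IH[OF w AE_carpet_map[OF i Cons.prems(2)]] show ?case by simp
qed simp

lemma E_words: "f \<in> \<F> \<Longrightarrow> E f = \<rho> ^ n * (\<Sum>w\<in>words n. E (f \<circ> word_map w))"
proof (induction n arbitrary: f)
  case (Suc n)
  have "E f = \<rho> * (\<Sum>i\<in>{1..8}. \<rho> ^ n * (\<Sum>w\<in>words n. E (f \<circ> carpet_map i \<circ> word_map w)))"
    unfolding E_carpet_map[OF Suc.prems]
    using Suc.IH[OF F_carpet_map[OF Suc.prems]] by (intro arg_cong2[where f="(*)"] sum.cong refl)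
  then show ?case
    unfolding words_eq_words_over sum_words_over_Suc comp_word_map_Cons
    by (simp only: sum_distrib_left power_Suc mult_ac)
qed (simp add: words_eq_words_over)

definition weight :: "(plane \<Rightarrow> real) \<Rightarrow> nat list \<Rightarrow> real" where
  "weight f w = \<rho> ^ length w * E (f \<circ> word_map w)"

lemma weight_append: "weight f (u @ v) = \<rho> ^ length u * weight (f \<circ> word_map u) v"
  by (simp add: weight_def comp_word_map_append power_add)

lemma cell_weight_weight: "f \<in> \<F> \<Longrightarrow> cell_weight (weight f)"
  unfolding cell_weight_def
proof (intro allI ballI)
  fix n w assume f: "f \<in> \<F>" and w: "w \<in> words n"
  have "0 \<le> weight f w" using rho by (simp add: weight_def E_nonneg[OF F_word_map[OF f w]])
  moreover have "weight f w = (\<Sum>i\<in>{1..8}. weight f (w @ [i]))"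
    unfolding weight_def comp_word_map_append E_carpet_map[OF F_word_map[OF f w]]
    by (simp add: sum_distrib_left mult_ac)
  ultimately show "0 \<le> weight f w \<and> weight f w = (\<Sum>i\<in>{1..8}. weight f (w @ [i]))" by simp
qed

section \<open>Uniform convergence and the Sobolev seminorm\<close>

definition uniformly_to :: "(nat \<Rightarrow> plane \<Rightarrow> real) \<Rightarrow> (plane \<Rightarrow> real) \<Rightarrow> bool" where
  "uniformly_to s f \<longleftrightarrow> (\<forall>\<epsilon>>0. \<forall>\<^sub>F k in sequentially. \<forall>x\<in>K. \<bar>s k x - f x\<bar> \<le> \<epsilon>)"

lemma integrable_F:
  assumes "f \<in> \<F>" shows "integrable m f"
proof -
  interpret prob_space m by (rule prob_space_m)
  have f: "f \<in> borel_measurable m" "integrable m (\<lambda>x. \<bar>f x\<bar> powr p)"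
    using assms by (auto simp: sobolev_def Lp_space_def)
  have "\<bar>y\<bar> \<le> 1 + \<bar>y\<bar> powr p" for y :: real
  proof (cases "\<bar>y\<bar> \<le> 1")
    case True
    then show ?thesis using powr_ge_zero[of "\<bar>y\<bar>" p] by linarith
  next
    case False
    then show ?thesis using powr_mono[of 1 p "\<bar>y\<bar>"] p by simp
  qed
  then show ?thesis
    using f by (intro Bochner_Integration.integrable_bound[of m "\<lambda>x. 1 + \<bar>f x\<bar> powr p" f]) (auto intro!: AE_I2)
qed

lemma tendsto_cell_mean:
  assumes s: "\<And>k. s k \<in> \<F>" and f: "f \<in> \<F>" and lim: "uniformly_to s f" and u: "u \<in> words n"
  shows "(\<lambda>k. cell_mean K m (s k) u) \<longlonglongrightarrow> cell_mean K m f u"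
proof -
  interpret prob_space m by (rule prob_space_m)
  let ?A = "word_map u ` K"
  have "?A \<subseteq> K" using word_map_in_K[OF u] by (rule image_subsetI)
  then have A: "?A \<in> sets m" unfolding sets_m by (rule compact_sets[OF compact_cell])
  have int: "integrable m (\<lambda>x. indicator ?A x *\<^sub>R g x)" if "g \<in> \<F>" for g
    by (rule integrable_mult_indicator[OF A integrable_F[OF that]])
  have "(\<lambda>k. LINT x:?A|m. s k x) \<longlonglongrightarrow> (LINT x:?A|m. f x)"
  proof (rule tendstoI)
    fix e :: real assume "0 < e"
    then have "\<forall>\<^sub>F k in sequentially. \<forall>x\<in>K. \<bar>s k x - f x\<bar> \<le> e / 2"
      using lim half_gt_zero unfolding uniformly_to_def by blast
    then show "\<forall>\<^sub>F k in sequentially. dist (LINT x:?A|m. s k x) (LINT x:?A|m. f x) < e"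
    proof eventually_elim
      case (elim k)
      have "(LINT x:?A|m. s k x) - (LINT x:?A|m. f x)
          = (\<integral>x. indicator ?A x *\<^sub>R s k x - indicator ?A x *\<^sub>R f x \<partial>m)"
        unfolding set_lebesgue_integral_def by (simp only: Bochner_Integration.integral_diff[OF int[OF s] int[OF f]])
      also have "\<bar>\<dots>\<bar> \<le> (\<integral>x. e / 2 \<partial>m)"
      proof (rule order_trans[OF integral_abs_bound], rule integral_mono)
        show "integrable m (\<lambda>x. \<bar>indicator ?A x *\<^sub>R s k x - indicator ?A x *\<^sub>R f x\<bar>)"
          by (intro integrable_abs Bochner_Integration.integrable_diff int s f)
        show "\<bar>indicator ?A x *\<^sub>R s k x - indicator ?A x *\<^sub>R f x\<bar> \<le> e / 2" if "x \<in> space m" for x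
          using bspec[OF elim, of x] that \<open>0 < e\<close> by (cases "x \<in> ?A") (simp_all add: space_m)
      qed simp
      also have "\<dots> = e / 2" by (simp add: prob_space)
      finally show ?case using \<open>0 < e\<close> by (simp add: dist_real_def)
    qed
  qed
  moreover have "measure m ?A = (1/8) ^ n"
    using m u by (auto simp: is_carpet_measure_def)
  ultimately show ?thesis
    unfolding cell_mean_def by (intro tendsto_divide tendsto_const) auto
qed

lemma scaled_energy_nonneg: "0 \<le> scaled_energy K m p \<rho> f n"
  unfolding scaled_energy_def graph_energy_def using rho
  by (intro mult_nonneg_nonneg divide_nonneg_nonneg sum_nonneg) auto

lemma scaled_energy_le_seminorm:
  assumes f: "f \<in> \<F>" and n: "1 \<le> n"
  shows "scaled_energy K m p \<rho> f n \<le> sobolev_seminorm K m p \<rho> f powr p"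
proof -
  have "bdd_above (scaled_energy K m p \<rho> f ` {1..})" using f by (simp add: sobolev_def)
  then have le: "scaled_energy K m p \<rho> f n \<le> (SUP n\<in>{1..}. scaled_energy K m p \<rho> f n)"
    using n by (intro cSUP_upper) auto
  with scaled_energy_nonneg[of f n] have "0 \<le> (SUP n\<in>{1..}. scaled_energy K m p \<rho> f n)" by linarith
  with le p show ?thesis by (simp add: sobolev_seminorm_def powr_powr)
qed

text \<open>The seminorm is a supremum of discrete energies, each a continuous function of finitely
  many cell means, and cell means converge under uniform convergence. For \<open>E\<close> itself
  this yields semicontinuity only up to the comparison constant, which is not enough; the sharp
  version needs uniform convexity.\<close>

lemma seminorm_lsc:
  assumes s: "\<And>k. s k \<in> \<F>" and f: "f \<in> \<F>" and lim: "uniformly_to s f"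
    and le: "\<forall>\<^sub>F k in sequentially. sobolev_seminorm K m p \<rho> (s k) \<le> b"
  shows "sobolev_seminorm K m p \<rho> f \<le> b"
proof -
  have sem0: "0 \<le> sobolev_seminorm K m p \<rho> g" for g by (simp add: sobolev_seminorm_def)
  have "0 \<le> b" using eventually_happens'[OF sequentially_bot le] sem0 order_trans by blast
  have "scaled_energy K m p \<rho> f n \<le> b powr p" if n: "1 \<le> n" for n
  proof (rule tendsto_le[OF sequentially_bot tendsto_const])
    show "(\<lambda>k. scaled_energy K m p \<rho> (s k) n) \<longlonglongrightarrow> scaled_energy K m p \<rho> f n"
      unfolding scaled_energy_def graph_energy_def split_def
      using p by (intro tendsto_intros tendsto_cell_mean s f lim)
        (auto simp: carpet_adj_def)
    show "\<forall>\<^sub>F k in sequentially. scaled_energy K m p \<rho> (s k) n \<le> b powr p"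
      using le
    proof eventually_elim
      case (elim k)
      then have "sobolev_seminorm K m p \<rho> (s k) powr p \<le> b powr p"
        using p sem0 by (intro powr_mono2) auto
      then show ?case using scaled_energy_le_seminorm[OF s n, of k] by linarith
    qed
  qed
  then have "(SUP n\<in>{1..}. scaled_energy K m p \<rho> f n) \<le> b powr p"
    by (intro cSUP_least) auto
  moreover have "0 \<le> (SUP n\<in>{1..}. scaled_energy K m p \<rho> f n)"
    using f scaled_energy_nonneg[of f 1] by (intro cSUP_upper2[of _ _ 1]) (auto simp: sobolev_def)
  ultimately have "sobolev_seminorm K m p \<rho> f \<le> (b powr p) powr (1/p)"
    unfolding sobolev_seminorm_def using p by (intro powr_mono2) auto
  then show ?thesis using p \<open>0 \<le> b\<close> by (simp add: powr_powr)
qed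

end

subsection \<open>Symmetries of the carpet\<close>

text \<open>Images of corners bound the absolute row sums of the matrix by 1. Preimages of two
  corners with one common coordinate are different points at which the corresponding row takes the
  value 1, so this row has a zero entry; surjectivity then leaves only entries of modulus 1 in the
  right places.\<close>

lemma square_symmetry_cases:
  assumes "T \<in> carpet_symmetries"
  obtains a b c d where "\<And>z. T z = (a * fst z + b * snd z, c * fst z + d * snd z)"
    "a \<in> {-1, 1} \<and> d \<in> {-1, 1} \<and> b = 0 \<and> c = 0 \<or> b \<in> {-1, 1} \<and> c \<in> {-1, 1} \<and> a = 0 \<and> d = 0"
proof -
  have lin: "linear T" and Q: "T ` cbox (-1,-1) (1,1) = cbox (-1,-1) (1,1)"
    using assms by (auto simp: carpet_symmetries_def)
  obtain a c where ac: "T (1, 0) = (a, c)" by (cases "T (1, 0)")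
  obtain b d where bd: "T (0, 1) = (b, d)" by (cases "T (0, 1)")
  have T: "T z = (a * fst z + b * snd z, c * fst z + d * snd z)" for z
  proof -
    have "z = fst z *\<^sub>R (1, 0) + snd z *\<^sub>R (0, 1)" by (cases z) simp
    then have "T z = fst z *\<^sub>R T (1, 0) + snd z *\<^sub>R T (0, 1)"
      by (metis linear_add[OF lin] linear_scale[OF lin])
    then show ?thesis by (simp add: ac bd mult.commute)
  qed
  have mem: "(x, y) \<in> cbox (-1,-1) (1,1) \<longleftrightarrow> \<bar>x\<bar> \<le> 1 \<and> \<bar>y\<bar> \<le> 1" for x y :: real
    by (auto simp: cbox_Pair_eq)
  have img: "\<bar>a * x + b * y\<bar> \<le> 1 \<and> \<bar>c * x + d * y\<bar> \<le> 1" if "\<bar>x\<bar> \<le> 1" "\<bar>y\<bar> \<le> 1" for x y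
  proof -
    have "T (x, y) \<in> cbox (-1,-1) (1,1)" using Q that mem[of x y] by blast
    then show ?thesis by (simp add: T mem abs_le_iff)
  qed
  have pre: "\<exists>x y. \<bar>x\<bar> \<le> 1 \<and> \<bar>y\<bar> \<le> 1 \<and> a * x + b * y = s \<and> c * x + d * y = t"
    if "\<bar>s\<bar> \<le> 1" "\<bar>t\<bar> \<le> 1" for s t
  proof -
    have "(s, t) \<in> T ` cbox (-1,-1) (1,1)" unfolding Q mem using that by blast
    then obtain x y where "(x, y) \<in> cbox (-1,-1) (1,1)" "T (x, y) = (s, t)" by auto
    then show ?thesis by (metis T mem fst_conv snd_conv Pair_inject)
  qed
  have abs1: "\<bar>a\<bar> + \<bar>b\<bar> \<le> 1" "\<bar>c\<bar> + \<bar>d\<bar> \<le> 1"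
    using img[of 1 1] img[of 1 "-1"] by auto
  \<comment> \<open>If both coefficients are nonzero and their moduli sum to at most 1, the value 1
    forces each term to be maximal, which fixes the point of the square.\<close>
  have det: "x = x' \<and> y = y'"
    if "\<bar>u\<bar> + \<bar>v\<bar> \<le> 1" "u \<noteq> 0" "v \<noteq> 0" "u * x + v * y = 1" "u * x' + v * y' = 1"
      "\<bar>x\<bar> \<le> 1" "\<bar>y\<bar> \<le> 1" "\<bar>x'\<bar> \<le> 1" "\<bar>y'\<bar> \<le> 1" for u v x y x' y' :: real
  proof -
    have le: "u * s \<le> \<bar>u\<bar>" if "\<bar>s\<bar> \<le> 1" for u s :: real
      using mult_left_mono[OF that, of "\<bar>u\<bar>"] abs_ge_self[of "u * s"] by (simp add: abs_mult)
    have "u * x = u * x'" "v * y = v * y'"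
      using that le[of x u] le[of y v] le[of x' u] le[of y' v] by linarith+
    then show ?thesis using that by simp
  qed
  obtain x1 y1 where p1: "\<bar>x1\<bar> \<le> 1" "\<bar>y1\<bar> \<le> 1" "a * x1 + b * y1 = 1" "c * x1 + d * y1 = 1"
    using pre[of 1 1] by auto
  obtain x2 y2 where p2: "\<bar>x2\<bar> \<le> 1" "\<bar>y2\<bar> \<le> 1" "a * x2 + b * y2 = 1" "c * x2 + d * y2 = -1"
    using pre[of 1 "-1"] by auto
  obtain x3 y3 where p3: "\<bar>x3\<bar> \<le> 1" "\<bar>y3\<bar> \<le> 1" "a * x3 + b * y3 = -1" "c * x3 + d * y3 = 1"
    using pre[of "-1" 1] by auto
  have ab: "a = 0 \<or> b = 0"
  proof (rule ccontr)
    assume "\<not> (a = 0 \<or> b = 0)"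
    with det[OF abs1(1) _ _ p1(3) p2(3) p1(1,2) p2(1,2)] have "x1 = x2 \<and> y1 = y2" by blast
    with p1 p2 show False by simp
  qed
  have cd: "c = 0 \<or> d = 0"
  proof (rule ccontr)
    assume "\<not> (c = 0 \<or> d = 0)"
    with det[OF abs1(2) _ _ p1(4) p3(4) p1(1,2) p3(1,2)] have "x1 = x3 \<and> y1 = y3" by blast
    with p1 p3 show False by simp
  qed
  have unit: "u \<in> {-1, 1}" if "u * s = 1" "\<bar>u\<bar> \<le> 1" "\<bar>s\<bar> \<le> 1" for u s :: real
  proof -
    have "\<bar>u\<bar> * \<bar>s\<bar> = 1" using that(1) by (simp flip: abs_mult)
    moreover have "\<bar>u\<bar> * \<bar>s\<bar> \<le> \<bar>u\<bar>" using mult_left_mono[OF that(3), of "\<bar>u\<bar>"] by simp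
    ultimately show ?thesis using that(2) by auto
  qed
  have "a \<in> {-1, 1} \<and> d \<in> {-1, 1} \<and> b = 0 \<and> c = 0 \<or> b \<in> {-1, 1} \<and> c \<in> {-1, 1} \<and> a = 0 \<and> d = 0"
  proof (cases "b = 0")
    case True
    then have ax: "a * x1 = 1" "a * x2 = 1" using p1(3) p2(3) by auto
    then have "x1 = x2" by (metis mult_left_cancel mult_zero_left zero_neq_one)
    then have "d \<noteq> 0" using p1(4) p2(4) by auto
    then have "c = 0" using cd by blast
    then show ?thesis using True unit[OF ax(1)] unit[of d y1] p1 abs1 by auto
  next
    case False
    then have "a = 0" using ab by blast
    then have ax: "b * y1 = 1" "b * y2 = 1" using p1(3) p2(3) by auto
    then have "y1 = y2" by (metis mult_left_cancel mult_zero_left zero_neq_one)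
    then have "c \<noteq> 0" using p1(4) p2(4) by auto
    then have "d = 0" using cd by blast
    then show ?thesis using \<open>a = 0\<close> unit[OF ax(1)] unit[of c x1] p1 abs1 by auto
  qed
  with T show ?thesis by (rule that)
qed

lemma symmetry_inj:
  assumes "T \<in> carpet_symmetries" shows "inj T"
proof (rule injI)
  fix x y assume "T x = T y"
  moreover obtain a b c d where "\<And>z. T z = (a * fst z + b * snd z, c * fst z + d * snd z)"
    and "a \<in> {-1, 1} \<and> d \<in> {-1, 1} \<and> b = 0 \<and> c = 0 \<or> b \<in> {-1, 1} \<and> c \<in> {-1, 1} \<and> a = 0 \<and> d = 0"
    using square_symmetry_cases[OF assms] by blast
  ultimately show "x = y" by (elim disjE conjE) (auto simp: prod_eq_iff)
qed

text \<open>An injection of the finite set of grid points into itself is a permutation, here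
  transported to the letters.\<close>

lemma symmetry_permutes_points:
  assumes "T \<in> carpet_symmetries"
  obtains \<sigma> where "bij_betw \<sigma> {1..8} {1..8}" "\<And>i. i \<in> {1..8} \<Longrightarrow> T (carpet_pt i) = carpet_pt (\<sigma> i)"
proof -
  let ?P = "carpet_pt ` {1..8}"
  obtain a b c d where T: "\<And>z. T z = (a * fst z + b * snd z, c * fst z + d * snd z)"
    and cases: "a \<in> {-1, 1} \<and> d \<in> {-1, 1} \<and> b = 0 \<and> c = 0 \<or> b \<in> {-1, 1} \<and> c \<in> {-1, 1} \<and> a = 0 \<and> d = 0"
    using square_symmetry_cases[OF assms] by blast
  define S where "S = {-1, 0, 1::real}"
  have unit: "u * x \<in> S \<and> (u * x = 0 \<longleftrightarrow> x = 0)" if "u \<in> {-1, 1}" "x \<in> S"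
    for u x :: real using that unfolding S_def insert_iff empty_iff by (elim disjE) simp_all
  have "T ` ?P \<subseteq> ?P"
  proof (rule image_subsetI)
    fix z assume "z \<in> ?P"
    then have "z \<in> {-1, 0, 1} \<times> {-1, 0, 1}" "z \<noteq> (0, 0)" unfolding carpet_pt_image by blast+
    then have z: "fst z \<in> S" "snd z \<in> S" "\<not> (fst z = 0 \<and> snd z = 0)"
      by (auto simp only: mem_Times_iff prod_eq_iff fst_conv snd_conv S_def)
    show "T z \<in> ?P"
      unfolding carpet_pt_image Diff_iff mem_Times_iff S_def[symmetric]
      using cases
    proof (elim disjE conjE)
      assume "a \<in> {-1, 1}" "d \<in> {-1, 1}" "b = 0" "c = 0"
      then show "(fst (T z) \<in> S \<and> snd (T z) \<in> S) \<and> T z \<notin> {(0, 0)}"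
        using unit[of a "fst z"] unit[of d "snd z"] z by (auto simp: T)
    next
      assume "b \<in> {-1, 1}" "c \<in> {-1, 1}" "a = 0" "d = 0"
      then show "(fst (T z) \<in> S \<and> snd (T z) \<in> S) \<and> T z \<notin> {(0, 0)}"
        using unit[of b "snd z"] unit[of c "fst z"] z by (auto simp: T)
    qed
  qed
  moreover have "inj_on T ?P" 
    by (rule inj_on_subset[OF symmetry_inj[OF assms] subset_UNIV])
  ultimately have "bij_betw T ?P ?P"
    by (simp add: bij_betw_def endo_inj_surj)
  moreover have q: "bij_betw carpet_pt {1..8} ?P"
    by (rule inj_on_imp_bij_betw[OF inj_on_carpet_pt])
  ultimately have "bij_betw (inv_into {1..8} carpet_pt \<circ> (T \<circ> carpet_pt)) {1..8} {1..8}"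
    by (intro bij_betw_trans[OF bij_betw_trans] bij_betw_inv_into)
  moreover have "T (carpet_pt i) = carpet_pt ((inv_into {1..8} carpet_pt \<circ> (T \<circ> carpet_pt)) i)"
    if "i \<in> {1..8}" for i
    using that \<open>T ` ?P \<subseteq> ?P\<close> by (simp add: f_inv_into_f image_subset_iff)
  ultimately show ?thesis by (rule that)
qed

lemma symmetry_carpet_map:
  assumes "T \<in> carpet_symmetries" "T (carpet_pt i) = carpet_pt j"
  shows "T (carpet_map i z) = carpet_map j (T z)"
proof -
  have lin: "linear T" using assms by (simp add: carpet_symmetries_def)
  show ?thesis
    unfolding carpet_map_def linear_add[OF lin] linear_scale[OF lin] linear_diff[OF lin] assms(2) ..
qed

lemma symmetry_bij:
  assumes "T \<in> carpet_symmetries"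
  shows "bij T" "inv T \<in> carpet_symmetries"
proof -
  note inj = symmetry_inj[OF assms]
  have lin: "linear T" and Q: "T ` cbox (-1,-1) (1,1) = cbox (-1,-1) (1,1)"
    using assms by (auto simp: carpet_symmetries_def)
  show bij: "bij T" using linear_inj_imp_surj[OF lin] inj by (simp add: bij_def)
  obtain T' where T': "linear T'" "\<And>x. T' (T x) = x" "\<And>x. T (T' x) = x"
    using linear_injective_isomorphism[OF lin inj] by auto
  then have inv: "inv T = T'" by (intro inv_unique_comp) (auto simp: fun_eq_iff)
  have "T' ` cbox (-1,-1) (1,1) = T' ` T ` cbox (-1,-1) (1,1)" by (simp only: Q)
  also have "\<dots> = cbox (-1,-1) (1,1)" by (simp only: image_image T'(2) image_ident)
  finally show "inv T \<in> carpet_symmetries" using T'(1) by (simp add: inv carpet_symmetries_def)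
qed

context carpet
begin

lemma carpet_symmetry_words:
  assumes T: "T \<in> carpet_symmetries"
  shows "\<exists>\<sigma>. bij_betw \<sigma> {1..8} {1..8} \<and> (\<forall>i\<in>{1..8}. T (carpet_pt i) = carpet_pt (\<sigma> i)) \<and>
    (\<forall>n. \<forall>w\<in>words n. \<forall>z. T (word_map w z) = word_map (map \<sigma> w) (T z))"
proof -
  obtain \<sigma> where \<sigma>: "bij_betw \<sigma> {1..8} {1..8}" "\<And>i. i \<in> {1..8} \<Longrightarrow> T (carpet_pt i) = carpet_pt (\<sigma> i)"
    using symmetry_permutes_points[OF T] by blast
  have "T (word_map w z) = word_map (map \<sigma> w) (T z)" if "w \<in> words n" for n w z
    using that
  proof (induction w arbitrary: n)
    case (Cons i w)
    then have w: "w \<in> words (n - 1)" and i: "i \<in> {1..8}" by (auto simp: words_def)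
    show ?case using symmetry_carpet_map[OF T \<sigma>(2)[OF i]] Cons.IH[OF w] by simp
  qed simp
  with \<sigma> show ?thesis by (intro exI[of _ \<sigma>] conjI ballI allI)
qed

text \<open>\<open>T\<close> conjugates the contraction with fixed point \<open>q\<close> into the
  one with fixed point \<open>T q\<close>. The image of \<open>K\<close> therefore solves the same
  fixed point equation with the maps permuted, and uniqueness applies.\<close>

lemma symmetry_image_K:
  assumes T: "T \<in> carpet_symmetries" shows "T ` K = K"
proof (rule carpet_unique)
  obtain \<sigma> where \<sigma>: "bij_betw \<sigma> {1..8} {1..8}" "\<And>i. i \<in> {1..8} \<Longrightarrow> T (carpet_pt i) = carpet_pt (\<sigma> i)"
    using symmetry_permutes_points[OF T] by blast
  have "linear T" using T by (simp add: carpet_symmetries_def)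
  then have "compact (T ` K)"
    by (intro compact_continuous_image linear_continuous_on compact_K) (simp add: linear_conv_bounded_linear)
  moreover have "T ` K = (\<Union>i\<in>{1..8}. carpet_map i ` T ` K)"
  proof -
    have "T ` K = (\<Union>i\<in>{1..8}. T ` carpet_map i ` K)" by (subst K_fixed) (simp add: image_UN)
    also have "\<dots> = (\<Union>i\<in>{1..8}. carpet_map (\<sigma> i) ` T ` K)"
    proof (rule SUP_cong[OF refl])
      fix i assume "i \<in> {1..8::nat}"
      from symmetry_carpet_map[OF T \<sigma>(2)[OF this]]
      show "T ` carpet_map i ` K = carpet_map (\<sigma> i) ` T ` K" by (simp add: image_image)
    qed
    also have "\<dots> = (\<Union>i\<in>\<sigma> ` {1..8}. carpet_map i ` T ` K)" by (simp only: image_image)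
    finally show ?thesis by (simp only: bij_betw_imp_surj_on[OF \<sigma>(1)])
  qed
  ultimately show "is_carpet (T ` K)" using K_nonempty unfolding is_carpet_def by blast
qed

lemma symmetry_in_K: "T \<in> carpet_symmetries \<Longrightarrow> z \<in> K \<Longrightarrow> T z \<in> K"
  using symmetry_image_K by blast

end

definition reflect_y :: "plane \<Rightarrow> plane" where "reflect_y z = (fst z, - snd z)"
definition swap_xy :: "plane \<Rightarrow> plane" where "swap_xy z = (snd z, fst z)"

lemma reflect_symmetry: "reflect_y \<in> carpet_symmetries"
  and swap_symmetry: "swap_xy \<in> carpet_symmetries"
  and reflect_swap_symmetry: "reflect_y \<circ> swap_xy \<in> carpet_symmetries"
proof -
  have mem: "z \<in> cbox (-1, -1) (1, 1) \<longleftrightarrow> -1 \<le> fst z \<and> fst z \<le> 1 \<and> -1 \<le> snd z \<and> snd z \<le> 1"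
    for z :: plane by (cases z) (auto simp: cbox_Pair_eq)
  have *: "T \<in> carpet_symmetries" if "linear T" "\<And>z. T' (T z) = z" "\<And>z. T (T' z) = z"
    "\<And>z. z \<in> cbox (-1, -1) (1, 1) \<Longrightarrow> T z \<in> cbox (-1, -1) (1, 1)"
    "\<And>z. z \<in> cbox (-1, -1) (1, 1) \<Longrightarrow> T' z \<in> cbox (-1, -1) (1, 1)" for T T'
  proof -
    have "T ` cbox (-1, -1) (1, 1) = cbox (-1, -1) (1, 1)"
      using that(3-5) by (metis (no_types, lifting) image_subsetI subsetI imageI subset_antisym)
    then show ?thesis using that(1) by (simp add: carpet_symmetries_def)
  qed
  have lr: "linear reflect_y" and ls: "linear swap_xy"
    by (rule linearI; simp add: reflect_y_def swap_xy_def)+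
  show "reflect_y \<in> carpet_symmetries"
    by (rule *[OF lr, of reflect_y]) (auto simp: reflect_y_def mem)
  show "swap_xy \<in> carpet_symmetries"
    by (rule *[OF ls, of swap_xy]) (auto simp: swap_xy_def mem)
  show "reflect_y \<circ> swap_xy \<in> carpet_symmetries"
    by (rule *[OF linear_compose[OF ls lr], of "swap_xy \<circ> reflect_y"]) (auto simp: swap_xy_def reflect_y_def mem)
qed

lemma id_symmetry: "id \<in> carpet_symmetries"
  by (simp add: carpet_symmetries_def linear_id[unfolded id_def] id_def)

context carpet_energy
begin

subsection \<open>Lower semicontinuity of the energy\<close>

lemma N_combine: "f \<in> \<F> \<Longrightarrow> g \<in> \<F> \<Longrightarrow> N (\<lambda>x. c * f x + d * g x) \<le> \<bar>c\<bar> * N f + \<bar>d\<bar> * N g"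
  using N_add[OF F_mult[of f c] F_mult[of g d]] by (simp add: N_mult)

text \<open>Uniform convexity speaks about the unit sphere. Functions with \<open>N\<close> close to
  \<open>L\<close> are normalized to \<open>u\<close> and \<open>v\<close>, and replacing the
  factors \<open>N h\<close> and \<open>N g\<close> by \<open>L\<close> costs at most
  \<open>\<eta>\<close> each.\<close>

lemma N_near_extremal:
  assumes L: "0 < L" and e: "0 < e"
  obtains \<eta> where "0 < \<eta>" "\<And>h g. h \<in> \<F> \<Longrightarrow> g \<in> \<F> \<Longrightarrow> \<bar>N h - L\<bar> \<le> \<eta> \<Longrightarrow> \<bar>N g - L\<bar> \<le> \<eta> \<Longrightarrow>
    2 * L - 2 * \<eta> \<le> N (\<lambda>x. h x + g x) \<Longrightarrow> N (\<lambda>x. h x - g x) \<le> e"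
proof -
  define e' where "e' = e / (2 * L)"
  have "0 < e'" using L e by (simp add: e'_def)
  then obtain \<delta> where \<delta>: "0 < \<delta>" "\<And>f g. f \<in> \<F> \<Longrightarrow> g \<in> \<F> \<Longrightarrow> N f = 1 \<Longrightarrow> N g = 1 \<Longrightarrow>
      e' < N (\<lambda>x. f x - g x) \<Longrightarrow> N (\<lambda>x. f x + g x) \<le> 2 * (1 - \<delta>)"
    using N_uniformly_convex unfolding uniformly_convex_on_def by meson
  \<comment> \<open>The bound \<open>L / 2\<close> keeps \<open>N h\<close> and \<open>N g\<close>
    positive, \<open>L * \<delta> / 4\<close> gives the contradiction with uniform convexity, and
    \<open>e / 4\<close> absorbs the two normalization errors next to
    \<open>L * e' = e / 2\<close>.\<close>
  define \<eta> where "\<eta> = min (L / 2) (min (L * \<delta> / 4) (e / 4))"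
  have \<eta>: "0 < \<eta>" "\<eta> \<le> L / 2" "\<eta> \<le> L * \<delta> / 4" "\<eta> \<le> e / 4"
    using L e \<delta>(1) by (auto simp: \<eta>_def)
  show ?thesis
  proof (rule that[OF \<eta>(1)])
    fix h g assume h: "h \<in> \<F>" "\<bar>N h - L\<bar> \<le> \<eta>" and g: "g \<in> \<F>" "\<bar>N g - L\<bar> \<le> \<eta>"
      and sum: "2 * L - 2 * \<eta> \<le> N (\<lambda>x. h x + g x)"
    have pos: "0 < N h" "0 < N g" using h g \<eta>(2) L by linarith+
    define u where "u x = inverse (N h) * h x" for x
    define v where "v x = inverse (N g) * g x" for x
    have uv: "u \<in> \<F>" "v \<in> \<F>" "N u = 1" "N v = 1"
      unfolding u_def v_def using pos h g by (simp_all add: F_mult N_mult)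
    have hg: "h = (\<lambda>x. N h * u x)" "g = (\<lambda>x. N g * v x)" using pos by (auto simp: u_def v_def fun_eq_iff)
    have c: "N (\<lambda>x. L * k x + ((N h - L) * u x + d * v x)) \<le> L * N k + (\<bar>N h - L\<bar> + \<bar>d\<bar>)"
      if "k \<in> \<F>" for k d
    proof -
      have "N (\<lambda>x. (N h - L) * u x + d * v x) \<le> \<bar>N h - L\<bar> + \<bar>d\<bar>"
        using N_combine[OF uv(1,2), of "N h - L" d] uv by simp
      then show ?thesis
        using N_add[OF F_mult[OF that, of L] F_add[OF F_mult[OF uv(1)] F_mult[OF uv(2)]], of "N h - L" d]
          N_mult[OF that, of L] L by simp
    qed
    have "N (\<lambda>x. u x - v x) \<le> e'"
    proof (rule ccontr)
      assume "\<not> ?thesis"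
      then have "N (\<lambda>x. u x + v x) \<le> 2 * (1 - \<delta>)" using \<delta>(2)[OF uv] by simp
      then have "L * N (\<lambda>x. u x + v x) \<le> L * (2 * (1 - \<delta>))" using L by simp
      moreover have "(\<lambda>x. h x + g x) = (\<lambda>x. L * (u x + v x) + ((N h - L) * u x + (N g - L) * v x))"
        by (subst hg(1), subst hg(2)) (simp add: algebra_simps)
      ultimately have "N (\<lambda>x. h x + g x) \<le> L * (2 * (1 - \<delta>)) + (\<eta> + \<eta>)"
        using c[OF F_add[OF uv(1,2)], of "N g - L"] h(2) g(2) by simp
      moreover have "0 < L * \<delta>" using L \<delta>(1) by simp
      ultimately show False using sum \<eta>(3) by (simp add: algebra_simps)
    qed
    then have "L * N (\<lambda>x. u x - v x) \<le> L * e'" using L by simp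
    moreover have "L * e' = e / 2" using L by (simp add: e'_def)
    moreover have "(\<lambda>x. h x - g x) = (\<lambda>x. L * (u x - v x) + ((N h - L) * u x + (L - N g) * v x))"
      by (subst hg(1), subst hg(2)) (simp add: algebra_simps)
    ultimately show "N (\<lambda>x. h x - g x) \<le> e"
      using c[OF F_diff[OF uv(1,2)], of "L - N g"] h(2) g(2) \<eta>(4) by simp
  qed
qed

text \<open>For fixed large \<open>k\<close> the difference \<open>f - h k\<close> is the uniform
  limit of \<open>h l - h k\<close>, whose Sobolev seminorms are small, so
  \<open>seminorm_lsc\<close> bounds it. Applied to a small difference, the comparison constant
  \<open>C\<close> does no harm; it enters twice, whence \<open>e / (2 * C * C)\<close>.\<close>

lemma energy_cauchy_limit:
  assumes h: "\<And>k. h k \<in> \<F>" and f: "f \<in> \<F>" and lim: "uniformly_to h f"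
    and cauchy: "\<And>e. 0 < e \<Longrightarrow> \<exists>k0. \<forall>k\<ge>k0. \<forall>l\<ge>k0. N (\<lambda>x. h k x - h l x) \<le> e"
    and NL: "(\<lambda>k. N (h k)) \<longlonglongrightarrow> L"
  shows "N f \<le> L"
proof (rule field_le_epsilon)
  fix e :: real assume e: "0 < e"
  obtain C where C: "1 \<le> C" "\<And>f. f \<in> \<F> \<Longrightarrow> sobolev_seminorm K m p \<rho> f \<le> C * N f"
    "\<And>f. f \<in> \<F> \<Longrightarrow> N f \<le> C * sobolev_seminorm K m p \<rho> f"
    using N_comparable by blast
  have "0 < e / (2 * C * C)" using e C(1) by simp
  then obtain k0 where k0: "\<And>k l. k \<ge> k0 \<Longrightarrow> l \<ge> k0 \<Longrightarrow> N (\<lambda>x. h k x - h l x) \<le> e / (2 * C * C)"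
    using cauchy by meson
  have "\<forall>\<^sub>F k in sequentially. N (h k) < L + e / 2" using order_tendstoD(2)[OF NL, of "L + e / 2"] e by simp
  then obtain k where k: "k \<ge> k0" "N (h k) < L + e / 2"
    by (auto simp: eventually_sequentially) (metis le_cases)
  have "sobolev_seminorm K m p \<rho> (\<lambda>x. f x - h k x) \<le> C * (e / (2 * C * C))"
  proof (rule seminorm_lsc[OF F_diff[OF h h] F_diff[OF f h]])
    show "uniformly_to (\<lambda>l x. h l x - h k x) (\<lambda>x. f x - h k x)"
      using lim by (simp add: uniformly_to_def)
    show "\<forall>\<^sub>F l in sequentially. sobolev_seminorm K m p \<rho> (\<lambda>x. h l x - h k x) \<le> C * (e / (2 * C * C))"
      using eventually_ge_at_top[of k0]
    proof eventually_elim
      case (elim l)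
      have "C * N (\<lambda>x. h l x - h k x) \<le> C * (e / (2 * C * C))"
        using k0[OF elim k(1)] C(1) by (intro mult_left_mono) auto
      with C(2)[OF F_diff[OF h h], of l k] show ?case by linarith
    qed
  qed
  then have "C * sobolev_seminorm K m p \<rho> (\<lambda>x. f x - h k x) \<le> C * (C * (e / (2 * C * C)))"
    using C(1) by (intro mult_left_mono) auto
  moreover have "C * (C * (e / (2 * C * C))) = e / 2" using C(1) by simp
  ultimately have "N (\<lambda>x. f x - h k x) \<le> e / 2" using C(3)[OF F_diff[OF f h], of k] by linarith
  then show "N f \<le> L + e" using N_le_add_diff[OF f h, of k] k(2) by linarith
qed

text \<open>Almost minimizers of \<^term>\<open>N\<close> in shrinking uniform neighbourhoods of \<open>f\<close> form a Cauchy sequence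
  by uniform convexity, as these neighbourhoods are convex and decreasing.\<close>

theorem energy_lsc:
  assumes s: "\<And>k. s k \<in> \<F>" and f: "f \<in> \<F>" and lim: "uniformly_to s f"
    and le: "\<forall>\<^sub>F k in sequentially. E (s k) \<le> a"
  shows "E f \<le> a"
proof -
  define b where "b = a powr (1/p)"
  define H where "H n = {h\<in>\<F>. \<forall>x\<in>K. \<bar>h x - f x\<bar> \<le> 1 / real (Suc n)}" for n
  define d where "d n = Inf (N ` H n)" for n
  have a0: "0 \<le> a" using eventually_happens'[OF sequentially_bot le] E_nonneg[OF s] order_trans by blast
  have fH: "f \<in> H n" for n using f by (simp add: H_def)
  have bdd: "bdd_below (N ` H n)" for n by (rule bdd_belowI[of _ 0]) (auto simp: N_nonneg)
  have d_le: "d n \<le> N h" if "h \<in> H n" for n h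
    unfolding d_def using that bdd by (intro cInf_lower) auto
  have Hmono: "H l \<subseteq> H k" if "k \<le> l" for k l
  proof -
    have "1 / real (Suc l) \<le> 1 / real (Suc k)" using that by (simp add: frac_le)
    then show ?thesis unfolding H_def by (auto intro: order_trans)
  qed
  have mono: "incseq d"
  proof (rule incseq_SucI)
    fix n
    have "N ` H (Suc n) \<noteq> {}" using fH[of "Suc n"] by blast
    moreover have "N ` H (Suc n) \<subseteq> N ` H n" by (rule image_mono[OF Hmono]) simp
    ultimately show "d n \<le> d (Suc n)" unfolding d_def by (intro cInf_superset_mono bdd)
  qed
  \<comment> \<open>The given sequence enters every neighbourhood \<open>H n\<close>, so the infima
    stay below \<open>b\<close>; the almost minimizers \<open>h n\<close> now take its
    place.\<close>
  have db: "d n \<le> b" for n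
  proof -
    have "\<forall>\<^sub>F k in sequentially. \<forall>x\<in>K. \<bar>s k x - f x\<bar> \<le> 1 / real (Suc n)"
      using lim by (simp add: uniformly_to_def del: of_nat_Suc)
    then have "\<forall>\<^sub>F k in sequentially. d n \<le> b" using le
    proof eventually_elim
      case (elim k)
      then have "d n \<le> N (s k)" using s by (intro d_le) (simp add: H_def)
      also have "\<dots> \<le> b" unfolding N_def b_def using elim E_nonneg[OF s] p by (intro powr_mono2) auto
      finally show ?case .
    qed
    then show ?thesis by simp
  qed
  obtain L where L: "d \<longlonglongrightarrow> L" "\<And>n. d n \<le> L"
    using incseq_convergent[OF mono] db by metis
  have "\<exists>h\<in>H n. N h < d n + 1 / real (Suc n)" for n
    using cInf_lessD[of "N ` H n" "d n + 1 / real (Suc n)"] fH unfolding d_def by auto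
  then obtain h where h: "\<And>n. h n \<in> H n" "\<And>n. N (h n) < d n + 1 / real (Suc n)" by metis
  have hF: "h n \<in> \<F>" for n using h(1) by (simp add: H_def)
  have z: "(\<lambda>n. 1 / real (Suc n)) \<longlonglongrightarrow> 0" by (rule LIMSEQ_Suc[OF lim_1_over_n])
  have NL: "(\<lambda>n. N (h n)) \<longlonglongrightarrow> L"
  proof (rule tendsto_sandwich[OF _ _ L(1)])
    show "(\<lambda>n. d n + 1 / real (Suc n)) \<longlonglongrightarrow> L" using tendsto_add[OF L(1) z] by simp
  qed (use d_le[OF h(1)] h(2) in \<open>auto intro!: always_eventually less_imp_le\<close>)
  have mid: "2 * d k \<le> N (\<lambda>x. h k x + h l x)" if "k \<le> l" for k l
  proof -
    have half: "\<bar>1/2 * (u + v) - y\<bar> \<le> c" if "\<bar>u - y\<bar> \<le> c" "\<bar>v - y\<bar> \<le> c" for u v y c :: real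
      unfolding distrib_left using that by linarith
    have hH: "h k \<in> H k" "h l \<in> H k" using h(1)[of k] h(1)[of l] Hmono[OF that] by blast+
    have "\<bar>1/2 * (h k x + h l x) - f x\<bar> \<le> 1 / real (Suc k)" if "x \<in> K" for x
    proof -
      have "\<bar>h k x - f x\<bar> \<le> 1 / real (Suc k)" "\<bar>h l x - f x\<bar> \<le> 1 / real (Suc k)"
        using hH that unfolding H_def by blast+
      then show ?thesis by (rule half)
    qed
    then have "(\<lambda>x. 1/2 * (h k x + h l x)) \<in> H k"
      unfolding H_def mem_Collect_eq using F_mult[OF F_add[OF hF hF], of "1/2" k l] by (intro conjI ballI)
    from d_le[OF this] show ?thesis using N_mult[OF F_add[OF hF hF], of "1/2" k l] by simp
  qed
  have cauchy: "\<exists>k0. \<forall>k\<ge>k0. \<forall>l\<ge>k0. N (\<lambda>x. h k x - h l x) \<le> e" if e: "0 < e" for e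
  \<comment> \<open>\<open>N_near_extremal\<close> needs a positive level. Otherwise the seminorms
    themselves become arbitrarily small and the triangle inequality suffices.\<close>
  proof (cases "L \<le> 0")
    case True
    then have "\<forall>\<^sub>F k in sequentially. N (h k) < e / 2" using order_tendstoD(2)[OF NL, of "e / 2"] e by simp
    then obtain k0 where k0: "\<And>k. k \<ge> k0 \<Longrightarrow> N (h k) < e / 2" by (auto simp: eventually_sequentially)
    have "N (\<lambda>x. h k x - h l x) \<le> e" if "k \<ge> k0" "l \<ge> k0" for k l
      using N_diff[OF hF hF, of k l] k0[OF that(1)] k0[OF that(2)] by linarith
    then show ?thesis by blast
  next
    case False
    then have "0 < L" by simp
    then obtain \<eta> where \<eta>: "0 < \<eta>" "\<And>h g. h \<in> \<F> \<Longrightarrow> g \<in> \<F> \<Longrightarrow> \<bar>N h - L\<bar> \<le> \<eta> \<Longrightarrow> \<bar>N g - L\<bar> \<le> \<eta> \<Longrightarrow>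
      2 * L - 2 * \<eta> \<le> N (\<lambda>x. h x + g x) \<Longrightarrow> N (\<lambda>x. h x - g x) \<le> e"
      using N_near_extremal[OF \<open>0 < L\<close> e] by blast
    have "\<forall>\<^sub>F k in sequentially. L - \<eta> < d k \<and> N (h k) < L + \<eta>"
      using order_tendstoD(1)[OF L(1), of "L - \<eta>"] order_tendstoD(2)[OF NL, of "L + \<eta>"] \<eta>(1)
      by (intro eventually_conj) auto
    then obtain k0 where k0: "\<And>k. k \<ge> k0 \<Longrightarrow> L - \<eta> < d k \<and> N (h k) < L + \<eta>"
      by (auto simp: eventually_sequentially)
    have near: "\<bar>N (h k) - L\<bar> \<le> \<eta>" if "k \<ge> k0" for k
      using k0[OF that] d_le[OF h(1), of k] by linarith
    have "N (\<lambda>x. h k x - h l x) \<le> e" if kl: "k \<ge> k0" "l \<ge> k0" for k l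
    proof (rule \<eta>(2)[OF hF hF near near])
      show "2 * L - 2 * \<eta> \<le> N (\<lambda>x. h k x + h l x)"
      proof (cases "k \<le> l")
        case True
        then show ?thesis using mid[OF True] k0[OF kl(1)] by linarith
      next
        case False
        then have "2 * d l \<le> N (\<lambda>x. h k x + h l x)" using mid[of l k] by (simp add: add.commute)
        then show ?thesis using k0[OF kl(2)] by linarith
      qed
    qed (use kl in auto)
    then show ?thesis by blast
  qed
  have "uniformly_to h f"
    unfolding uniformly_to_def
  proof (intro allI impI)
    fix e :: real assume "0 < e"
    from order_tendstoD(2)[OF z this]
    show "\<forall>\<^sub>F k in sequentially. \<forall>x\<in>K. \<bar>h k x - f x\<bar> \<le> e"
    proof eventually_elim
      case (elim k)
      then show ?case using h(1)[of k] unfolding H_def by fastforce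
    qed
  qed
  from energy_cauchy_limit[OF hF f this cauchy NL] have "N f \<le> L" .
  also have "L \<le> b" using LIMSEQ_le_const2[OF L(1)] db by blast
  finally have "N f powr p \<le> b powr p" using p by (intro powr_mono2) (auto simp: N_nonneg)
  then show ?thesis using a0 p by (simp add: E_eq_N[OF f] b_def powr_powr)
qed

end

lemma bij_betw_map_words_over:
  assumes "bij_betw \<sigma> A B" shows "bij_betw (map \<sigma>) (words_over A n) (words_over B n)"
proof (rule bij_betwI)
  let ?\<tau> = "inv_into A \<sigma>"
  show "map \<sigma> \<in> words_over A n \<rightarrow> words_over B n" "map ?\<tau> \<in> words_over B n \<rightarrow> words_over A n"
    using bij_betwE[OF assms] bij_betwE[OF bij_betw_inv_into[OF assms]]
    by (auto simp: words_over_def subset_iff)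
  show "map ?\<tau> (map \<sigma> w) = w" if "w \<in> words_over A n" for w
    using that bij_betw_inv_into_left[OF assms] by (auto simp: words_over_def intro!: map_idI)
  show "map \<sigma> (map ?\<tau> w) = w" if "w \<in> words_over B n" for w
    using that bij_betw_inv_into_right[OF assms] by (auto simp: words_over_def intro!: map_idI)
qed

text \<open>Convexity of the power function at \<open>a / l\<close> and \<open>b / (1 - l)\<close>
  with weights \<open>l\<close> and \<open>1 - l\<close>. The bound is linear in the
  \<open>p\<close>-th powers, that is, in energies, and can be summed over cells.\<close>

lemma powr_add_le:
  fixes a b :: real
  assumes p: "1 < p" and l: "0 < l" "l < 1" and ab: "0 \<le> a" "0 \<le> b"
  shows "(a + b) powr p \<le> l powr (1 - p) * a powr p + (1 - l) powr (1 - p) * b powr p"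
proof -
  have ge1: "1 \<le> x powr (1 - p)" if "0 < x" "x < 1" for x :: real
    using powr_mono'[of "1 - p" 0 x] that p by simp
  have sc: "x * (y / x) powr p = x powr (1 - p) * y powr p" if "0 < x" "0 \<le> y" for x y :: real
    using that by (simp add: powr_divide powr_diff)
  consider "a = 0" | "b = 0" | "0 < a" "0 < b" using ab by linarith
  then show ?thesis
  proof cases
    case 1
    then show ?thesis using mult_right_mono[OF ge1[of "1 - l"], of "b powr p"] l p by simp
  next
    case 2
    then show ?thesis using mult_right_mono[OF ge1[of l], of "a powr p"] l p by simp
  next
    case 3
    have "((1 - (1 - l)) *\<^sub>R (a / l) + (1 - l) *\<^sub>R (b / (1 - l))) powr p
        \<le> (1 - (1 - l)) * (a / l) powr p + (1 - l) * (b / (1 - l)) powr p"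
      using 3 l p by (intro convex_onD[OF powr_convex]) auto
    then show ?thesis using l 3 sc[of l a] sc[of "1 - l" b] by simp
  qed
qed

subsection \<open>Absence of energy on the sides of the square\<close>

text \<open>\<open>fold_y\<close> maps the upper two thirds of \<open>[-1, 1]\<close> to the lowest third by two reflections,
  and \<open>fold_top n\<close> does the same in the highest row of cells of level \<open>n\<close>. In every such cell the
  lowest row of subcells is complete, hence the carpet is mapped to itself.\<close>

definition fold_y :: "real \<Rightarrow> real" where
  "fold_y y = min y (max (- 2/3 - y) (y - 4/3))"

definition fold_top :: "nat \<Rightarrow> plane \<Rightarrow> plane" where
  "fold_top n z = (fst z, 1 + (1/3) ^ n * (fold_y (3 ^ n * (snd z - 1) + 1) - 1))"

text \<open>In the cells of the highest row the distance to the upper side is divided by 3, so the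
  rescaled ordinate inside \<open>fold_y\<close> is unchanged. This recursion drives the inductions
  on the level.\<close>

lemma fold_top_top:
  assumes "snd (carpet_pt i) = 1"
  shows "fold_top (Suc n) (carpet_map i z) = carpet_map i (fold_top n z)"
proof -
  have "3 ^ Suc n * (snd (carpet_map i z) - 1) + 1 = 3 ^ n * (snd z - 1) + 1"
    by (simp add: snd_carpet_map assms algebra_simps add_divide_distrib)
  then have "fold_top (Suc n) (carpet_map i z)
      = (fst (carpet_map i z), 1 + (1/3) ^ Suc n * (fold_y (3 ^ n * (snd z - 1) + 1) - 1))"
    unfolding fold_top_def by (simp only:)
  then show ?thesis
    by (simp add: prod_eq_iff fst_carpet_map snd_carpet_map assms) (simp add: fold_top_def fst_carpet_map)
qed

text \<open>These cells lie below ordinate \<open>1/3\<close>, so the rescaled ordinate is at most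
  \<open>-1\<close>, where \<open>fold_y\<close> is the identity.\<close>

lemma fold_top_other:
  assumes "snd (carpet_pt i) \<le> 0" "\<bar>snd z\<bar> \<le> 1"
  shows "fold_top (Suc n) (carpet_map i z) = carpet_map i z"
proof -
  define y where "y = snd (carpet_map i z)"
  have y: "2/3 \<le> 1 - y" using assms by (auto simp: y_def snd_carpet_map abs_le_iff divide_simps)
  have "(3::real) \<le> 3 ^ Suc n" by simp
  from mult_mono[OF this y] have "3 ^ Suc n * (y - 1) \<le> - 2" by (simp add: algebra_simps)
  then have "fold_y (3 ^ Suc n * (y - 1) + 1) = 3 ^ Suc n * (y - 1) + 1"
    unfolding fold_y_def by linarith
  then show ?thesis by (simp add: fold_top_def prod_eq_iff flip: y_def) (simp add: field_simps)
qed

text \<open>Each cell moves down its own column: the middle cells 4 and 8 are reflected once and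
  land upside down, the upper cells 5, 6 and 7 are reflected twice and are thus translated.\<close>

lemma fold_top_0:
  assumes "\<bar>snd z\<bar> \<le> 1"
  shows "snd (carpet_pt i) = -1 \<Longrightarrow> fold_top 0 (carpet_map i z) = carpet_map i z"
    "fold_top 0 (carpet_map 4 z) = carpet_map 3 (reflect_y z)"
    "fold_top 0 (carpet_map 5 z) = carpet_map 3 z"
    "fold_top 0 (carpet_map 6 z) = carpet_map 2 z"
    "fold_top 0 (carpet_map 7 z) = carpet_map 1 z"
    "fold_top 0 (carpet_map 8 z) = carpet_map 1 (reflect_y z)"
  using assms
  by (auto simp: prod_eq_iff fold_top_def fst_carpet_map snd_carpet_map reflect_y_def fold_y_def
      min_def max_def field_simps)

lemma dist_fold_top:
  assumes "\<bar>snd z\<bar> \<le> 1"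
  shows "dist (fold_top n z) z \<le> 2 * (1/3) ^ n"
proof -
  define t where "t = 3 ^ n * (snd z - 1) + 1"
  have t: "t \<le> 1" using assms by (simp add: t_def mult_nonneg_nonpos)
  have z: "snd z = 1 + (1/3) ^ n * (t - 1)" by (simp add: t_def power_divide)
  have "fold_top n z - z = (0, (1/3) ^ n * (fold_y t - t))"
    by (simp add: fold_top_def prod_eq_iff flip: t_def) (simp add: z algebra_simps)
  then have "dist (fold_top n z) z = (1/3) ^ n * \<bar>fold_y t - t\<bar>"
    by (simp add: dist_norm norm_Pair abs_mult)
  also have "\<bar>fold_y t - t\<bar> \<le> 2" using t by (auto simp: fold_y_def min_def max_def)
  finally show ?thesis by (simp add: mult.commute)
qed

lemma continuous_on_fold_top: "continuous_on A (fold_top n)"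
  unfolding fold_top_def fold_y_def by (intro continuous_intros)

context carpet
begin

lemma fold_top_in_K: "z \<in> K \<Longrightarrow> fold_top n z \<in> K"
proof (induction n arbitrary: z)
  case 0
  then obtain i z' where i: "i \<in> {1..8}" "z' \<in> K" "z = carpet_map i z'" using K_fixed by blast
  have y: "\<bar>snd z'\<bar> \<le> 1" using K_in_square i by blast
  have "reflect_y z' \<in> K" using symmetry_in_K[OF reflect_symmetry] i by blast
  then show ?case
    using i fold_top_0[OF y] carpet_map_in_K[OF _ i(2)] carpet_map_in_K[of _ "reflect_y z'"]
    unfolding letters_eq by (elim insertE emptyE) simp_all
next
  case (Suc n)
  then obtain i z' where i: "i \<in> {1..8}" "z' \<in> K" "z = carpet_map i z'" using K_fixed by blast
  have y: "\<bar>snd z'\<bar> \<le> 1" using K_in_square i by blast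
  have "snd (carpet_pt i) = 1 \<or> snd (carpet_pt i) \<le> 0" using carpet_pt_cases(2)[OF i(1)] by auto
  then show ?case
  proof
    assume "snd (carpet_pt i) = 1"
    then show ?thesis using fold_top_top carpet_map_in_K[OF i(1) Suc.IH[OF i(2)]] i(3) by simp
  next
    assume "snd (carpet_pt i) \<le> 0"
    then show ?thesis using fold_top_other[OF _ y] carpet_map_in_K[OF i(1,2)] i(3) by simp
  qed
qed

end

context carpet_energy
begin

lemma E_add_le:
  assumes "f \<in> \<F>" "g \<in> \<F>" "0 < l" "l < 1"
  shows "E (\<lambda>x. f x + g x) \<le> l powr (1 - p) * E f + (1 - l) powr (1 - p) * E g"
proof -
  have "N (\<lambda>x. f x + g x) powr p \<le> (N f + N g) powr p"
    using p assms by (intro powr_mono2 N_add) (auto simp: N_nonneg)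
  also have "\<dots> \<le> l powr (1 - p) * N f powr p + (1 - l) powr (1 - p) * N g powr p"
    using p assms by (intro powr_add_le N_nonneg)
  finally show ?thesis using assms by (simp add: E_eq_N F_add)
qed

text \<open>For \<open>T = {5,6,7}\<close> this is the energy in the highest row of cells of level
  \<open>n\<close>; the letter sets of the other sides arise by symmetry.\<close>

definition edge_energy :: "nat set \<Rightarrow> (plane \<Rightarrow> real) \<Rightarrow> nat \<Rightarrow> real" where
  "edge_energy T f n = \<rho> ^ n * (\<Sum>w\<in>words_over T n. E (f \<circ> word_map w))"

lemma edge_energy_0 [simp]: "edge_energy T f 0 = E f"
  by (simp add: edge_energy_def)

lemma edge_energy_Suc:
  "edge_energy T f (Suc n) = \<rho> * (\<Sum>i\<in>T. edge_energy T (f \<circ> carpet_map i) n)"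
  unfolding edge_energy_def sum_words_over_Suc comp_word_map_Cons
  by (simp only: sum_distrib_left power_Suc mult_ac)

lemma words_over_letters: "T \<subseteq> {1..8} \<Longrightarrow> w \<in> words_over T n \<Longrightarrow> w \<in> words n"
  by (auto simp: words_over_def words_def)

lemma edge_energy_nonneg: "f \<in> \<F> \<Longrightarrow> T \<subseteq> {1..8} \<Longrightarrow> 0 \<le> edge_energy T f n"
  unfolding edge_energy_def using rho
  by (intro mult_nonneg_nonneg sum_nonneg E_nonneg F_word_map words_over_letters) auto

lemma edge_energy_decreasing:
  assumes "f \<in> \<F>" "T \<subseteq> {1..8}" shows "edge_energy T f (Suc n) \<le> edge_energy T f n"
  using assms(1)
proof (induction n arbitrary: f)
  case 0
  have "(\<Sum>i\<in>T. E (f \<circ> carpet_map i)) \<le> (\<Sum>i\<in>{1..8}. E (f \<circ> carpet_map i))"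
    using assms(2) by (intro sum_mono2 E_nonneg F_carpet_map[OF 0]) auto
  then show ?case using rho by (simp only: edge_energy_Suc edge_energy_0 E_carpet_map[OF 0]) simp
next
  case (Suc n)
  show ?case
    unfolding edge_energy_Suc[of _ _ "Suc n"] edge_energy_Suc[of _ f n]
    using rho assms(2) by (intro mult_left_mono sum_mono Suc.IH F_carpet_map[OF Suc.prems]) auto
qed

lemma edge_energy_le: "f \<in> \<F> \<Longrightarrow> T \<subseteq> {1..8} \<Longrightarrow> edge_energy T f n \<le> E f"
proof (induction n)
  case (Suc n)
  then show ?case using edge_energy_decreasing[of f T n] by simp
qed simp

text \<open>For \<open>n = 0\<close> the folded function repeats the three lowest cells, which gives
  three times the energy outside the upper row; the remaining term
  \<open>E f - edge_energy {5,6,7} f 0\<close> vanishes. In the induction step the letters 5, 6, 7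
  inherit the bound and the other cells are untouched. That the folded function lies in
  \<open>\<F>C\<close> rests on its continuity together with membership on each cell.\<close>

lemma fold_top_energy:
  assumes "f \<in> \<F>C"
  shows "f \<circ> fold_top n \<in> \<F>C \<and> E (f \<circ> fold_top n)
    \<le> E f - edge_energy {5,6,7} f n + 3 * (edge_energy {5,6,7} f n - edge_energy {5,6,7} f (Suc n))"
  using assms
proof (induction n arbitrary: f)
  case 0
  note fF = FC_F[OF 0]
  have cont: "continuous_on K (f \<circ> fold_top 0)"
    unfolding comp_def using fold_top_in_K
    by (intro continuous_on_compose2[OF FC_cont[OF 0] continuous_on_fold_top] image_subsetI)
  define e where "e i = E (f \<circ> carpet_map i)" for i
  have e0: "0 \<le> e i" if "i \<in> {1..8}" for i unfolding e_def by (rule E_nonneg[OF F_carpet_map[OF fF that]])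
  have same: "f \<circ> fold_top 0 \<circ> carpet_map i \<in> \<F> \<and> E (f \<circ> fold_top 0 \<circ> carpet_map i) = e j"
    if "j \<in> {1..8}" "T \<in> {id, reflect_y}"
      "\<And>z. \<bar>snd z\<bar> \<le> 1 \<Longrightarrow> fold_top 0 (carpet_map i z) = carpet_map j (T z)" for i j T
  proof -
    have T: "T \<in> carpet_symmetries" using that(2) id_symmetry reflect_symmetry by auto
    note g = F_carpet_map[OF fF that(1)]
    have eq: "(f \<circ> carpet_map j \<circ> T) z = (f \<circ> fold_top 0 \<circ> carpet_map i) z" if "z \<in> K" for z
      using that(1) K_in_square(2)[OF that] \<open>\<And>z. \<bar>snd z\<bar> \<le> 1 \<Longrightarrow> _\<close> by simp
    have "f \<circ> fold_top 0 \<circ> carpet_map i \<in> \<F>" by (rule F_cong[OF F_symmetry[OF g T] eq])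
    moreover have "E (f \<circ> carpet_map j \<circ> T) = E (f \<circ> fold_top 0 \<circ> carpet_map i)"
      by (rule E_cong[OF F_symmetry[OF g T] eq])
    ultimately show ?thesis unfolding E_symmetry[OF g T] e_def by simp
  qed
  \<comment> \<open>Here \<open>\<tau>\<close> sends a letter to the one in the lowest row of the
    same column.\<close>
  have cells: "f \<circ> fold_top 0 \<circ> carpet_map i \<in> \<F> \<and> E (f \<circ> fold_top 0 \<circ> carpet_map i) = e (\<tau> i)"
    if "i \<in> {1..8}" "\<tau> = (\<lambda>i. if i \<in> {4,5} then 3 else if i = 6 then 2 else if i \<in> {7,8} then 1 else i)"
    for i \<tau>
    using that(1) unfolding letters_eq
    by (elim insertE emptyE; simp add: that(2))
      (rule same[of _ id] same[of _ reflect_y]; simp add: fold_top_0)+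
  have FC: "f \<circ> fold_top 0 \<in> \<F>C" by (rule FC_carpetI[OF cont]) (use cells in blast)
  have "E (f \<circ> fold_top 0) = \<rho> * (\<Sum>i\<in>{1..8}. E (f \<circ> fold_top 0 \<circ> carpet_map i))"
    by (rule E_carpet_map[OF FC_F[OF FC]])
  also have "\<dots> = \<rho> * (\<Sum>i\<in>{1..8}. e (if i \<in> {4,5} then 3 else if i = 6 then 2 else if i \<in> {7,8} then 1 else i))"
    using cells by simp
  \<comment> \<open>The columns contain 3, 2 and 3 cells, the centre being absent; the
    multiplicities are rounded up to 3, and cells 4 and 8 are added on the right.\<close>
  also have "\<dots> \<le> \<rho> * (3 * ((\<Sum>i\<in>{1..8}. e i) - (\<Sum>i\<in>{5,6,7}. e i)))"
    using rho e0[of 1] e0[of 2] e0[of 3] e0[of 4] e0[of 8] unfolding letters_eq by simp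
  also have "\<dots> = 3 * (E f - edge_energy {5,6,7} f (Suc 0))"
    by (simp only: edge_energy_Suc edge_energy_0 E_carpet_map[OF fF] e_def) (simp add: algebra_simps)
  finally have "E (f \<circ> fold_top 0) \<le> 3 * (E f - edge_energy {5,6,7} f (Suc 0))" .
  with FC show ?case unfolding edge_energy_0 by linarith
next
  case (Suc n)
  note fF = FC_F[OF Suc.prems]
  let ?T = "{5,6,7::nat}"
  have cont: "continuous_on K (f \<circ> fold_top (Suc n))"
    unfolding comp_def using fold_top_in_K
    by (intro continuous_on_compose2[OF FC_cont[OF Suc.prems] continuous_on_fold_top] image_subsetI)
  have top: "f \<circ> fold_top (Suc n) \<circ> carpet_map i = f \<circ> carpet_map i \<circ> fold_top n" if "i \<in> ?T" for i
    using that by (auto simp: fun_eq_iff fold_top_top)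
  have other: "(f \<circ> carpet_map i) z = (f \<circ> fold_top (Suc n) \<circ> carpet_map i) z"
    if "i \<in> {1..8} - ?T" "z \<in> K" for i z
  proof -
    have "snd (carpet_pt i) \<le> 0" using that(1) unfolding letters_eq by auto
    from fold_top_other[OF this K_in_square(2)[OF that(2)]] show ?thesis by simp
  qed
  have IH: "f \<circ> carpet_map i \<circ> fold_top n \<in> \<F>C \<and> E (f \<circ> carpet_map i \<circ> fold_top n)
    \<le> E (f \<circ> carpet_map i) - edge_energy ?T (f \<circ> carpet_map i) n +
      3 * (edge_energy ?T (f \<circ> carpet_map i) n - edge_energy ?T (f \<circ> carpet_map i) (Suc n))"
    if "i \<in> ?T" for i
    by (rule Suc.IH[OF FC_carpet_map[OF Suc.prems]]) (use that in auto)
  have FC: "f \<circ> fold_top (Suc n) \<in> \<F>C"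
  proof (rule FC_carpetI[OF cont])
    fix i assume i: "i \<in> {1..8::nat}"
    show "f \<circ> fold_top (Suc n) \<circ> carpet_map i \<in> \<F>"
    proof (cases "i \<in> ?T")
      case True
      then show ?thesis using IH[OF True] FC_F by (simp add: top)
    next
      case False
      then show ?thesis using i by (intro F_cong[OF F_carpet_map[OF fF i] other]) auto
    qed
  qed
  have split: "(\<Sum>i\<in>{1..8}. g i) = (\<Sum>i\<in>{1..8} - ?T. g i) + (\<Sum>i\<in>?T. g i)" for g :: "nat \<Rightarrow> real"
    by (rule sum.subset_diff) auto
  have E_fold: "E (f \<circ> fold_top (Suc n)) = \<rho> * (\<Sum>i\<in>{1..8}. E (f \<circ> fold_top (Suc n) \<circ> carpet_map i))"
    by (rule E_carpet_map[OF FC_F[OF FC]])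
  have "(\<Sum>i\<in>{1..8}. E (f \<circ> fold_top (Suc n) \<circ> carpet_map i))
      = (\<Sum>i\<in>{1..8} - ?T. E (f \<circ> carpet_map i)) + (\<Sum>i\<in>?T. E (f \<circ> carpet_map i \<circ> fold_top n))"
  proof -
    have "E (f \<circ> fold_top (Suc n) \<circ> carpet_map i) = E (f \<circ> carpet_map i)" if "i \<in> {1..8} - ?T" for i
      by (rule E_cong[OF F_carpet_map[OF fF] other[OF that], symmetric]) (use that in blast)
    moreover have "E (f \<circ> fold_top (Suc n) \<circ> carpet_map i) = E (f \<circ> carpet_map i \<circ> fold_top n)"
      if "i \<in> ?T" for i by (simp only: top[OF that])
    ultimately show ?thesis unfolding split by (intro arg_cong2[where f="(+)"] sum.cong refl)
  qed
  also have "\<dots> \<le> (\<Sum>i\<in>{1..8} - ?T. E (f \<circ> carpet_map i)) + (\<Sum>i\<in>?T. E (f \<circ> carpet_map i) - edge_energy ?T (f \<circ> carpet_map i) n +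
      3 * (edge_energy ?T (f \<circ> carpet_map i) n - edge_energy ?T (f \<circ> carpet_map i) (Suc n)))"
    using IH by (intro add_left_mono sum_mono) blast
  also have "\<dots> = (\<Sum>i\<in>{1..8}. E (f \<circ> carpet_map i)) - (\<Sum>i\<in>?T. edge_energy ?T (f \<circ> carpet_map i) n)
      + 3 * ((\<Sum>i\<in>?T. edge_energy ?T (f \<circ> carpet_map i) n) - (\<Sum>i\<in>?T. edge_energy ?T (f \<circ> carpet_map i) (Suc n)))"
  proof -
    have "(\<Sum>i\<in>?T. e i - a i + 3 * (a i - b i)) = (\<Sum>i\<in>?T. e i) - (\<Sum>i\<in>?T. a i) + 3 * ((\<Sum>i\<in>?T. a i) - (\<Sum>i\<in>?T. b i))"
      for e a b :: "nat \<Rightarrow> real"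
      by (simp only: sum.distrib sum_subtractf sum_distrib_left[symmetric])
    moreover have "x + (u - v + w) = x + u - v + w" for x u v w :: real by simp
    ultimately show ?thesis unfolding split by (simp only:)
  qed
  finally have le: "E (f \<circ> fold_top (Suc n)) \<le> \<rho> * ((\<Sum>i\<in>{1..8}. E (f \<circ> carpet_map i)) - (\<Sum>i\<in>?T. edge_energy ?T (f \<circ> carpet_map i) n)
      + 3 * ((\<Sum>i\<in>?T. edge_energy ?T (f \<circ> carpet_map i) n) - (\<Sum>i\<in>?T. edge_energy ?T (f \<circ> carpet_map i) (Suc n))))"
    unfolding E_fold by (rule mult_left_mono) (rule less_imp_le[OF rho])
  have dist: "\<rho> * (s - a + 3 * (a - b)) = \<rho> * s - \<rho> * a + 3 * (\<rho> * a - \<rho> * b)" for s a b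
    by (simp add: algebra_simps)
  have "E (f \<circ> fold_top (Suc n)) \<le> E f - edge_energy ?T f (Suc n) +
      3 * (edge_energy ?T f (Suc n) - edge_energy ?T f (Suc (Suc n)))"
    using le unfolding dist E_carpet_map[OF fF] edge_energy_Suc[of ?T f] .
  with FC show ?case by blast
qed

lemma uniformly_to_compose:
  assumes f: "continuous_on K f" and T: "\<And>n z. z \<in> K \<Longrightarrow> T n z \<in> K"
    "\<And>n z. z \<in> K \<Longrightarrow> dist (T n z) z \<le> c n" and c: "c \<longlonglongrightarrow> (0::real)"
  shows "uniformly_to (\<lambda>n. f \<circ> T n) f"
  unfolding uniformly_to_def
proof (intro allI impI)
  fix e :: real assume "0 < e"
  then obtain d where d: "0 < d" "\<And>x y. x \<in> K \<Longrightarrow> y \<in> K \<Longrightarrow> dist x y < d \<Longrightarrow> dist (f x) (f y) < e"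
    using compact_uniformly_continuous[OF f compact_K] unfolding uniformly_continuous_on_def
    by (metis dist_commute)
  from order_tendstoD(2)[OF c d(1)]
  show "\<forall>\<^sub>F n in sequentially. \<forall>x\<in>K. \<bar>(f \<circ> T n) x - f x\<bar> \<le> e"
  proof eventually_elim
    case (elim n)
    show ?case
    proof
      fix x assume x: "x \<in> K"
      have "dist (T n x) x < d" using T(2)[OF x, of n] elim by linarith
      from d(2)[OF T(1)[OF x] x this] show "\<bar>(f \<circ> T n) x - f x\<bar> \<le> e" by (simp add: dist_real_def)
    qed
  qed
qed

lemma top_energy_tendsto_FC:
  assumes f: "f \<in> \<F>C"
  shows "edge_energy {5,6,7} f \<longlonglongrightarrow> 0"
proof -
  let ?e = "edge_energy {5,6,7} f"
  have fF: "f \<in> \<F>" by (rule FC_F[OF f])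
  have nn: "0 \<le> ?e n" for n by (rule edge_energy_nonneg[OF fF]) auto
  have dec: "decseq ?e" by (rule decseq_SucI, rule edge_energy_decreasing[OF fF]) auto
  obtain c where c: "?e \<longlonglongrightarrow> c" "\<And>n. c \<le> ?e n" using decseq_convergent[OF dec, of 0] nn by blast
  have "E f \<le> E f - c + e" if "0 < e" for e
  proof (rule energy_lsc[OF _ fF])
    show "f \<circ> fold_top n \<in> \<F>" for n using fold_top_energy[OF f, of n] FC_F by blast
    have "(\<lambda>n. 2 * (1/3::real) ^ n) \<longlonglongrightarrow> 0" by real_asymp
    then show "uniformly_to (\<lambda>n. f \<circ> fold_top n) f"
      using dist_fold_top[OF K_in_square(2)]
      by (intro uniformly_to_compose[OF FC_cont[OF f], of fold_top "\<lambda>n. 2 * (1/3) ^ n"] fold_top_in_K)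
    have "(\<lambda>n. 3 * (?e n - ?e (Suc n))) \<longlonglongrightarrow> 3 * (c - c)"
      by (intro tendsto_intros c LIMSEQ_Suc)
    then have "\<forall>\<^sub>F n in sequentially. 3 * (?e n - ?e (Suc n)) < e"
      using that by (intro order_tendstoD(2)[of _ 0]) auto
    then show "\<forall>\<^sub>F n in sequentially. E (f \<circ> fold_top n) \<le> E f - c + e"
    proof eventually_elim
      case (elim n)
      then show ?case using fold_top_energy[OF f, of n] c(2)[of n] by linarith
    qed
  qed
  from this[of "c / 2"] have "c \<le> 0" by (cases "0 < c") simp_all
  moreover have "0 \<le> c" by (rule LIMSEQ_le_const[OF c(1)]) (use nn in blast)
  ultimately show ?thesis using c(1) by simp
qed

lemma FC_dense:
  assumes "f \<in> \<F>" "0 < e"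
  obtains g where "g \<in> \<F>C" "E (\<lambda>x. f x - g x) < e"
proof -
  obtain C where C: "1 \<le> C" "\<And>f. f \<in> \<F> \<Longrightarrow> sobolev_seminorm K m p \<rho> f \<le> C * N f"
    "\<And>f. f \<in> \<F> \<Longrightarrow> N f \<le> C * sobolev_seminorm K m p \<rho> f"
    using N_comparable by blast
  \<comment> \<open>With this \<open>d\<close>, the comparison of \<open>N\<close> with the Sobolev
    seminorm yields the bound \<open>(e / 2) powr (1/p)\<close> for \<open>N\<close>, that is,
    \<open>e / 2\<close> for the energy.\<close>
  define d where "d = (e / 2) powr (1/p) / C"
  have "0 < d" using assms(2) C(1) by (simp add: d_def)
  then obtain g where g: "g \<in> \<F>C" "sobolev_norm K m p \<rho> (\<lambda>x. f x - g x) < d"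
    using dense assms(1) unfolding dense_subset_on_def by blast
  have F: "(\<lambda>x. f x - g x) \<in> \<F>" by (rule F_diff[OF assms(1) FC_F[OF g(1)]])
  have "sobolev_seminorm K m p \<rho> (\<lambda>x. f x - g x) \<le> d"
    using g(2) unfolding sobolev_norm_def Lp_norm_def
    by (smt (verit) powr_ge_zero)
  then have "C * sobolev_seminorm K m p \<rho> (\<lambda>x. f x - g x) \<le> C * d" using C(1) by simp
  then have "N (\<lambda>x. f x - g x) \<le> (e / 2) powr (1/p)" using C(3)[OF F] C(1) by (simp add: d_def)
  then have "N (\<lambda>x. f x - g x) powr p \<le> ((e / 2) powr (1/p)) powr p"
    using p by (intro powr_mono2) (auto simp: N_nonneg)
  then have "E (\<lambda>x. f x - g x) \<le> e / 2" using p assms(2) by (simp add: E_eq_N[OF F] powr_powr)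
  with g(1) show ?thesis using assms(2) by (intro that) auto
qed

text \<open>Approximation by a continuous \<open>g\<close>: up to the factor
  \<open>2 powr (p - 1)\<close>, the row energy of \<open>f\<close> is at most that of
  \<open>g\<close>, which tends to 0, plus that of \<open>f - g\<close>, which is bounded by
  \<open>E (f - g)\<close> on every level.\<close>

lemma top_energy_tendsto:
  assumes f: "f \<in> \<F>"
  shows "edge_energy {5,6,7} f \<longlonglongrightarrow> 0"
proof (rule tendstoI)
  let ?T = "{5,6,7::nat}"
  fix e :: real assume "0 < e"
  define c where "c = (1/2) powr (1 - p)"
  have c: "0 < c" by (simp add: c_def)
  obtain g where g: "g \<in> \<F>C" "E (\<lambda>x. f x - g x) < e / (2 * c)"
    using FC_dense[OF f, of "e / (2 * c)"] \<open>0 < e\<close> c by auto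
  have gF: "g \<in> \<F>" by (rule FC_F[OF g(1)])
  note dF = F_diff[OF f gF]
  have "\<forall>\<^sub>F n in sequentially. edge_energy ?T g n < e / (2 * c)"
    using order_tendstoD(2)[OF top_energy_tendsto_FC[OF g(1)]] \<open>0 < e\<close> c by simp
  then show "\<forall>\<^sub>F n in sequentially. dist (edge_energy ?T f n) 0 < e"
  proof eventually_elim
    case (elim n)
    have "E (f \<circ> word_map w) \<le> c * E (g \<circ> word_map w) + c * E ((\<lambda>x. f x - g x) \<circ> word_map w)"
      if "w \<in> words_over ?T n" for w
    proof -
      have w: "w \<in> words n" by (rule words_over_letters[OF _ that]) auto
      show ?thesis
        using E_add_le[OF F_word_map[OF gF w] F_word_map[OF dF w], of "1/2"]
        by (simp add: c_def comp_def)
    qed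
    then have "(\<Sum>w\<in>words_over ?T n. E (f \<circ> word_map w))
        \<le> (\<Sum>w\<in>words_over ?T n. c * E (g \<circ> word_map w) + c * E ((\<lambda>x. f x - g x) \<circ> word_map w))"
      by (rule sum_mono)
    then have "edge_energy ?T f n \<le> \<rho> ^ n * (\<Sum>w\<in>words_over ?T n. c * E (g \<circ> word_map w) + c * E ((\<lambda>x. f x - g x) \<circ> word_map w))"
      unfolding edge_energy_def using rho by (intro mult_left_mono) auto
    also have "\<dots> = c * edge_energy ?T g n + c * edge_energy ?T (\<lambda>x. f x - g x) n"
      unfolding edge_energy_def by (simp only: sum.distrib sum_distrib_left ring_distribs mult_ac)
    also have "\<dots> \<le> c * edge_energy ?T g n + c * E (\<lambda>x. f x - g x)"
      using c edge_energy_le[OF dF, of ?T n] by simp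
    also have "\<dots> < c * (e / (2 * c)) + c * (e / (2 * c))"
      using c elim g(2) by (intro add_strict_mono mult_strict_left_mono)
    also have "\<dots> = e" using c by simp
    finally show ?case using edge_energy_nonneg[OF f, of ?T n] by simp
  qed
qed

text \<open>The letters along the side of the square that \<open>T\<close> carries to the upper
  side.\<close>

definition side :: "(plane \<Rightarrow> plane) \<Rightarrow> nat set" where
  "side T = {i\<in>{1..8}. snd (T (carpet_pt i)) = 1}"

text \<open>\<open>T\<close> relabels the words along this side as words along the upper one, and
  invariance of \<open>E\<close> turns \<open>f\<close> into \<open>f \<circ> inv T\<close>.\<close>

lemma side_energy_tendsto:
  assumes f: "f \<in> \<F>" and T: "T \<in> carpet_symmetries"
  shows "edge_energy (side T) f \<longlonglongrightarrow> 0"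
proof -
  obtain \<sigma> where \<sigma>: "bij_betw \<sigma> {1..8} {1..8}" "\<forall>i\<in>{1..8}. T (carpet_pt i) = carpet_pt (\<sigma> i)"
    and \<sigma>w: "\<forall>n. \<forall>w\<in>words n. \<forall>z. T (word_map w z) = word_map (map \<sigma> w) (T z)"
    using carpet_symmetry_words[OF T] by (elim exE conjE)
  have \<sigma>3: "T (word_map w z) = word_map (map \<sigma> w) (T z)" if "w \<in> words n" for n w z
    using \<sigma>w that by blast
  have top: "{5,6,7} = {i\<in>{1..8}. snd (carpet_pt i) = 1}" unfolding letters_eq by auto
  have img: "\<sigma> ` side T = {5,6,7}"
  proof -
    have "side T = {i\<in>{1..8}. snd (carpet_pt (\<sigma> i)) = 1}"
      unfolding side_def by (intro Collect_cong conj_cong refl) (simp only: bspec[OF \<sigma>(2)])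
    then have "\<sigma> ` side T = {j\<in>\<sigma> ` {1..8}. snd (carpet_pt j) = 1}" by blast
    then show ?thesis by (simp only: bij_betw_imp_surj_on[OF \<sigma>(1)] top)
  qed
  have inj: "inj_on \<sigma> (side T)" by (rule inj_on_subset[OF bij_betw_imp_inj_on[OF \<sigma>(1)]]) (auto simp: side_def)
  have bij: "bij_betw (map \<sigma>) (words_over (side T) n) (words_over {5,6,7} n)" for n
    by (rule bij_betw_map_words_over[OF bij_betw_imageI[OF inj img]])
  note F = F_symmetry[OF f symmetry_bij(2)[OF T]]
  have "edge_energy (side T) f n = edge_energy {5,6,7} (f \<circ> inv T) n" for n
  proof -
    have "E (f \<circ> word_map w) = E (f \<circ> inv T \<circ> word_map (map \<sigma> w))" if "w \<in> words_over (side T) n" for w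
    proof -
      have w: "w \<in> words n" by (rule words_over_letters[OF _ that]) (auto simp: side_def)
      have w': "map \<sigma> w \<in> words n" by (rule words_over_letters[OF _ bij_betw_apply[OF bij that]]) auto
      have "f \<circ> word_map w = f \<circ> inv T \<circ> word_map (map \<sigma> w) \<circ> T"
        by (simp only: fun_eq_iff comp_apply \<sigma>3[OF w, symmetric] inv_f_f[OF bij_is_inj[OF symmetry_bij(1)[OF T]]]) simp
      then show ?thesis using E_symmetry[OF F_word_map[OF F w'] T] by simp
    qed
    then show ?thesis
      unfolding edge_energy_def sum.reindex_bij_betw[OF bij, symmetric] by simp
  qed
  then have "edge_energy (side T) f = edge_energy {5,6,7} (f \<circ> inv T)" by (rule ext)
  then show ?thesis using top_energy_tendsto[OF F] by (simp only:)
qed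

end

subsection \<open>The energy measures\<close>

lemma sum_UN_le:
  fixes g :: "'a \<Rightarrow> real"
  assumes "finite I" "\<And>i. i \<in> I \<Longrightarrow> finite (A i)" "\<And>i x. i \<in> I \<Longrightarrow> x \<in> A i \<Longrightarrow> 0 \<le> g x"
  shows "sum g (\<Union>i\<in>I. A i) \<le> (\<Sum>i\<in>I. sum g (A i))"
  using assms
proof (induction I rule: finite_induct)
  case (insert i I)
  have "sum g (\<Union>i\<in>insert i I. A i) = sum g (A i) + sum g ((\<Union>i\<in>I. A i) - A i)"
    using insert.hyps(1) insert.prems(1) by (simp flip: sum.union_diff2 sum.union_disjoint add: Un_Diff_cancel)
  also have "sum g ((\<Union>i\<in>I. A i) - A i) \<le> sum g (\<Union>i\<in>I. A i)"
    using insert.hyps(1) insert.prems by (intro sum_mono2) auto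
  also have "\<dots> \<le> (\<Sum>i\<in>I. sum g (A i))" using insert.prems by (intro insert.IH) auto
  finally show ?case using insert.hyps by simp
qed simp

text \<open>Because the inequality is linear, it passes through every step of the induction on
  \<open>g\<close>: multiples, sums and monotone limits.\<close>

lemma nn_integral_le_combination:
  assumes sets: "sets \<nu> = sets M" "sets \<nu>1 = sets M" "sets \<nu>2 = sets M"
    and le: "\<And>B. B \<in> sets M \<Longrightarrow> emeasure \<nu> B \<le> a * emeasure \<nu>1 B + b * emeasure \<nu>2 B"
    and g: "g \<in> borel_measurable M"
  shows "(\<integral>\<^sup>+ x. g x \<partial>\<nu>) \<le> a * (\<integral>\<^sup>+ x. g x \<partial>\<nu>1) + b * (\<integral>\<^sup>+ x. g x \<partial>\<nu>2)"
  using g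
proof (induction rule: borel_measurable_induct)
  case (cong f g)
  have sp: "space \<nu> = space M" "space \<nu>1 = space M" "space \<nu>2 = space M"
    using sets by (auto dest: sets_eq_imp_space_eq)
  have "(\<integral>\<^sup>+ x. f x \<partial>\<mu>) = (\<integral>\<^sup>+ x. g x \<partial>\<mu>)" if "space \<mu> = space M" for \<mu>
    using cong(3) that by (intro nn_integral_cong) auto
  then show ?case using cong(4) sp by metis
next
  case (set A)
  then show ?case using le[OF set] sets by simp
next
  case (mult u c)
  note [measurable_cong] = sets
  have [measurable]: "u \<in> borel_measurable \<nu>" "u \<in> borel_measurable \<nu>1" "u \<in> borel_measurable \<nu>2"
    using mult(2) by measurable
  show ?case using mult_left_mono[OF mult(4), of c] by (simp add: nn_integral_cmult distrib_left mult_ac)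
next
  case (add u v)
  note [measurable_cong] = sets
  have [measurable]: "u \<in> borel_measurable \<nu>" "u \<in> borel_measurable \<nu>1" "u \<in> borel_measurable \<nu>2"
    "v \<in> borel_measurable \<nu>" "v \<in> borel_measurable \<nu>1" "v \<in> borel_measurable \<nu>2"
    using add.hyps by measurable
  show ?case using add_mono[OF add.IH] by (simp add: nn_integral_add distrib_left ac_simps)
next
  case (seq U)
  note [measurable_cong] = sets
  have [measurable]: "U i \<in> borel_measurable \<nu>" for i using seq(1) by measurable
  have "(\<integral>\<^sup>+ x. (SUP i. U i) x \<partial>\<nu>) = (SUP i. \<integral>\<^sup>+ x. U i x \<partial>\<nu>)"
    unfolding SUP_apply using seq.hyps(3) by (intro nn_integral_monotone_convergence_SUP) measurable
  also have "\<dots> \<le> a * (\<integral>\<^sup>+ x. (SUP i. U i) x \<partial>\<nu>1) + b * (\<integral>\<^sup>+ x. (SUP i. U i) x \<partial>\<nu>2)"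
  proof (rule SUP_least)
    fix i
    have "U i \<le> (SUP i. U i)" by (rule SUP_upper) simp
    then have "(\<integral>\<^sup>+ x. U i x \<partial>\<mu>) \<le> (\<integral>\<^sup>+ x. (SUP i. U i) x \<partial>\<mu>)" for \<mu>
      by (intro nn_integral_mono) (simp add: le_fun_def)
    then show "(\<integral>\<^sup>+ x. U i x \<partial>\<nu>) \<le> a * (\<integral>\<^sup>+ x. (SUP i. U i) x \<partial>\<nu>1) + b * (\<integral>\<^sup>+ x. (SUP i. U i) x \<partial>\<nu>2)"
      by (intro order_trans[OF seq.IH] add_mono mult_left_mono) auto
  qed
  finally show ?case .
qed

text \<open>The family of linear bounds is equivalent to the triangle inequality for the \<open>p\<close>-th roots;
  the value of \<open>l\<close> for which it is attained is \<open>a / (a + b)\<close>, where \<open>a\<close> and \<open>b\<close> are the roots.\<close>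

lemma ennreal_powr_triangle:
  assumes p: "1 < p"
    and le: "\<And>l. 0 < l \<Longrightarrow> l < 1 \<Longrightarrow> x \<le> ennreal (l powr (1 - p)) * y + ennreal ((1 - l) powr (1 - p)) * z"
  shows "ennreal_powr x (1/p) \<le> ennreal_powr y (1/p) + ennreal_powr z (1/p)"
proof (cases "y = \<infinity> \<or> z = \<infinity>")
  case True
  then show ?thesis by (auto simp: ennreal_powr_def)
next
  case False
  then obtain y' z' where yz: "y = ennreal y'" "z = ennreal z'" "0 \<le> y'" "0 \<le> z'"
    by (cases y; cases z) auto
  have le': "x \<le> ennreal (l powr (1 - p) * y' + (1 - l) powr (1 - p) * z')" if "0 < l" "l < 1" for l
    using le[OF that] yz by (simp add: ennreal_plus ennreal_mult)
  have "x \<noteq> \<infinity>" using le'[of "1/2"] by (auto simp: top_unique)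
  then obtain x' where x: "x = ennreal x'" "0 \<le> x'" by (cases x) auto
  define a where "a = y' powr (1/p)"
  define b where "b = z' powr (1/p)"
  have ab: "0 \<le> a" "0 \<le> b" "y' = a powr p" "z' = b powr p"
    using p yz by (auto simp: a_def b_def powr_powr)
  have "x' powr (1/p) \<le> a + b + e" if e: "0 < e" for e
  proof -
    \<comment> \<open>The shift by \<open>e / 2\<close> makes both roots positive, so that the
      optimal \<open>l\<close> lies strictly between 0 and 1 even if \<open>a\<close> or
      \<open>b\<close> vanishes.\<close>
    define a' where "a' = a + e / 2"
    define b' where "b' = b + e / 2"
    have a'b': "0 < a'" "0 < b'" "a \<le> a'" "b \<le> b'" using e ab by (auto simp: a'_def b'_def)
    define l where "l = a' / (a' + b')"
    have l: "0 < l" "l < 1" "1 - l = b' / (a' + b')" using a'b' by (auto simp: l_def field_simps)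
    have sc: "(u / s) powr (1 - p) * u powr p = u * s powr (p - 1)" if "0 < u" "0 < s" for u s :: real
      using that by (simp add: powr_divide powr_diff)
    have "x' \<le> l powr (1 - p) * y' + (1 - l) powr (1 - p) * z'"
      by (rule ennreal_le_iff[THEN iffD1, OF _ le'[OF l(1,2), unfolded x(1)]])
        (use yz in \<open>simp add: add_nonneg_nonneg\<close>)
    also have "\<dots> \<le> l powr (1 - p) * a' powr p + (1 - l) powr (1 - p) * b' powr p"
      using p ab a'b' by (intro add_mono mult_left_mono) (auto intro!: powr_mono2)
    also have "\<dots> = a' * (a' + b') powr (p - 1) + b' * (a' + b') powr (p - 1)"
      unfolding l(3) unfolding l_def using a'b' by (subst (1 2) sc) auto
    also have "\<dots> = (a' + b') powr p"
      using a'b' by (simp add: powr_mult_base flip: distrib_right)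
    finally have "x' powr (1/p) \<le> ((a' + b') powr p) powr (1/p)"
      using x p by (intro powr_mono2) auto
    also have "\<dots> = a + b + e" using a'b' p by (simp add: powr_powr a'_def b'_def)
    finally show ?thesis .
  qed
  then have "x' powr (1/p) \<le> a + b" by (rule field_le_epsilon)
  then show ?thesis
    using x yz by (simp add: ennreal_powr_def a_def b_def flip: ennreal_plus)
qed

section \<open>Intersections of cells and set functions on the carpet\<close>

lemma word_map_interior:
  assumes "w \<in> words n" "\<bar>fst z\<bar> < 1" "\<bar>snd z\<bar> < 1"
  shows "\<bar>fst (word_map w z)\<bar> < 1 \<and> \<bar>snd (word_map w z)\<bar> < 1"
  using assms(1)
proof (induction w arbitrary: n)
  case (Cons i w)
  then have "w \<in> words (n - 1)" and i: "i \<in> {1..8}" by (auto simp: words_def)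
  have step: "\<bar>(s + 2 * q) / 3\<bar> < 1" if "\<bar>s\<bar> < 1" "q \<in> {-1, 0, 1}" for s q :: real
    using that by auto
  from Cons.IH[OF \<open>w \<in> words (n - 1)\<close>] show ?case
    unfolding word_map_Cons comp_apply fst_carpet_map snd_carpet_map
    by (intro conjI step carpet_pt_cases[OF i]) simp_all
qed (use assms in auto)

context carpet
begin

text \<open>Common first letters can be cancelled. If the first letters differ and \<open>z\<close>
  were inside the open square, then in each coordinate the equation of the two points would force
  equal grid coordinates, as these differ by half the difference of two numbers in
  \<open>[-1, 1]\<close>, one of them of modulus less than 1. The letters would then
  coincide.\<close>

lemma cells_meet_boundary:
  assumes "u \<in> words n" "w \<in> words n" "u \<noteq> w" "z \<in> K" "z' \<in> K" "word_map u z = word_map w z'"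
  shows "\<bar>fst z\<bar> = 1 \<or> \<bar>snd z\<bar> = 1"
  using assms
proof (induction n arbitrary: u w)
  case (Suc n)
  have cons: "\<exists>i x'. x = i # x' \<and> i \<in> {1..8} \<and> x' \<in> words n" if "x \<in> words (Suc n)" for x
    using that by (cases x) (auto simp: words_def)
  obtain i u' where u: "u = i # u'" "i \<in> {1..8}" "u' \<in> words n"
    using cons[OF Suc.prems(1)] by blast
  obtain j w' where w: "w = j # w'" "j \<in> {1..8}" "w' \<in> words n"
    using cons[OF Suc.prems(2)] by blast
  have eq: "carpet_map i (word_map u' z) = carpet_map j (word_map w' z')"
    using Suc.prems u w by simp
  show ?case
  proof (cases "i = j")
    case True
    then have "word_map u' z = word_map w' z'"
      using eq injD[OF inj_word_map, of "[i]" "word_map u' z" "word_map w' z'"] by simp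
    with True show ?thesis using Suc.IH[OF u(3) w(3)] Suc.prems u w by auto
  next
    case False
    show ?thesis
    proof (rule ccontr)
      assume "\<not> ?thesis"
      then have "\<bar>fst z\<bar> < 1" "\<bar>snd z\<bar> < 1" using K_in_square[OF Suc.prems(4)] by auto
      from word_map_interior[OF u(3) this]
      have a: "\<bar>fst (word_map u' z)\<bar> < 1" "\<bar>snd (word_map u' z)\<bar> < 1" by auto
      have b: "\<bar>fst (word_map w' z')\<bar> \<le> 1" "\<bar>snd (word_map w' z')\<bar> \<le> 1"
        using K_in_square[OF word_map_in_K[OF w(3) Suc.prems(5)]] by auto
      have "x = y" if "\<bar>s\<bar> < 1" "\<bar>t\<bar> \<le> 1" "x \<in> {-1, 0, 1}" "y \<in> {-1, 0, 1}"
        "(s + 2 * x) / 3 = (t + 2 * y) / 3" for s t x y :: real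
        using that by auto
      note coord = this
      have "fst (carpet_pt i) = fst (carpet_pt j)"
        using arg_cong[OF eq, of fst] unfolding fst_carpet_map
        by (rule coord[OF a(1) b(1) carpet_pt_cases(1)[OF u(2)] carpet_pt_cases(1)[OF w(2)]])
      moreover have "snd (carpet_pt i) = snd (carpet_pt j)"
        using arg_cong[OF eq, of snd] unfolding snd_carpet_map
        by (rule coord[OF a(2) b(2) carpet_pt_cases(2)[OF u(2)] carpet_pt_cases(2)[OF w(2)]])
      ultimately have "carpet_pt i = carpet_pt j" by (rule prod_eqI)
      then show False using False inj_onD[OF inj_on_carpet_pt] u(2) w(2) by blast
    qed
  qed
qed (auto simp: words_def)

text \<open>An equation \<open>(s + 2 * q) / 3 = 1\<close> with \<open>s\<close> and
  \<open>q\<close> at most 1 forces \<open>s = q = 1\<close>, so a point of the side can be reached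
  only through letters of that side.\<close>

lemma side_words:
  assumes "T \<in> carpet_symmetries" "z \<in> K" "v \<in> words k" "snd (T (word_map v z)) = 1"
  shows "v \<in> words_over {i\<in>{1..8}. snd (T (carpet_pt i)) = 1} k"
  using assms(3,4)
proof (induction v arbitrary: k)
  case (Cons i v)
  then have v: "v \<in> words (k - 1)" and i: "i \<in> {1..8}" and k: "k = Suc (k - 1)" by (auto simp: words_def)
  obtain \<sigma> where \<sigma>: "bij_betw \<sigma> {1..8} {1..8}" "\<forall>i\<in>{1..8}. T (carpet_pt i) = carpet_pt (\<sigma> i)"
    using carpet_symmetry_words[OF assms(1)] by (elim exE conjE)
  have \<sigma>i: "T (carpet_pt i) = carpet_pt (\<sigma> i)" "\<sigma> i \<in> {1..8}"
    using \<sigma>(2) bij_betwE[OF \<sigma>(1)] i by blast+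
  define a where "a = T (word_map v z)"
  have "\<bar>snd a\<bar> \<le> 1" unfolding a_def
    by (intro K_in_square symmetry_in_K[OF assms(1)] word_map_in_K[OF v assms(2)])
  moreover have "(snd a + 2 * snd (carpet_pt (\<sigma> i))) / 3 = 1"
    using Cons.prems(2) symmetry_carpet_map[OF assms(1) \<sigma>i(1)] by (simp add: a_def snd_carpet_map)
  ultimately have "snd a = 1" "snd (carpet_pt (\<sigma> i)) = 1"
    using carpet_pt_cases(2)[OF \<sigma>i(2)] by auto
  with Cons.IH[OF v] i \<sigma>i(1) show ?case
    by (subst k) (auto simp: a_def words_over_Suc)
qed (auto simp: words_def)

lemma cell_measure_compact':
  assumes "cell_weight \<mu>" "compact A" "A \<subseteq> K"
  shows "(\<lambda>n. \<Sum>w\<in>words n. if word_map w ` K \<inter> A \<noteq> {} then \<mu> w else 0) \<longlonglongrightarrow> measure (cell_measure \<mu>) A"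
  using cell_measure_compact[OF assms] by (simp add: sum.inter_filter[OF finite_words])

text \<open>Inner regularity and monotonicity give \<open>measure \<nu> B \<le> \<tau> B\<close>,
  and likewise for the complement; as the totals agree, both are equalities. This identifies a sum
  of push-forwards without first making it a measure.\<close>

lemma measure_extend_compact:
  assumes fin: "finite_measure \<nu>" and sets: "sets \<nu> = sets (borel_on K)"
    and compact: "\<And>A. compact A \<Longrightarrow> A \<subseteq> K \<Longrightarrow> measure \<nu> A = \<tau> A"
    and mono: "\<And>A B. A \<in> sets (borel_on K) \<Longrightarrow> B \<in> sets (borel_on K) \<Longrightarrow> A \<subseteq> B \<Longrightarrow> \<tau> A \<le> \<tau> B"
    and compl: "\<And>B. B \<in> sets (borel_on K) \<Longrightarrow> \<tau> (K - B) = \<tau> K - \<tau> B"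
    and B: "B \<in> sets (borel_on K)"
  shows "measure \<nu> B = \<tau> B"
proof -
  interpret finite_measure \<nu> by (rule fin)
  have K: "K \<in> sets (borel_on K)" by (rule compact_sets[OF compact_K]) simp
  have sp: "space \<nu> = K" using sets_eq_imp_space_eq[OF sets] by (simp add: space_borel_on)
  have le: "measure \<nu> B \<le> \<tau> B" if B: "B \<in> sets (borel_on K)" for B
  proof -
    have BK: "B \<subseteq> K" using B by (simp add: sets_borel_on)
    have empty: "\<tau> {} = 0" using compl[OF K] by simp
    have nonneg: "0 \<le> \<tau> B" using mono[of "{}" B] B empty by simp
    have "emeasure \<nu> B \<le> ennreal (\<tau> B)"
      unfolding emeasure_inner_compact[OF fin sets B]
    proof (rule SUP_least)
      fix A assume "A \<in> {A. A \<subseteq> B \<and> compact A}"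
      then have A: "A \<subseteq> B" "compact A" "A \<subseteq> K" using BK by auto
      show "emeasure \<nu> A \<le> ennreal (\<tau> B)"
        unfolding emeasure_eq_measure compact[OF A(2,3)]
        by (intro ennreal_leI mono compact_sets A B)
    qed
    then show ?thesis using nonneg by (simp add: emeasure_eq_measure)
  qed
  have "measure \<nu> (K - B) = measure \<nu> K - measure \<nu> B"
    using finite_measure_compl[of B] B sets sp by simp
  moreover have "measure \<nu> K = \<tau> K" by (rule compact[OF compact_K]) simp
  moreover have "K - B \<in> sets (borel_on K)" using B K by (rule sets.Diff[rotated])
  ultimately show ?thesis using le[OF B] le[of "K - B"] compl[OF B] by linarith
qed

end

section \<open>Energy measures and their masses on cells\<close>

context carpet_energy
begin

definition energy_measure :: "(plane \<Rightarrow> real) \<Rightarrow> plane measure" ("\<Gamma>") where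
  "energy_measure f = cell_measure (weight f)"

lemma finite_energy_measure: "f \<in> \<F> \<Longrightarrow> finite_measure (\<Gamma> f)"
  and sets_energy_measure: "f \<in> \<F> \<Longrightarrow> sets (\<Gamma> f) = sets (borel_on K)"
  by (simp_all add: energy_measure_def finite_cell_measure sets_cell_measure cell_weight_weight)

lemma energy_measure_compact:
  assumes "f \<in> \<F>" "compact A" "A \<subseteq> K"
  shows "(\<lambda>n. \<Sum>w\<in>words n. if word_map w ` K \<inter> A \<noteq> {} then weight f w else 0) \<longlonglongrightarrow> measure (\<Gamma> f) A"
  unfolding energy_measure_def by (rule cell_measure_compact'[OF cell_weight_weight[OF assms(1)] assms(2,3)])

lemma weight_nonneg': "f \<in> \<F> \<Longrightarrow> w \<in> words n \<Longrightarrow> 0 \<le> weight f w"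
  using cell_weight_weight unfolding cell_weight_def by blast

lemma energy_measure_cong:
  assumes "f \<in> \<F>" "g \<in> \<F>" "AE x in m. f x = g x"
  shows "\<Gamma> f = \<Gamma> g"
proof (rule measure_eqI_compact)
  fix A assume A: "compact A" "A \<subseteq> K"
  have "weight f w = weight g w" if "w \<in> words n" for w n
    using E_cong_AE[OF F_word_map[OF assms(1) that] F_word_map[OF assms(2) that]]
      AE_word_map[OF that assms(3)] by (simp add: weight_def)
  then have "(\<Sum>w\<in>words n. if word_map w ` K \<inter> A \<noteq> {} then weight f w else 0) =
      (\<Sum>w\<in>words n. if word_map w ` K \<inter> A \<noteq> {} then weight g w else 0)" for n
    by (intro sum.cong) auto
  then show "measure (\<Gamma> f) A = measure (\<Gamma> g) A"
    using LIMSEQ_unique[OF energy_measure_compact[OF assms(1) A]] energy_measure_compact[OF assms(2) A]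
    by simp
qed (rule finite_energy_measure sets_energy_measure assms)+

lemma weight_words: "f \<in> \<F> \<Longrightarrow> u \<in> words n \<Longrightarrow> (\<Sum>v\<in>words k. weight f (u @ v)) = weight f u"
  using E_words[OF F_word_map, of f u n k]
  by (simp only: weight_def comp_word_map_append length_append power_add sum_distrib_left mult.assoc)
    (simp add: words_def)

text \<open>One symmetry for each side; in the order listed they carry the upper, lower, right and
  left side to the upper one.\<close>

definition sides :: "(plane \<Rightarrow> plane) set" where
  "sides = {id, reflect_y, swap_xy, reflect_y \<circ> swap_xy}"

lemma sides_symmetries: "T \<in> sides \<Longrightarrow> T \<in> carpet_symmetries"
  using id_symmetry reflect_symmetry swap_symmetry reflect_swap_symmetry by (auto simp: sides_def)

text \<open>Words of length \<open>n + k\<close> whose cells meet the cell of \<open>w\<close> are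
  sorted by their first \<open>n\<close> letters. Those beginning with \<open>w\<close> contribute
  exactly \<open>weight f w\<close>. For any other prefix \<open>u\<close> the remaining
  \<open>k\<close> letters run along one of the four sides of the cell of \<open>u\<close>, and the
  energy there tends to 0 as \<open>k\<close> grows.\<close>

lemma energy_measure_cell:
  assumes f: "f \<in> \<F>" and w: "w \<in> words n"
  shows "measure (\<Gamma> f) (word_map w ` K) = weight f w"
proof -
  let ?A = "word_map w ` K"
  let ?S = "\<lambda>u k. \<Sum>v\<in>words k. if word_map (u @ v) ` K \<inter> ?A \<noteq> {} then weight f (u @ v) else 0"
  let ?b = "\<lambda>u k. \<Sum>T\<in>sides. \<rho> ^ n * edge_energy (side T) (f \<circ> word_map u) k"
  have AK: "?A \<subseteq> K" using word_map_in_K[OF w] by (rule image_subsetI)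
  have lim: "(\<lambda>k. \<Sum>v\<in>words (k + n). if word_map v ` K \<inter> ?A \<noteq> {} then weight f v else 0) \<longlonglongrightarrow> measure (\<Gamma> f) ?A"
    by (rule LIMSEQ_ignore_initial_segment[OF energy_measure_compact[OF f compact_cell AK]])
  have split: "(\<Sum>v\<in>words (k + n). if word_map v ` K \<inter> ?A \<noteq> {} then weight f v else 0)
      = weight f w + (\<Sum>u\<in>words n - {w}. ?S u k)" for k
  proof -
    have "word_map (w @ v) ` K \<inter> ?A \<noteq> {}" if "v \<in> words k" for v
    proof -
      have "word_map (w @ v) base \<in> word_map (w @ v) ` K \<inter> ?A"
        using base_in_K word_map_in_K[OF that base_in_K] by (simp add: word_map_append)
      then show ?thesis by blast
    qed
    then have "?S w k = weight f w" using weight_words[OF f w, of k] by (simp cong: sum.cong)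
    moreover have "(\<Sum>v\<in>words (k + n). if word_map v ` K \<inter> ?A \<noteq> {} then weight f v else 0) = (\<Sum>u\<in>words n. ?S u k)"
      unfolding words_eq_words_over add.commute[of k n] by (rule sum_words_over_add)
    ultimately show ?thesis using sum.remove[OF finite_words w, of "\<lambda>u. ?S u k"] by simp
  qed
  have "(\<lambda>k. \<Sum>u\<in>words n - {w}. ?S u k) \<longlonglongrightarrow> 0"
  proof (rule tendsto_null_sum)
    fix u assume u: "u \<in> words n - {w}"
    then have un: "u \<in> words n" "u \<noteq> w" by auto
    note fu = F_word_map[OF f un(1)]
    show "(\<lambda>k. ?S u k) \<longlonglongrightarrow> 0"
    proof (rule tendsto_sandwich[OF _ _ tendsto_const])
      show "(\<lambda>k. ?b u k) \<longlonglongrightarrow> 0"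
        by (intro tendsto_null_sum tendsto_mult_right_zero side_energy_tendsto fu sides_symmetries)
      show "\<forall>\<^sub>F k in sequentially. 0 \<le> ?S u k"
        using weight_nonneg'[OF f words_append[OF un(1)]] by (intro always_eventually allI sum_nonneg) auto
      show "\<forall>\<^sub>F k in sequentially. ?S u k \<le> ?b u k"
      proof (intro always_eventually allI)
        fix k
        let ?G = "{v\<in>words k. word_map (u @ v) ` K \<inter> ?A \<noteq> {}}"
        have sub: "words_over (side T) k \<subseteq> words k" for T
          by (rule subsetI, rule words_over_letters[of "side T"]) (auto simp: side_def)
        have "?G \<subseteq> (\<Union>T\<in>sides. words_over (side T) k)"
        proof
          fix v assume "v \<in> ?G"
          then have "v \<in> words k" "\<exists>x\<in>K. \<exists>y\<in>K. word_map u (word_map v x) = word_map w y"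
            unfolding word_map_append comp_def by blast+
          then obtain x y where v: "v \<in> words k" "x \<in> K" "y \<in> K" "word_map u (word_map v x) = word_map w y"
            by blast
          have "\<bar>fst (word_map v x)\<bar> = 1 \<or> \<bar>snd (word_map v x)\<bar> = 1"
            by (rule cells_meet_boundary[OF un(1) w un(2) word_map_in_K[OF v(1,2)] v(3,4)])
          then have "\<exists>T\<in>sides. snd (T (word_map v x)) = 1"
            by (auto simp: sides_def reflect_y_def swap_xy_def abs_if split: if_splits)
          then obtain T where T: "T \<in> sides" "snd (T (word_map v x)) = 1" by blast
          from side_words[OF sides_symmetries[OF T(1)] v(2,1) T(2)] T(1)
          show "v \<in> (\<Union>T\<in>sides. words_over (side T) k)" unfolding side_def by blast
        qed
        then have "sum (\<lambda>v. weight f (u @ v)) ?G \<le> sum (\<lambda>v. weight f (u @ v)) (\<Union>T\<in>sides. words_over (side T) k)"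
          using sub weight_nonneg'[OF f words_append[OF un(1)]]
          by (intro sum_mono2 finite_subset[OF _ finite_words[of k]]) blast+
        also have "\<dots> \<le> (\<Sum>T\<in>sides. \<Sum>v\<in>words_over (side T) k. weight f (u @ v))"
          using sub weight_nonneg'[OF f words_append[OF un(1)]]
          by (intro sum_UN_le finite_subset[OF sub finite_words]) (auto simp: sides_def)
        also have "\<dots> = ?b u k"
        proof (rule sum.cong[OF refl])
          fix T
          have "weight f (u @ v) = \<rho> ^ n * (\<rho> ^ k * E (f \<circ> word_map u \<circ> word_map v))" if "v \<in> words_over (side T) k" for v
            using un(1) that by (simp add: weight_append words_def words_over_def) (simp add: weight_def)
          then show "(\<Sum>v\<in>words_over (side T) k. weight f (u @ v)) = \<rho> ^ n * edge_energy (side T) (f \<circ> word_map u) k"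
            by (simp add: edge_energy_def sum_distrib_left)
        qed
        finally show "?S u k \<le> ?b u k" by (simp add: sum.inter_filter[OF finite_words])
      qed
    qed
  qed
  from tendsto_add[OF tendsto_const[of "weight f w"] this]
  have "(\<lambda>k. weight f w + (\<Sum>u\<in>words n - {w}. ?S u k)) \<longlonglongrightarrow> weight f w" by (simp only: add_0_right)
  from LIMSEQ_unique[OF lim[unfolded split] this] show ?thesis .
qed

lemma energy_measure_total: "f \<in> \<F> \<Longrightarrow> measure (\<Gamma> f) K = E f"
  using energy_measure_cell[of f "[]" 0] by (simp add: words_eq_words_over weight_def)

section \<open>Triangle inequality and Lipschitz contractivity\<close>

lemma energy_measure_add_le:
  assumes f: "f \<in> \<F>" and g: "g \<in> \<F>" and l: "0 < l" "l < 1" and B: "B \<in> sets (borel_on K)"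
  shows "emeasure (\<Gamma> (\<lambda>x. f x + g x)) B
    \<le> ennreal (l powr (1 - p)) * emeasure (\<Gamma> f) B + ennreal ((1 - l) powr (1 - p)) * emeasure (\<Gamma> g) B"
  unfolding energy_measure_def
proof (rule cell_measure_le[OF cell_weight_weight[OF F_add[OF f g]] cell_weight_weight[OF f]
    cell_weight_weight[OF g] _ _ _ B])
  fix n w assume w: "w \<in> words n"
  have "E ((\<lambda>x. f x + g x) \<circ> word_map w)
      \<le> l powr (1 - p) * E (f \<circ> word_map w) + (1 - l) powr (1 - p) * E (g \<circ> word_map w)"
    using E_add_le[OF F_word_map[OF f w] F_word_map[OF g w] l] by (simp add: comp_def)
  then have "\<rho> ^ length w * E ((\<lambda>x. f x + g x) \<circ> word_map w)
      \<le> \<rho> ^ length w * (l powr (1 - p) * E (f \<circ> word_map w) + (1 - l) powr (1 - p) * E (g \<circ> word_map w))"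
    using rho by simp
  then show "weight (\<lambda>x. f x + g x) w \<le> l powr (1 - p) * weight f w + (1 - l) powr (1 - p) * weight g w"
    by (simp add: weight_def distrib_left mult_ac)
qed auto

lemma energy_measure_triangle:
  assumes f: "f \<in> \<F>" and g: "g \<in> \<F>" and h: "h \<in> borel_measurable (borel_on K)"
  shows "ennreal_powr (\<integral>\<^sup>+ x. h x \<partial>\<Gamma> (\<lambda>x. f x + g x)) (1/p)
    \<le> ennreal_powr (\<integral>\<^sup>+ x. h x \<partial>\<Gamma> f) (1/p) + ennreal_powr (\<integral>\<^sup>+ x. h x \<partial>\<Gamma> g) (1/p)"
  by (rule ennreal_powr_triangle[OF p], rule nn_integral_le_combination[OF sets_energy_measure[OF F_add[OF f g]]
      sets_energy_measure[OF f] sets_energy_measure[OF g] energy_measure_add_le[OF f g] h])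

lemma energy_measure_lipschitz:
  assumes f: "f \<in> \<F>" and h: "h \<in> borel_measurable (borel_on K)" and \<phi>: "1-lipschitz_on UNIV \<phi>"
  shows "(\<integral>\<^sup>+ x. h x \<partial>\<Gamma> (\<phi> \<circ> f)) \<le> (\<integral>\<^sup>+ x. h x \<partial>\<Gamma> f)"
proof -
  note \<phi>f = F_lipschitz[OF f \<phi>]
  have "emeasure (\<Gamma> (\<phi> \<circ> f)) B \<le> ennreal 1 * emeasure (\<Gamma> f) B + ennreal 0 * emeasure (\<Gamma> f) B"
    if "B \<in> sets (borel_on K)" for B
    unfolding energy_measure_def
  proof (rule cell_measure_le[OF cell_weight_weight[OF \<phi>f] cell_weight_weight[OF f] cell_weight_weight[OF f] _ _ _ that])
    fix n w assume w: "w \<in> words n"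
    show "weight (\<phi> \<circ> f) w \<le> 1 * weight f w + 0 * weight f w"
      using E_lipschitz[OF F_word_map[OF f w] \<phi>] rho by (simp add: weight_def comp_assoc)
  qed auto
  from nn_integral_le_combination[OF _ _ _ this h] show ?thesis
    using sets_energy_measure[OF f] sets_energy_measure[OF \<phi>f] by simp
qed

section \<open>Self-similarity and symmetry of the energy measures\<close>

lemma vimage_word_map_compact:
  assumes "compact A" shows "compact (word_map w -` A \<inter> K)"
proof -
  have "closed (K \<inter> word_map w -` A)"
    by (rule continuous_closed_preimage[OF continuous_on_word_map closed_K compact_imp_closed[OF assms]])
  then have "compact (K \<inter> (K \<inter> word_map w -` A))" by (rule compact_Int_closed[OF compact_K])
  then show ?thesis by (simp add: Int_commute)
qed

lemma measurable_word_map: "w \<in> words n \<Longrightarrow> word_map w \<in> measurable (borel_on K) (borel_on K)"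
  using word_map_in_K
  by (intro measurable_restrict_space2 borel_measurable_continuous_on_restrict continuous_on_word_map)
    (auto simp: space_borel_on)

text \<open>The cell of \<open>w @ v\<close> meets \<open>A\<close> exactly if the cell of
  \<open>v\<close> meets the preimage of \<open>A\<close> under \<open>word_map w\<close>. So for
  compact \<open>A\<close> the approximating sums agree at every level, whatever the overlaps of
  cells, and the limits agree as well.\<close>

lemma energy_measure_self_similar:
  assumes f: "f \<in> \<F>" and B: "B \<in> sets (borel_on K)"
  shows "emeasure (\<Gamma> f) B = ennreal (\<rho> ^ n) *
    (\<Sum>w\<in>words n. emeasure (distr (\<Gamma> (f \<circ> word_map w)) (borel_on K) (word_map w)) B)"
proof -
  define \<tau> where "\<tau> A = \<rho> ^ n * (\<Sum>w\<in>words n. measure (\<Gamma> (f \<circ> word_map w)) (word_map w -` A \<inter> K))" for A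
  note fw = F_word_map[OF f]
  note fin = finite_energy_measure[OF fw]
  note sets = sets_energy_measure[OF fw]
  have sp: "space (\<Gamma> (f \<circ> word_map w)) = K" if "w \<in> words n" for w
    using sets_eq_imp_space_eq[OF sets[OF that]] by (simp add: space_borel_on)
  have pre: "word_map w -` A \<inter> K \<in> sets (borel_on K)" if "w \<in> words n" "A \<in> sets (borel_on K)" for w A
    using measurable_sets[OF measurable_word_map[OF that(1)] that(2)] by (simp add: space_borel_on)
  have wm: "word_map w \<in> measurable (\<Gamma> (f \<circ> word_map w)) (borel_on K)" if "w \<in> words n" for w
    using measurable_word_map[OF that] by (simp add: measurable_cong_sets[OF sets[OF that] refl])
  have "measure (\<Gamma> f) B = \<tau> B"
  proof (rule measure_extend_compact[OF finite_energy_measure[OF f] sets_energy_measure[OF f] _ _ _ B])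
    fix A assume A: "compact A" "A \<subseteq> K"
    let ?S = "\<lambda>k. \<Sum>v\<in>words (n + k). if word_map v ` K \<inter> A \<noteq> {} then weight f v else 0"
    have "(\<lambda>k. \<rho> ^ n * (\<Sum>w\<in>words n. \<Sum>v\<in>words k. if word_map v ` K \<inter> (word_map w -` A \<inter> K) \<noteq> {}
        then weight (f \<circ> word_map w) v else 0)) \<longlonglongrightarrow> \<tau> A"
      unfolding \<tau>_def
      by (intro tendsto_intros energy_measure_compact fw vimage_word_map_compact A) auto
    moreover have "\<rho> ^ n * (\<Sum>w\<in>words n. \<Sum>v\<in>words k. if word_map v ` K \<inter> (word_map w -` A \<inter> K) \<noteq> {}
        then weight (f \<circ> word_map w) v else 0) = ?S k" for k
    proof -
      have "?S k = (\<Sum>w\<in>words n. \<Sum>v\<in>words k. if word_map (w @ v) ` K \<inter> A \<noteq> {} then weight f (w @ v) else 0)"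
        unfolding words_eq_words_over by (rule sum_words_over_add)
      also have "\<dots> = (\<Sum>w\<in>words n. \<Sum>v\<in>words k. \<rho> ^ n * (if word_map v ` K \<inter> (word_map w -` A \<inter> K) \<noteq> {}
        then weight (f \<circ> word_map w) v else 0))"
      proof (intro sum.cong refl)
        fix w v assume wv: "w \<in> words n" "v \<in> words k"
        have "word_map (w @ v) ` K \<inter> A \<noteq> {} \<longleftrightarrow> word_map v ` K \<inter> (word_map w -` A \<inter> K) \<noteq> {}"
          using word_map_in_K[OF wv(2)] unfolding word_map_append comp_def by blast
        moreover have "length w = n" using wv by (simp add: words_def)
        ultimately show "(if word_map (w @ v) ` K \<inter> A \<noteq> {} then weight f (w @ v) else 0) =
            \<rho> ^ n * (if word_map v ` K \<inter> (word_map w -` A \<inter> K) \<noteq> {} then weight (f \<circ> word_map w) v else 0)"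
          by (simp add: weight_append)
      qed
      finally show ?thesis by (simp only: sum_distrib_left)
    qed
    moreover have "?S \<longlonglongrightarrow> measure (\<Gamma> f) A"
      using LIMSEQ_ignore_initial_segment[OF energy_measure_compact[OF f A], of n] by (simp add: add.commute)
    ultimately show "measure (\<Gamma> f) A = \<tau> A" by (simp add: LIMSEQ_unique)
  next
    fix A B assume AB: "A \<in> sets (borel_on K)" "B \<in> sets (borel_on K)" "A \<subseteq> B"
    show "\<tau> A \<le> \<tau> B"
      unfolding \<tau>_def using rho AB(3)
      by (intro mult_left_mono sum_mono finite_measure.finite_measure_mono fin)
        (auto simp: sets pre[OF _ AB(2)])
  next
    fix B assume B: "B \<in> sets (borel_on K)"
    have "measure (\<Gamma> (f \<circ> word_map w)) (word_map w -` (K - B) \<inter> K)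
        = measure (\<Gamma> (f \<circ> word_map w)) (word_map w -` K \<inter> K) - measure (\<Gamma> (f \<circ> word_map w)) (word_map w -` B \<inter> K)"
      if w: "w \<in> words n" for w
    proof -
      have "word_map w -` (K - B) \<inter> K = K - (word_map w -` B \<inter> K)" "word_map w -` K \<inter> K = K"
        using word_map_in_K[OF w] by blast+
      then show ?thesis
        using finite_measure.finite_measure_compl[OF fin[OF w], of "word_map w -` B \<inter> K"]
        by (simp add: sp[OF w] sets[OF w] pre[OF w B])
    qed
    then show "\<tau> (K - B) = \<tau> K - \<tau> B"
      by (simp add: \<tau>_def right_diff_distrib sum_subtractf)
  qed
  moreover have "emeasure (distr (\<Gamma> (f \<circ> word_map w)) (borel_on K) (word_map w)) B
      = ennreal (measure (\<Gamma> (f \<circ> word_map w)) (word_map w -` B \<inter> K))" if "w \<in> words n" for w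
    using B by (simp add: emeasure_distr[OF wm[OF that]] sp[OF that] finite_measure.emeasure_eq_measure[OF fin[OF that]])
  ultimately show ?thesis
    using rho by (simp add: finite_measure.emeasure_eq_measure[OF finite_energy_measure[OF f]] \<tau>_def
        ennreal_mult sum_nonneg)
qed

text \<open>The symmetry permutes the words of each length, and the weight of \<open>f\<close> at
  \<open>w\<close> is that of \<open>f \<circ> inv T\<close> at the permuted word; reindexing
  matches the approximating sums on compact sets.\<close>

lemma energy_measure_symmetry:
  assumes f: "f \<in> \<F>" and T: "T \<in> carpet_symmetries"
  shows "distr (\<Gamma> f) (borel_on K) T = \<Gamma> (f \<circ> inv T)"
proof -
  have lin: "linear T" using T by (simp add: carpet_symmetries_def)
  have contT: "continuous_on S T" for S
    by (rule linear_continuous_on) (use lin in \<open>simp add: linear_conv_bounded_linear\<close>)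
  have "T \<in> measurable (borel_on K) (borel_on K)"
    using symmetry_in_K[OF T]
    by (intro measurable_restrict_space2 borel_measurable_continuous_on_restrict contT)
      (auto simp: space_borel_on)
  then have measT: "T \<in> measurable (\<Gamma> f) (borel_on K)"
    by (simp add: measurable_cong_sets[OF sets_energy_measure[OF f] refl])
  have sp: "space (\<Gamma> f) = K"
    using sets_eq_imp_space_eq[OF sets_energy_measure[OF f]] by (simp add: space_borel_on)
  note F = F_symmetry[OF f symmetry_bij(2)[OF T]]
  obtain \<sigma> where \<sigma>: "bij_betw \<sigma> {1..8} {1..8}" "\<forall>n. \<forall>w\<in>words n. \<forall>z. T (word_map w z) = word_map (map \<sigma> w) (T z)"
    using carpet_symmetry_words[OF T] by (elim exE conjE)
  show ?thesis
  proof (rule measure_eqI_compact[OF finite_measure.finite_measure_distr[OF finite_energy_measure[OF f] measT]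
        _ finite_energy_measure[OF F] sets_energy_measure[OF F]])
    fix A assume A: "compact A" "A \<subseteq> K"
    have "closed (K \<inter> T -` A)"
      by (rule continuous_closed_preimage[OF contT closed_K compact_imp_closed[OF A(1)]])
    then have "compact (K \<inter> (K \<inter> T -` A))" by (rule compact_Int_closed[OF compact_K])
    then have pre: "compact (T -` A \<inter> K)" by (simp add: Int_commute)
    have "(\<Sum>w\<in>words n. if word_map w ` K \<inter> (T -` A \<inter> K) \<noteq> {} then weight f w else 0)
        = (\<Sum>w\<in>words n. if word_map w ` K \<inter> A \<noteq> {} then weight (f \<circ> inv T) w else 0)" for n
    proof -
      have bij: "bij_betw (map \<sigma>) (words n) (words n)"
        unfolding words_eq_words_over by (rule bij_betw_map_words_over[OF \<sigma>(1)])
      have "(\<Sum>w\<in>words n. if word_map w ` K \<inter> A \<noteq> {} then weight (f \<circ> inv T) w else 0)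
          = (\<Sum>w\<in>words n. if word_map (map \<sigma> w) ` K \<inter> A \<noteq> {} then weight (f \<circ> inv T) (map \<sigma> w) else 0)"
        by (rule sum.reindex_bij_betw[OF bij, symmetric])
      also have "\<dots> = (\<Sum>w\<in>words n. if word_map w ` K \<inter> (T -` A \<inter> K) \<noteq> {} then weight f w else 0)"
      proof (rule sum.cong[OF refl])
        fix w assume w: "w \<in> words n"
        have Tw: "T (word_map w z) = word_map (map \<sigma> w) (T z)" for z using \<sigma>(2) w by blast
        have w': "map \<sigma> w \<in> words n" by (rule bij_betw_apply[OF bij w])
        have img: "word_map (map \<sigma> w) ` K = T ` word_map w ` K"
          by (subst symmetry_image_K[OF T, symmetric]) (simp only: image_image Tw)
        have "word_map w ` K \<subseteq> K" using word_map_in_K[OF w] by (rule image_subsetI)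
        then have "word_map (map \<sigma> w) ` K \<inter> A \<noteq> {} \<longleftrightarrow> word_map w ` K \<inter> (T -` A \<inter> K) \<noteq> {}"
          unfolding img by blast
        moreover have "f \<circ> word_map w = f \<circ> inv T \<circ> word_map (map \<sigma> w) \<circ> T"
          by (simp only: fun_eq_iff comp_apply Tw[symmetric] inv_f_f[OF bij_is_inj[OF symmetry_bij(1)[OF T]]]) simp
        then have "weight (f \<circ> inv T) (map \<sigma> w) = weight f w"
          using E_symmetry[OF F_word_map[OF F w'] T] by (simp add: weight_def)
        ultimately show "(if word_map (map \<sigma> w) ` K \<inter> A \<noteq> {} then weight (f \<circ> inv T) (map \<sigma> w) else 0)
            = (if word_map w ` K \<inter> (T -` A \<inter> K) \<noteq> {} then weight f w else 0)" by simp
      qed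
      finally show ?thesis by simp
    qed
    then have "measure (\<Gamma> f) (T -` A \<inter> K) = measure (\<Gamma> (f \<circ> inv T)) A"
      using LIMSEQ_unique[OF energy_measure_compact[OF f pre]] energy_measure_compact[OF F A] by simp
    then show "measure (distr (\<Gamma> f) (borel_on K) T) A = measure (\<Gamma> (f \<circ> inv T)) A"
      by (simp add: measure_distr[OF measT compact_sets[OF A]] sp)
  qed simp
qed

end

context carpet_energy
begin

subsection \<open>Chain rule and locality\<close>

lemma N_lipschitz:
  assumes g: "g \<in> \<F>" and L: "0 < L" and R: "L-lipschitz_on UNIV R"
  shows "R \<circ> g \<in> \<F>" "N (R \<circ> g) \<le> L * N g"
proof -
  define \<phi> where "\<phi> t = R t / L" for t
  have \<phi>: "1-lipschitz_on UNIV \<phi>"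
    using R L unfolding lipschitz_on_def \<phi>_def
    by (auto simp: dist_real_def divide_le_eq mult.commute simp flip: diff_divide_distrib)
  have eq: "(\<lambda>x. L * (\<phi> \<circ> g) x) = R \<circ> g" using L by (simp add: \<phi>_def fun_eq_iff)
  show "R \<circ> g \<in> \<F>" using F_mult[OF F_lipschitz[OF g \<phi>], of L] unfolding eq .
  have "N (\<phi> \<circ> g) \<le> N g"
    unfolding N_def using E_lipschitz[OF g \<phi>] E_nonneg[OF F_lipschitz[OF g \<phi>]] p by (intro powr_mono2) auto
  then have "L * N (\<phi> \<circ> g) \<le> L * N g" using L by simp
  moreover have "N (R \<circ> g) = L * N (\<phi> \<circ> g)" using N_mult[OF F_lipschitz[OF g \<phi>], of L] L unfolding eq by simp
  ultimately show "N (R \<circ> g) \<le> L * N g" by simp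
qed

text \<open>Only the range of \<open>g\<close> matters: precomposition with the clamping map, which
  is 1-Lipschitz, extends \<open>R\<close> to the line with the same constant.\<close>

lemma N_lipschitz_on:
  assumes g: "g \<in> \<F>" and L: "0 < L" and R: "L-lipschitz_on {a..b} R"
    and range: "\<And>x. x \<in> K \<Longrightarrow> g x \<in> {a..b}"
  shows "R \<circ> g \<in> \<F>" "N (R \<circ> g) \<le> L * N g"
proof -
  define clamp where "clamp t = max a (min b t)" for t :: real
  have "a \<le> b" using range[OF base_in_K] by simp
  then have "L-lipschitz_on UNIV (R \<circ> clamp)"
    using R L unfolding lipschitz_on_def
  proof (intro conjI ballI)
    fix s t :: real
    have "dist (R (clamp s)) (R (clamp t)) \<le> L * dist (clamp s) (clamp t)"
      using R \<open>a \<le> b\<close> unfolding lipschitz_on_def clamp_def by (simp add: max_def min_def)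
    also have "dist (clamp s) (clamp t) \<le> dist s t"
      using \<open>a \<le> b\<close> by (auto simp: clamp_def dist_real_def max_def min_def)
    finally show "dist ((R \<circ> clamp) s) ((R \<circ> clamp) t) \<le> L * dist s t" using L by simp
  qed simp
  note l = N_lipschitz[OF g L this]
  have eq: "(R \<circ> clamp \<circ> g) x = (R \<circ> g) x" if "x \<in> K" for x
    using range[OF that] by (simp add: clamp_def)
  show "R \<circ> g \<in> \<F>" by (rule F_cong[OF l(1) eq])
  have "N (R \<circ> clamp \<circ> g) = N (R \<circ> g)" by (rule N_cong[OF l(1) eq])
  with l(2) show "N (R \<circ> g) \<le> L * N g" by (simp only:)
qed

lemma lipschitz_on_interval:
  assumes "\<And>t. (R has_field_derivative R' t) (at t)" "\<And>t. t \<in> {a..b} \<Longrightarrow> \<bar>R' t\<bar> \<le> L" "0 \<le> L"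
  shows "L-lipschitz_on {a..b::real} R"
proof (rule lipschitz_onI)
  fix s t assume "s \<in> {a..b}" "t \<in> {a..b}"
  then have "norm (R s - R t) \<le> L * norm (s - t)"
    using assms by (intro field_differentiable_bound[of "{a..b}" R R']) (auto intro: DERIV_subset)
  then show "dist (R s) (R t) \<le> L * dist s t" by (simp add: dist_norm)
qed (rule assms)

context
  fixes f :: "plane \<Rightarrow> real" and \<Psi> D :: "real \<Rightarrow> real"
  assumes f: "f \<in> \<F>C" and deriv: "\<And>t. (\<Psi> has_field_derivative D t) (at t)"
    and D: "continuous_on UNIV D"
begin

lemma range_bounds:
  obtains a b where "\<And>x. x \<in> K \<Longrightarrow> f x \<in> {a..b}"
proof -
  have "bounded (f ` K)" by (intro compact_imp_bounded compact_continuous_image FC_cont f compact_K)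
  then obtain B where "\<And>x. x \<in> K \<Longrightarrow> \<bar>f x\<bar> \<le> B" unfolding bounded_iff real_norm_def by blast
  then show ?thesis by (intro that[of "-B" B]) (force simp: abs_le_iff)
qed

lemma derivative_bound:
  obtains M where "0 < M" "\<And>t. t \<in> {a..b} \<Longrightarrow> \<bar>D t\<bar> \<le> M"
proof -
  have "bounded (D ` {a..b})"
    by (intro compact_imp_bounded compact_continuous_image continuous_on_subset[OF D]) auto
  then obtain B where "\<And>t. t \<in> {a..b} \<Longrightarrow> \<bar>D t\<bar> \<le> B" unfolding bounded_iff real_norm_def by blast
  then show ?thesis by (intro that[of "max B 1"]) (auto simp: le_max_iff_disj)
qed

lemma chain_in_F: "\<Psi> \<circ> f \<in> \<F>"
proof -
  obtain a b where ab: "\<And>x. x \<in> K \<Longrightarrow> f x \<in> {a..b}" using range_bounds by blast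
  obtain M where M: "0 < M" "\<And>t. t \<in> {a..b} \<Longrightarrow> \<bar>D t\<bar> \<le> M" using derivative_bound by blast
  show ?thesis
    by (rule N_lipschitz_on(1)[OF FC_F[OF f] M(1) lipschitz_on_interval[OF deriv M(2)] ab]) (use M in auto)
qed

text \<open>On a small cell \<open>\<Psi> \<circ> f\<close> differs from a linear function of \<open>f\<close> by \<open>R \<circ> f\<close>, where \<open>R\<close> has a small
  Lipschitz constant.\<close>

lemma chain_cell:
  assumes e: "0 < e"
  shows "\<exists>n0. \<forall>n\<ge>n0. \<forall>w\<in>words n. \<forall>x\<in>K.
    \<bar>N (\<Psi> \<circ> f \<circ> word_map w) - \<bar>D (f (word_map w x))\<bar> * N (f \<circ> word_map w)\<bar> \<le> e * N (f \<circ> word_map w)"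
proof -
  obtain a b where ab: "\<And>x. x \<in> K \<Longrightarrow> f x \<in> {a..b}" using range_bounds by blast
  have "uniformly_continuous_on {a..b} D"
    by (intro compact_uniformly_continuous continuous_on_subset[OF D]) auto
  then obtain d where d: "0 < d" "\<And>s t. s \<in> {a..b} \<Longrightarrow> t \<in> {a..b} \<Longrightarrow> dist s t < d \<Longrightarrow> dist (D s) (D t) < e"
    using e unfolding uniformly_continuous_on_def by (metis dist_commute)
  have "0 < d / 2" using d(1) by simp
  then obtain r where r: "0 < r" "\<And>x y. x \<in> K \<Longrightarrow> y \<in> K \<Longrightarrow> dist x y < r \<Longrightarrow> dist (f x) (f y) < d / 2"
    using compact_uniformly_continuous[OF FC_cont[OF f] compact_K] unfolding uniformly_continuous_on_def
    by (metis dist_commute)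
  have "(\<lambda>n. (1/3) ^ n * diameter K) \<longlonglongrightarrow> 0" by real_asymp
  from order_tendstoD(2)[OF this r(1)] obtain n0 where n0: "\<And>n. n \<ge> n0 \<Longrightarrow> (1/3) ^ n * diameter K < r"
    by (auto simp: eventually_sequentially)
  have "\<bar>N (\<Psi> \<circ> f \<circ> word_map w) - \<bar>D (f (word_map w x))\<bar> * N (f \<circ> word_map w)\<bar> \<le> e * N (f \<circ> word_map w)"
    if "n \<ge> n0" and w: "w \<in> words n" and x: "x \<in> K" for n w x
  proof -
    define t where "t = f (word_map w x)"
    define c where "c = D t"
    define R where "R s = \<Psi> s - c * s" for s
    \<comment> \<open>On this interval around \<open>t\<close> the derivative \<open>D s - c\<close>
      of \<open>R\<close> is at most \<open>e\<close>; the radius \<open>d / 2\<close> keeps the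
      closed interval within distance less than \<open>d\<close> of \<open>t\<close>.\<close>
    define a' where "a' = max a (t - d / 2)"
    define b' where "b' = min b (t + d / 2)"
    note g = F_word_map[OF FC_F[OF f] w]
    have t: "t \<in> {a..b}" unfolding t_def by (intro ab word_map_in_K[OF w] x)
    have "e-lipschitz_on {a'..b'} R"
    proof (rule lipschitz_on_interval)
      show "(R has_field_derivative (D s - c)) (at s)" for s
        unfolding R_def by (auto intro!: derivative_eq_intros deriv)
      show "\<bar>D s - c\<bar> \<le> e" if "s \<in> {a'..b'}" for s
      proof -
        have "s \<in> {a..b}" "dist s t < d" using that d(1) by (auto simp: a'_def b'_def dist_real_def)
        from d(2)[OF this(1) t this(2)] show ?thesis by (simp add: c_def dist_real_def)
      qed
    qed (use e in simp)
    moreover have "(f \<circ> word_map w) y \<in> {a'..b'}" if "y \<in> K" for y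
    proof -
      have "dist y x \<le> diameter K"
        using that x compact_imp_bounded[OF compact_K] by (intro diameter_bounded_bound)
      then have "dist (word_map w y) (word_map w x) \<le> (1/3) ^ n * diameter K"
        using w by (simp add: dist_word_map words_def)
      then have "dist (word_map w y) (word_map w x) < r" using n0[OF \<open>n \<ge> n0\<close>] by linarith
      from r(2)[OF word_map_in_K[OF w that] word_map_in_K[OF w x] this]
      have "\<bar>f (word_map w y) - t\<bar> < d / 2" by (simp add: t_def dist_real_def)
      moreover have "f (word_map w y) \<in> {a..b}" by (intro ab word_map_in_K[OF w] that)
      moreover from calculation have "t - d / 2 \<le> f (word_map w y)" "f (word_map w y) \<le> t + d / 2" by linarith+
      ultimately show ?thesis unfolding a'_def b'_def by simp
    qed
    ultimately have R: "R \<circ> (f \<circ> word_map w) \<in> \<F>" "N (R \<circ> (f \<circ> word_map w)) \<le> e * N (f \<circ> word_map w)"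
      using N_lipschitz_on[OF g e] by blast+
    have cg: "(\<lambda>z. c * (f \<circ> word_map w) z) \<in> \<F>" "N (\<lambda>z. c * (f \<circ> word_map w) z) = \<bar>c\<bar> * N (f \<circ> word_map w)"
      using F_mult[OF g] N_mult[OF g] by blast+
    have eq: "\<Psi> \<circ> f \<circ> word_map w = (\<lambda>z. c * (f \<circ> word_map w) z + (R \<circ> (f \<circ> word_map w)) z)"
      "(\<lambda>z. c * (f \<circ> word_map w) z - (\<Psi> \<circ> f \<circ> word_map w) z) = (\<lambda>z. (- 1) * (R \<circ> (f \<circ> word_map w)) z)"
      by (auto simp: R_def)
    have "N (\<Psi> \<circ> f \<circ> word_map w) \<le> \<bar>c\<bar> * N (f \<circ> word_map w) + N (R \<circ> (f \<circ> word_map w))"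
      unfolding eq(1) using N_add[OF cg(1) R(1)] cg(2) by simp
    moreover have "\<bar>c\<bar> * N (f \<circ> word_map w) \<le> N (\<Psi> \<circ> f \<circ> word_map w) + N (R \<circ> (f \<circ> word_map w))"
      using N_le_add_diff[OF cg(1) F_word_map[OF chain_in_F w]] N_mult[OF R(1), of "-1"]
      unfolding cg(2) eq(2) by simp
    ultimately show ?thesis using R(2) unfolding c_def t_def by linarith
  qed
  then show ?thesis by blast
qed

text \<open>Passage from \<open>N\<close> to \<open>p\<close>-th powers. After division by
  \<open>N (f \<circ> word_map w)\<close> the estimate of \<open>chain_cell\<close> becomes one
  between bounded numbers, to which uniform continuity of the power applies. The error is a multiple
  of \<open>weight f w\<close>, so that its sum over all cells is at most
  \<open>e * E f\<close>.\<close>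

lemma chain_weight:
  assumes e: "0 < e"
  shows "\<exists>n0. \<forall>n\<ge>n0. \<forall>w\<in>words n.
    \<bar>weight (\<Psi> \<circ> f) w - \<bar>D (f (word_map w base))\<bar> powr p * weight f w\<bar> \<le> e * weight f w"
proof -
  obtain a b where ab: "\<And>x. x \<in> K \<Longrightarrow> f x \<in> {a..b}" using range_bounds by blast
  obtain M where M: "0 < M" "\<And>t. t \<in> {a..b} \<Longrightarrow> \<bar>D t\<bar> \<le> M" using derivative_bound by blast
  \<comment> \<open>The quotient \<open>s\<close> below differs from
    \<open>\<bar>D (f (word_map w base))\<bar> \<le> M\<close> by at most
    \<open>d' \<le> 1\<close>.\<close>
  have "uniformly_continuous_on {0..M + 1} (\<lambda>s. s powr p)"
    using p by (intro compact_uniformly_continuous continuous_on_powr' continuous_intros) auto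
  then obtain d where d: "0 < d" "\<And>s t. s \<in> {0..M + 1} \<Longrightarrow> t \<in> {0..M + 1} \<Longrightarrow> dist s t < d \<Longrightarrow> dist (s powr p) (t powr p) < e"
    using e unfolding uniformly_continuous_on_def by (metis dist_commute)
  define d' where "d' = min 1 (d / 2)"
  have d': "0 < d'" "d' \<le> 1" "d' < d" using d(1) by (auto simp: d'_def)
  from chain_cell[OF d'(1)] obtain n0 where n0: "\<And>n w x. n \<ge> n0 \<Longrightarrow> w \<in> words n \<Longrightarrow> x \<in> K \<Longrightarrow>
    \<bar>N (\<Psi> \<circ> f \<circ> word_map w) - \<bar>D (f (word_map w x))\<bar> * N (f \<circ> word_map w)\<bar> \<le> d' * N (f \<circ> word_map w)"
    by blast
  have "\<bar>weight (\<Psi> \<circ> f) w - \<bar>D (f (word_map w base))\<bar> powr p * weight f w\<bar> \<le> e * weight f w"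
    if "n \<ge> n0" and w: "w \<in> words n" for n w
  proof -
    let ?c = "\<bar>D (f (word_map w base))\<bar>"
    define u where "u = N (f \<circ> word_map w)"
    define v where "v = N (\<Psi> \<circ> f \<circ> word_map w)"
    have c: "?c \<le> M" by (intro M(2) ab word_map_in_K[OF w] base_in_K)
    have uv: "\<bar>v - ?c * u\<bar> \<le> d' * u" "0 \<le> u" "0 \<le> v"
      unfolding u_def v_def using n0[OF that base_in_K] by (auto simp: N_nonneg)
    have "\<bar>v powr p - ?c powr p * u powr p\<bar> \<le> e * u powr p"
    proof (cases "u = 0")
      case True
      then show ?thesis using uv p by simp
    next
      case False
      then have u: "0 < u" using uv by simp
      define s where "s = v / u"
      have v: "v = s * u" using u by (simp add: s_def)
      have "\<bar>s - ?c\<bar> * u \<le> d' * u" using uv(1) u unfolding v by (simp add: abs_mult flip: left_diff_distrib)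
      then have sc: "\<bar>s - ?c\<bar> \<le> d'" using u by simp
      have s: "0 \<le> s" using uv u by (simp add: s_def)
      have "dist (s powr p) (?c powr p) < e"
        using s sc c d' by (intro d(2)) (auto simp: dist_real_def)
      then have "\<bar>s powr p - ?c powr p\<bar> * u powr p \<le> e * u powr p"
        by (intro mult_right_mono) (auto simp: dist_real_def)
      moreover have "v powr p - ?c powr p * u powr p = (s powr p - ?c powr p) * u powr p"
        unfolding v using s u by (simp add: powr_mult left_diff_distrib)
      ultimately show ?thesis by (simp add: abs_mult)
    qed
    then have le: "\<rho> ^ n * \<bar>v powr p - ?c powr p * u powr p\<bar> \<le> \<rho> ^ n * (e * u powr p)" using rho by simp
    have W: "weight f w = \<rho> ^ n * u powr p" "weight (\<Psi> \<circ> f) w = \<rho> ^ n * v powr p"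
      using w E_eq_N[OF F_word_map[OF FC_F[OF f] w]] E_eq_N[OF F_word_map[OF chain_in_F w]]
      by (simp_all only: weight_def u_def v_def) (simp_all add: words_def)
    have pull: "\<bar>\<rho> ^ n * x - c * (\<rho> ^ n * y)\<bar> = \<rho> ^ n * \<bar>x - c * y\<bar>" for x y c
    proof -
      have "\<rho> ^ n * x - c * (\<rho> ^ n * y) = \<rho> ^ n * (x - c * y)" by (simp add: algebra_simps)
      then show ?thesis using rho by (simp add: abs_mult)
    qed
    show ?thesis unfolding W pull mult.left_commute[of e "\<rho> ^ n"] by (rule le)
  qed
  then show ?thesis by blast
qed

text \<open>The weights of \<open>\<Psi> \<circ> f\<close> are replaced by Riemann-type sums with
  the factor taken at one point of each cell; these converge to the integral by the construction of
  the measure.\<close>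

lemma chain_integral:
  assumes A: "compact A" "A \<subseteq> K"
  shows "measure (\<Gamma> (\<Psi> \<circ> f)) A = (\<integral>x. indicator A x * \<bar>D (f x)\<bar> powr p \<partial>\<Gamma> f)"
proof -
  note fF = FC_F[OF f]
  let ?S = "\<lambda>n. {w\<in>words n. word_map w ` K \<inter> A \<noteq> {}}"
  let ?d = "\<lambda>n. (\<Sum>w\<in>?S n. weight (\<Psi> \<circ> f) w) - (\<Sum>w\<in>?S n. \<bar>D (f (word_map w base))\<bar> powr p * weight f w)"
  have "continuous_on K (\<lambda>x. \<bar>D (f x)\<bar> powr p)"
    using p by (intro continuous_on_powr' continuous_on_rabs continuous_on_const
        continuous_on_compose2[OF D FC_cont[OF f]]) auto
  from cell_measure_integral[OF cell_weight_weight[OF fF] A this]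
  have "(\<lambda>n. \<Sum>w\<in>?S n. \<bar>D (f (word_map w base))\<bar> powr p * weight f w)
      \<longlonglongrightarrow> (\<integral>x. indicator A x * \<bar>D (f x)\<bar> powr p \<partial>\<Gamma> f)" unfolding energy_measure_def .
  moreover have "?d \<longlonglongrightarrow> 0"
  proof (rule tendstoI)
    fix e :: real assume e: "0 < e"
    define e' where "e' = e / (E f + 1)"
    have Ef: "0 \<le> E f" by (rule E_nonneg[OF fF])
    have e': "0 < e'" "e' * E f < e" using e Ef by (auto simp: e'_def field_simps)
    from chain_weight[OF e'(1)] obtain n0 where n0: "\<And>n w. n \<ge> n0 \<Longrightarrow> w \<in> words n \<Longrightarrow>
      \<bar>weight (\<Psi> \<circ> f) w - \<bar>D (f (word_map w base))\<bar> powr p * weight f w\<bar> \<le> e' * weight f w" by blast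
    have "dist (?d n) 0 < e" if "n \<ge> n0" for n
    proof -
      have "\<bar>?d n\<bar> \<le> (\<Sum>w\<in>?S n. \<bar>weight (\<Psi> \<circ> f) w - \<bar>D (f (word_map w base))\<bar> powr p * weight f w\<bar>)"
        unfolding sum_subtractf[symmetric] by (rule sum_abs)
      also have "\<dots> \<le> (\<Sum>w\<in>?S n. e' * weight f w)" using n0[OF that] by (intro sum_mono) blast
      also have "\<dots> \<le> (\<Sum>w\<in>words n. e' * weight f w)"
        using e' weight_nonneg'[OF fF] finite_words by (intro sum_mono2) auto
      also have "\<dots> = e' * E f"
        using weight_words[OF fF, of "[]" 0 n] by (simp add: sum_distrib_left[symmetric] words_eq_words_over weight_def)
      finally show ?thesis using e' by (simp add: dist_real_def)
    qed
    then show "\<forall>\<^sub>F n in sequentially. dist (?d n) 0 < e" unfolding eventually_sequentially by blast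
  qed
  ultimately have "(\<lambda>n. (\<Sum>w\<in>?S n. \<bar>D (f (word_map w base))\<bar> powr p * weight f w) + ?d n)
      \<longlonglongrightarrow> (\<integral>x. indicator A x * \<bar>D (f x)\<bar> powr p \<partial>\<Gamma> f) + 0" by (rule tendsto_add)
  then have "(\<lambda>n. \<Sum>w\<in>?S n. weight (\<Psi> \<circ> f) w) \<longlonglongrightarrow> (\<integral>x. indicator A x * \<bar>D (f x)\<bar> powr p \<partial>\<Gamma> f)" by simp
  from LIMSEQ_unique[OF cell_measure_compact[OF cell_weight_weight[OF chain_in_F] A] this]
  show ?thesis unfolding energy_measure_def .
qed

lemma chain_rule: "\<Gamma> (\<Psi> \<circ> f) = density (\<Gamma> f) (\<lambda>x. ennreal (\<bar>D (f x)\<bar> powr p))"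
proof -
  note fF = FC_F[OF f]
  interpret finite_measure "\<Gamma> f" by (rule finite_energy_measure[OF fF])
  let ?h = "\<lambda>x. \<bar>D (f x)\<bar> powr p"
  have sp: "space (\<Gamma> f) = K"
    using sets_eq_imp_space_eq[OF sets_energy_measure[OF fF]] by (simp add: space_borel_on)
  have "continuous_on K ?h"
    using p by (intro continuous_on_powr' continuous_on_rabs continuous_on_const
        continuous_on_compose2[OF D FC_cont[OF f]]) auto
  then have "?h \<in> borel_measurable (borel_on K)" by (rule borel_measurable_continuous_on_restrict)
  then have meas [measurable]: "?h \<in> borel_measurable (\<Gamma> f)"
    by (simp add: measurable_cong_sets[OF sets_energy_measure[OF fF] refl])
  obtain a b where ab: "\<And>x. x \<in> K \<Longrightarrow> f x \<in> {a..b}" using range_bounds by blast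
  obtain M where M: "0 < M" "\<And>t. t \<in> {a..b} \<Longrightarrow> \<bar>D t\<bar> \<le> M" using derivative_bound by blast
  have int: "integrable (\<Gamma> f) (\<lambda>x. indicator A x * ?h x)" if "A \<in> sets (\<Gamma> f)" for A
  proof (rule integrable_const_bound)
    show "AE x in \<Gamma> f. norm (indicator A x * ?h x) \<le> M powr p"
      using ab M p by (intro AE_I2) (auto simp: sp indicator_def intro!: powr_mono2)
  qed (use that in measurable)
  have em: "emeasure (density (\<Gamma> f) ?h) A = ennreal (\<integral>x. indicator A x * ?h x \<partial>\<Gamma> f)"
    if "A \<in> sets (\<Gamma> f)" for A
  proof -
    have "emeasure (density (\<Gamma> f) ?h) A = (\<integral>\<^sup>+x. ennreal (indicator A x * ?h x) \<partial>\<Gamma> f)"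
      using that by (subst emeasure_density) (auto intro!: nn_integral_cong simp: indicator_def)
    also have "\<dots> = ennreal (\<integral>x. indicator A x * ?h x \<partial>\<Gamma> f)"
      by (rule nn_integral_eq_integral[OF int[OF that]]) auto
    finally show ?thesis .
  qed
  show ?thesis
  proof (rule measure_eqI_compact[OF finite_energy_measure[OF chain_in_F] sets_energy_measure[OF chain_in_F]])
    show "finite_measure (density (\<Gamma> f) ?h)"
      using em[of "space (\<Gamma> f)"] by (intro finite_measureI) simp
    show "sets (density (\<Gamma> f) ?h) = sets (borel_on K)" by (simp add: sets_energy_measure[OF fF])
    fix A assume A: "compact A" "A \<subseteq> K"
    have "A \<in> sets (\<Gamma> f)" using compact_sets[OF A] by (simp add: sets_energy_measure[OF fF])
    then show "measure (\<Gamma> (\<Psi> \<circ> f)) A = measure (density (\<Gamma> f) ?h) A"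
      unfolding measure_def[of "density _ _"] em[OF \<open>A \<in> sets (\<Gamma> f)\<close>] chain_integral[OF A]
      by (simp add: integral_nonneg_AE)
  qed
qed

end

text \<open>The functions \<open>\<Theta> j\<close> below converge uniformly to the identity while their derivatives converge to
  the indicator of \<open>h \<noteq> a\<close>; lower semicontinuity shows that no energy is lost on \<open>h = a\<close>.\<close>

lemma energy_measure_level_set:
  assumes h: "h \<in> \<F>C"
  shows "measure (\<Gamma> h) {x\<in>K. h x = a} = 0"
proof -
  note hF = FC_F[OF h]
  interpret finite_measure "\<Gamma> h" by (rule finite_energy_measure[OF hF])
  let ?Z = "{x\<in>K. h x = a}"
  define \<Theta> where "\<Theta> j t = t - arctan (real (Suc j) * (t - a)) / real (Suc j)" for j t
  define D where "D j t = 1 - 1 / (1 + (real (Suc j) * (t - a))\<^sup>2)" for j t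
  have sp: "space (\<Gamma> h) = K"
    using sets_eq_imp_space_eq[OF sets_energy_measure[OF hF]] by (simp add: space_borel_on)
  have pos: "0 < 1 + (s::real)\<^sup>2" for s by (rule add_pos_nonneg) auto
  have D01: "0 \<le> D j t" "D j t \<le> 1" for j t
    unfolding D_def using pos[of "real (Suc j) * (t - a)"] by (auto simp: field_simps)
  have "((\<lambda>t. t - arctan (k * (t - a)) / k) has_field_derivative 1 - 1 / (1 + (k * (t - a))\<^sup>2)) (at t)"
    if "k \<noteq> 0" for k t
    using that by (auto intro!: derivative_eq_intros simp: inverse_eq_divide)
  then have deriv: "(\<Theta> j has_field_derivative D j t) (at t)" for j t
    unfolding \<Theta>_def D_def by simp
  have Dcont: "continuous_on UNIV (D j)" for j
    unfolding D_def using pos by (intro continuous_intros) (metis less_irrefl)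
  note \<Theta>F = chain_in_F[OF h deriv Dcont]
  have Zc: "compact ?Z"
  proof -
    have "closed (K \<inter> h -` {a})" by (rule continuous_closed_preimage[OF FC_cont[OF h] closed_K]) simp
    moreover have "K \<inter> h -` {a} = ?Z" by auto
    ultimately show ?thesis using compact_Int_closed[OF compact_K, of ?Z] by (simp add: Int_absorb1)
  qed
  then have Z: "?Z \<in> sets (\<Gamma> h)" using compact_sets[of ?Z] by (simp add: sets_energy_measure[OF hF])
  have hm: "h \<in> borel_measurable (\<Gamma> h)"
    using borel_measurable_continuous_on_restrict[OF FC_cont[OF h]]
    by (simp add: measurable_cong_sets[OF sets_energy_measure[OF hF] refl])
  \<comment> \<open>By the chain rule these energies are the integrals of
    \<open>\<bar>D j (h x)\<bar> powr p\<close>, whose integrands are bounded by 1, vanish on the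
    level set and tend to 1 elsewhere.\<close>
  have "(\<lambda>j. E (\<Theta> j \<circ> h)) \<longlonglongrightarrow> E h - measure (\<Gamma> h) ?Z"
  proof -
    have "(\<lambda>j. \<integral>x. indicator K x * \<bar>D j (h x)\<bar> powr p \<partial>\<Gamma> h) \<longlonglongrightarrow> (\<integral>x. 1 - indicator ?Z x \<partial>\<Gamma> h)"
    proof (rule integral_dominated_convergence)
      show "(\<lambda>x. 1 - indicator ?Z x :: real) \<in> borel_measurable (\<Gamma> h)" using Z by measurable
      have "K \<in> sets (\<Gamma> h)" using sets.top[of "\<Gamma> h"] by (simp add: sp)
      then show "(\<lambda>x. indicator K x * \<bar>D j (h x)\<bar> powr p) \<in> borel_measurable (\<Gamma> h)" for j
        unfolding D_def using hm by measurable
      show "integrable (\<Gamma> h) (\<lambda>_. 1::real)" by simp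
      show "AE x in \<Gamma> h. norm (indicator K x * \<bar>D j (h x)\<bar> powr p) \<le> 1" for j
        using D01 p powr_mono2[of p "D j (h x)" 1 for x] by (intro AE_I2) (auto simp: sp)
      show "AE x in \<Gamma> h. (\<lambda>j. indicator K x * \<bar>D j (h x)\<bar> powr p) \<longlonglongrightarrow> 1 - indicator ?Z x"
      proof (intro AE_I2)
        fix x assume "x \<in> space (\<Gamma> h)"
        then have x: "x \<in> K" by (simp add: sp)
        show "(\<lambda>j. indicator K x * \<bar>D j (h x)\<bar> powr p) \<longlonglongrightarrow> 1 - indicator ?Z x"
        proof (cases "h x = a")
          case True
          then show ?thesis using x p by (simp add: D_def)
        next
          case False
          define y where "y = h x - a"
          have "(\<lambda>j. 1 - 1 / (1 + (real (Suc j) * y)\<^sup>2)) \<longlonglongrightarrow> 1"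
          proof -
            have y2: "0 < y\<^sup>2" using False by (simp add: y_def)
            have "(\<lambda>j. 1 - 1 / (1 + (real (Suc j))\<^sup>2 * y\<^sup>2)) \<longlonglongrightarrow> 1" using y2 by real_asymp
            then show ?thesis by (simp add: power_mult_distrib)
          qed
          then have "(\<lambda>j. D j (h x)) \<longlonglongrightarrow> 1" by (simp add: D_def y_def)
          then have "(\<lambda>j. \<bar>D j (h x)\<bar> powr p) \<longlonglongrightarrow> \<bar>1\<bar> powr p" by (intro tendsto_intros) auto
          then show ?thesis using x False by simp
        qed
      qed
    qed
    moreover have "(\<integral>x. indicator K x * \<bar>D j (h x)\<bar> powr p \<partial>\<Gamma> h) = E (\<Theta> j \<circ> h)" for j
      using chain_integral[OF h deriv Dcont compact_K subset_refl, of j] energy_measure_total[OF \<Theta>F, of j] by simp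
    moreover have "(\<integral>x. 1 - indicator ?Z x \<partial>\<Gamma> h) = E h - measure (\<Gamma> h) ?Z"
      using Z emeasure_finite[of ?Z] energy_measure_total[OF hF]
      by (subst Bochner_Integration.integral_diff) (auto simp: sp sets.Int_space_eq2 less_top[symmetric] Int_absorb2)
    ultimately show ?thesis by simp
  qed
  note E_lim = this
  have lim: "\<forall>\<^sub>F j in sequentially. E (\<Theta> j \<circ> h) \<le> E h - measure (\<Gamma> h) ?Z + e" if "0 < e" for e
  proof -
    have "\<forall>\<^sub>F j in sequentially. E (\<Theta> j \<circ> h) < E h - measure (\<Gamma> h) ?Z + e"
      by (rule order_tendstoD(2)[OF E_lim]) (use that in simp)
    then show ?thesis by (rule eventually_mono) (rule less_imp_le)
  qed
  have unif: "uniformly_to (\<lambda>j. \<Theta> j \<circ> h) h"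
    unfolding uniformly_to_def
  proof (intro allI impI)
    fix e :: real assume e: "0 < e"
    have "(\<lambda>j. 2 / real (Suc j)) \<longlonglongrightarrow> 0" by real_asymp
    from order_tendstoD(2)[OF this e]
    show "\<forall>\<^sub>F j in sequentially. \<forall>x\<in>K. \<bar>(\<Theta> j \<circ> h) x - h x\<bar> \<le> e"
    proof eventually_elim
      case (elim j)
      have "\<bar>arctan s\<bar> \<le> 2" for s using arctan_bounded[of s] pi_less_4 by linarith
      then have "\<bar>arctan s\<bar> / real (Suc j) \<le> 2 / real (Suc j)" for s by (intro divide_right_mono) auto
      then have "\<bar>(\<Theta> j \<circ> h) x - h x\<bar> \<le> 2 / real (Suc j)" for x
        by (simp add: \<Theta>_def abs_divide del: of_nat_Suc)
      then show ?case using elim by (meson less_imp_le order_trans)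
    qed
  qed
  have "E h \<le> E h - measure (\<Gamma> h) ?Z + e" if "0 < e" for e
    by (rule energy_lsc[OF \<Theta>F hF unif lim[OF that]])
  from this[of "measure (\<Gamma> h) ?Z / 2"] measure_nonneg[of "\<Gamma> h" ?Z] show ?thesis
    by (cases "measure (\<Gamma> h) ?Z = 0") auto
qed

text \<open>\<open>A\<close> lies in a level set of \<open>f - g\<close>, where the latter has no
  energy. In the linear bound for \<open>f = g + (f - g)\<close> only the term of \<open>g\<close>
  remains, and its factor tends to 1 as \<open>l\<close> does. Exchanging \<open>f\<close> and
  \<open>g\<close> gives equality.\<close>

lemma energy_measure_local_le:
  assumes f: "f \<in> \<F>C" and g: "g \<in> \<F>C" and A: "A \<in> sets (borel_on K)" and eq: "\<forall>x\<in>A. f x - g x = a"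
  shows "measure (\<Gamma> f) A \<le> measure (\<Gamma> g) A"
proof -
  note fF = FC_F[OF f] and gF = FC_F[OF g]
  let ?h = "\<lambda>x. f x - g x"
  have hF: "?h \<in> \<F>" by (rule F_diff[OF fF gF])
  have h: "?h \<in> \<F>C" by (rule FC_I[OF hF continuous_on_diff[OF FC_cont[OF f] FC_cont[OF g]]])
  interpret h: finite_measure "\<Gamma> ?h" by (rule finite_energy_measure[OF hF])
  have "closed (K \<inter> ?h -` {a})" by (rule continuous_closed_preimage[OF FC_cont[OF h] closed_K]) simp
  moreover have "K \<inter> ?h -` {a} = {x\<in>K. ?h x = a}" by auto
  ultimately have "{x\<in>K. ?h x = a} \<in> sets (borel_on K)" by (auto simp: sets_borel_on borel_closed)
  moreover have "A \<subseteq> {x\<in>K. ?h x = a}" using A eq by (auto simp: sets_borel_on)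
  ultimately have "measure (\<Gamma> ?h) A \<le> measure (\<Gamma> ?h) {x\<in>K. ?h x = a}"
    by (intro h.finite_measure_mono) (simp_all add: sets_energy_measure[OF hF])
  then have zero: "measure (\<Gamma> ?h) A = 0"
    using energy_measure_level_set[OF h] measure_nonneg[of "\<Gamma> ?h" A] by simp
  have le: "measure (\<Gamma> f) A \<le> l powr (1 - p) * measure (\<Gamma> g) A" if "0 < l" "l < 1" for l
  proof -
    have "emeasure (\<Gamma> f) A \<le> ennreal (l powr (1 - p)) * emeasure (\<Gamma> g) A
        + ennreal ((1 - l) powr (1 - p)) * emeasure (\<Gamma> ?h) A"
      using energy_measure_add_le[OF gF hF that A] by simp
    then show ?thesis
      using zero by (simp add: finite_measure.emeasure_eq_measure[OF finite_energy_measure[OF fF]]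
          finite_measure.emeasure_eq_measure[OF finite_energy_measure[OF gF]] h.emeasure_eq_measure
          flip: ennreal_mult)
  qed
  have "(\<lambda>n. (1 - 1 / (real n + 2)) powr (1 - p) * measure (\<Gamma> g) A) \<longlonglongrightarrow> 1 powr (1 - p) * measure (\<Gamma> g) A"
  proof (intro tendsto_intros)
    show "(\<lambda>n. 1 - 1 / (real n + 2)) \<longlonglongrightarrow> 1" by real_asymp
  qed auto
  moreover have "measure (\<Gamma> f) A \<le> (1 - 1 / (real n + 2)) powr (1 - p) * measure (\<Gamma> g) A" for n
    by (rule le) (auto simp: field_simps)
  ultimately have "measure (\<Gamma> f) A \<le> 1 powr (1 - p) * measure (\<Gamma> g) A"
    by (intro LIMSEQ_le_const) blast+
  then show ?thesis by simp
qed

lemma energy_measure_local: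
  assumes f: "f \<in> \<F>C" and g: "g \<in> \<F>C" and A: "A \<in> sets (borel_on K)" and eq: "\<forall>x\<in>A. f x - g x = a"
  shows "emeasure (\<Gamma> f) A = emeasure (\<Gamma> g) A"
proof -
  have "\<forall>x\<in>A. g x - f x = - a" using eq by (auto simp: algebra_simps)
  from energy_measure_local_le[OF f g A eq] energy_measure_local_le[OF g f A this] show ?thesis
    by (simp add: finite_measure.emeasure_eq_measure[OF finite_energy_measure[OF FC_F]] f g)
qed

lemma energy_measure_chain:
  assumes f: "f \<in> \<F>C" and \<Psi>: "\<Psi> C1_differentiable_on UNIV"
  shows "\<Psi> \<circ> f \<in> \<F> \<and> \<Gamma> (\<Psi> \<circ> f) = density (\<Gamma> f) (\<lambda>x. ennreal (\<bar>deriv \<Psi> (f x)\<bar> powr p))"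
proof -
  obtain D where D: "\<And>t. (\<Psi> has_vector_derivative D t) (at t)" "continuous_on UNIV D"
    using \<Psi> unfolding C1_differentiable_on_def by blast
  have d: "(\<Psi> has_field_derivative D t) (at t)" for t
    using D(1) by (simp add: has_real_derivative_iff_has_vector_derivative)
  then have "deriv \<Psi> = D" by (intro ext DERIV_imp_deriv)
  then show ?thesis using chain_in_F[OF f d D(2)] chain_rule[OF f d D(2)] by simp
qed

end

theorem theorem1p2:
  fixes K :: "plane set" and m :: "plane measure" and p \<rho> :: real
    and E :: "(plane \<Rightarrow> real) \<Rightarrow> real"
  assumes p: "1 < p"
    and K: "is_carpet K"
    and m: "is_carpet_measure K m"
    and rho: "is_scaling_factor K p \<rho>"
    and banach: "seminorm_on (sobolev K m p \<rho>) (sobolev_norm K m p \<rho>)"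
      "complete_on (sobolev K m p \<rho>) (sobolev_norm K m p \<rho>)"
    and reflexive: "reflexive_on (sobolev K m p \<rho>) (sobolev_norm K m p \<rho>)"
    and separable: "separable_on (sobolev K m p \<rho>) (sobolev_norm K m p \<rho>)"
    and dense: "dense_subset_on (sobolev K m p \<rho>) (sobolev_norm K m p \<rho>) (sobolev_cont K m p \<rho>)"
    and dense_C: "\<forall>f. continuous_on K f \<longrightarrow>
      (\<forall>\<epsilon>>0. \<exists>g\<in>sobolev_cont K m p \<rho>. \<forall>x\<in>K. \<bar>f x - g x\<bar> < \<epsilon>)"
    and E: "self_similar_energy K m p \<rho> E"
  shows "\<exists>\<Gamma> :: (plane \<Rightarrow> real) \<Rightarrow> plane measure.
    (\<forall>f\<in>sobolev K m p \<rho>. finite_measure (\<Gamma> f) \<and> sets (\<Gamma> f) = sets (borel_on K)) \<and>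
    (\<forall>f\<in>sobolev K m p \<rho>. \<forall>g\<in>sobolev K m p \<rho>. (AE x in m. f x = g x) \<longrightarrow> \<Gamma> f = \<Gamma> g) \<and>
    \<comment> \<open>(i)\<close>
    (\<forall>f\<in>sobolev K m p \<rho>. measure (\<Gamma> f) K = E f \<and>
       (\<forall>n\<ge>1. \<forall>w\<in>words n. measure (\<Gamma> f) (word_map w ` K) = \<rho> ^ n * E (f \<circ> word_map w))) \<and>
    \<comment> \<open>(ii)\<close>
    (\<forall>f\<^sub>1\<in>sobolev K m p \<rho>. \<forall>f\<^sub>2\<in>sobolev K m p \<rho>. \<forall>g\<in>borel_measurable (borel_on K).
       ennreal_powr (\<integral>\<^sup>+ x. g x \<partial>\<Gamma> (\<lambda>x. f\<^sub>1 x + f\<^sub>2 x)) (1/p)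
       \<le> ennreal_powr (\<integral>\<^sup>+ x. g x \<partial>\<Gamma> f\<^sub>1) (1/p) + ennreal_powr (\<integral>\<^sup>+ x. g x \<partial>\<Gamma> f\<^sub>2) (1/p)) \<and>
    \<comment> \<open>(iii)\<close>
    (\<forall>f\<in>sobolev K m p \<rho>. \<forall>g\<in>borel_measurable (borel_on K). \<forall>\<phi> :: real \<Rightarrow> real.
       1-lipschitz_on UNIV \<phi> \<longrightarrow> (\<integral>\<^sup>+ x. g x \<partial>\<Gamma> (\<phi> \<circ> f)) \<le> (\<integral>\<^sup>+ x. g x \<partial>\<Gamma> f)) \<and>
    \<comment> \<open>(iv)\<close>
    (\<forall>n\<ge>1. \<forall>f\<in>sobolev K m p \<rho>. \<forall>A\<in>sets (borel_on K).
       emeasure (\<Gamma> f) A =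
         ennreal (\<rho> ^ n) *
         (\<Sum>w\<in>words n. emeasure (distr (\<Gamma> (f \<circ> word_map w)) (borel_on K) (word_map w)) A)) \<and>
    \<comment> \<open>(v); the push-forward of a measure \<open>\<mu>\<close> is \<open>A \<mapsto> \<mu> (\<Phi> -` A)\<close>, hence the inverse on the right\<close>
    (\<forall>f\<in>sobolev K m p \<rho>. \<forall>\<Phi>\<in>carpet_symmetries.
       distr (\<Gamma> f) (borel_on K) \<Phi> = \<Gamma> (f \<circ> inv \<Phi>)) \<and>
    \<comment> \<open>(vi)\<close>
    (\<forall>f\<in>sobolev_cont K m p \<rho>. \<forall>\<Psi> :: real \<Rightarrow> real. \<Psi> C1_differentiable_on UNIV \<longrightarrow>
       \<Psi> \<circ> f \<in> sobolev K m p \<rho> \<and>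
       \<Gamma> (\<Psi> \<circ> f) = density (\<Gamma> f) (\<lambda>x. ennreal (\<bar>deriv \<Psi> (f x)\<bar> powr p))) \<and>
    (\<forall>f\<in>sobolev_cont K m p \<rho>. \<forall>g\<in>sobolev_cont K m p \<rho>. \<forall>A\<in>sets (borel_on K). \<forall>a.
       (\<forall>x\<in>A. f x - g x = a) \<longrightarrow> emeasure (\<Gamma> f) A = emeasure (\<Gamma> g) A)"
proof -
  interpret carpet_energy K m p \<rho> E
    using p K m rho dense E by unfold_locales (simp_all add: is_scaling_factor_def)
  show ?thesis
    apply (intro exI[of _ energy_measure] conjI ballI allI impI)
    subgoal by (rule finite_energy_measure)
    subgoal by (rule sets_energy_measure)
    subgoal by (rule energy_measure_cong)
    subgoal by (rule energy_measure_total)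
    subgoal by (simp add: energy_measure_cell) (simp add: weight_def words_def)
    subgoal by (rule energy_measure_triangle)
    subgoal by (rule energy_measure_lipschitz)
    subgoal by (rule energy_measure_self_similar)
    subgoal by (rule energy_measure_symmetry)
    subgoal using energy_measure_chain by blast
    subgoal using energy_measure_chain by blast
    subgoal by (rule energy_measure_local) blast+
    done
qed

end
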